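(* For positive integers $a,b$ define \[ G^T_{a,b}(x) = \frac{x^{a+2b} + x^{a} - x^{2a+b} - x^{b} - x^{a+b}}{x^{\min\{a,b\}}} \in \mathbb{Z}[x], \] which equals $x^{a+b}P^T(x^a,x^b)/x^{\min\{a,b\}}$ for $P^T(x,y) = y + y^{-1} - (x + x^{-1} + 1)$. Let $C^T_{a,b}(x)$ be the product of the distinct cyclotomic polynomials arising from the following three rules: (I) if $(a,b) = (a_1 d_1, b_1 d_1)$ with $d_1 \in \mathbb{Z}^{+}$ and $(a_1,b_1)$ congruent modulo $6$ to one of $(1,0)$, $(3,2)$, $(3,-2)$, $(5,0)$, then $\Phi_{6d_1}(x)$ arises; (II) if $(a,b) = (a_2 d_2, b_2 d_2)$ with $d_2 \in \mathbb{Z}^{+}$ and $(a_2,b_2)$ congruent modulo $10$ to one of $(2,\pm 1)$, $(4,\pm 3)$, $(6,\pm 3)$, $(8,\pm 1)$, then $\Phi_{10 d_2}(x)$ arises; (III) if $(a,b) = (a_3 d_3, b_3 d_3)$ with $d_3 \in \mathbb{Z}^{+}$ and $(a_3,b_3)$ congruent modulo $12$ to one of $(3,\pm 2)$, $(4,\pm 3)$, $(8,\pm 3)$, $(9,\pm 2)$, then $\Phi_{12 d_3}(x)$ arises. Then for all positive integers $a,b$: (a) the cyclotomic part of $G^T_{a,b}(x)$ is $C^T_{a,b}(x)$ (that is, $C^T_{a,b}(x)$ divides $G^T_{a,b}(x)$, each of its cyclotomic factors divides $G^T_{a,b}(x)$ with multiplicity exactly one, and $G^T_{a,b}(x)/C^T_{a,b}(x)$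 has no cyclotomic factor); (b) if $a \ne b$, then $G^T_{a,b}(x)$ is a product of irreducible reciprocal polynomials; (c) assuming Lehmer's Conjecture, there is an absolute constant $C$ such that if $\max\{a/b, b/a\} > C$, then $G^T_{a,b}(x)/C^T_{a,b}(x)$ is irreducible.
   Context: $\Phi_k(x)$ denotes the $k$-th cyclotomic polynomial. A non-zero polynomial $w(x) \in \mathbb{R}[x]$ is reciprocal if $w(x) = \pm x^{\deg w} w(1/x)$. The cyclotomic part of a polynomial in $\mathbb{Z}[x]$ is the product of its cyclotomic irreducible factors counted with multiplicity. The Mahler measure of $p(x) \in \mathbb{C}[x]$ is $M(p) = \exp\left(\int_0^1 \log|p(e^{2\pi i t})|\,dt\right)$. Lehmer's Conjecture asserts that every polynomial $p(x) \in \mathbb{Z}[x]$ that is irreducible over $\mathbb{Z}$ and not cyclotomic and not $\pm x$ satisfies $M(p) \ge M(x^{10}+x^9-x^7-x^6-x^5-x^4-x^3+x+1) = 1.176280818\ldots$ (equivalently: any $p \in \mathbb{Z}[x]$ with $M(p) > 1$ has $M(p) \ge 1.176280818\ldots$). *)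

theory Defs
  imports "HOL-Analysis.Analysis" "HOL-Computational_Algebra.Computational_Algebra"
    "HOL-Number_Theory.Cong"
begin

definition cyclo :: "nat \<Rightarrow> int poly" where
  "cyclo k = (THE p. map_poly of_int p =
      (\<Prod>z\<in>{z::complex. z ^ k = 1 \<and> (\<forall>j\<in>{1..<k}. z ^ j \<noteq> 1)}. [:- z, 1:]))"

definition is_cyclotomic :: "int poly \<Rightarrow> bool" where
  "is_cyclotomic p \<longleftrightarrow> (\<exists>k>0. p = cyclo k \<or> p = - cyclo k)"

definition reciprocal :: "'a::comm_ring_1 poly \<Rightarrow> bool" where
  "reciprocal w \<longleftrightarrow> w \<noteq> 0 \<and> (w = reflect_poly w \<or> w = - reflect_poly w)"

definition mahler_measure :: "complex poly \<Rightarrow> real" where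
  "mahler_measure p = exp (integral {0..1} (\<lambda>t. ln (cmod (poly p (cis (2 * pi * t))))))"

definition lehmer_poly :: "int poly" where
  "lehmer_poly = [:1, 1, 0, -1, -1, -1, -1, -1, 0, 1, 1:]"

definition lehmer_conjecture :: bool where
  "lehmer_conjecture \<longleftrightarrow>
     (\<forall>p::int poly. irreducible p \<and> \<not> is_cyclotomic p \<and> p \<noteq> [:0, 1:] \<and> p \<noteq> [:0, -1:] \<longrightarrow>
        mahler_measure (map_poly of_int p) \<ge> mahler_measure (map_poly of_int lehmer_poly))"

definition GT :: "nat \<Rightarrow> nat \<Rightarrow> int poly" where
  "GT a b = (let m = min a b in
     monom 1 (a + 2*b - m) + monom 1 (a - m) - monom 1 (2*a + b - m)
     - monom 1 (b - m) - monom 1 (a + b - m))"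

definition CT_indices :: "nat \<Rightarrow> nat \<Rightarrow> nat set" where
  "CT_indices a b =
     {6 * d | d. d > 0 \<and> d dvd a \<and> d dvd b \<and>
        (let a1 = int (a div d); b1 = int (b div d) in
          ([a1 = 1] (mod 6) \<and> [b1 = 0] (mod 6)) \<or> ([a1 = 3] (mod 6) \<and> [b1 = 2] (mod 6)) \<or>
          ([a1 = 3] (mod 6) \<and> [b1 = -2] (mod 6)) \<or> ([a1 = 5] (mod 6) \<and> [b1 = 0] (mod 6)))}
   \<union> {10 * d | d. d > 0 \<and> d dvd a \<and> d dvd b \<and>
        (let a2 = int (a div d); b2 = int (b div d) in
          ([a2 = 2] (mod 10) \<and> ([b2 = 1] (mod 10) \<or> [b2 = -1] (mod 10))) \<or>
          ([a2 = 4] (mod 10) \<and> ([b2 = 3] (mod 10) \<or> [b2 = -3] (mod 10))) \<or>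
          ([a2 = 6] (mod 10) \<and> ([b2 = 3] (mod 10) \<or> [b2 = -3] (mod 10))) \<or>
          ([a2 = 8] (mod 10) \<and> ([b2 = 1] (mod 10) \<or> [b2 = -1] (mod 10))))}
   \<union> {12 * d | d. d > 0 \<and> d dvd a \<and> d dvd b \<and>
        (let a3 = int (a div d); b3 = int (b div d) in
          ([a3 = 3] (mod 12) \<and> ([b3 = 2] (mod 12) \<or> [b3 = -2] (mod 12))) \<or>
          ([a3 = 4] (mod 12) \<and> ([b3 = 3] (mod 12) \<or> [b3 = -3] (mod 12))) \<or>
          ([a3 = 8] (mod 12) \<and> ([b3 = 3] (mod 12) \<or> [b3 = -3] (mod 12))) \<or>
          ([a3 = 9] (mod 12) \<and> ([b3 = 2] (mod 12) \<or> [b3 = -2] (mod 12))))}"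

definition CT :: "nat \<Rightarrow> nat \<Rightarrow> int poly" where
  "CT a b = (\<Prod>k\<in>CT_indices a b. cyclo k)"

end

theory Submission
  imports Defs "HOL-Number_Theory.Totient"
begin

text \<open>
  Up to a power of \<open>x\<close>, \<open>GT a b\<close> is \<open>F = x\<^sup>b + x\<^sup>-\<^sup>b - x\<^sup>a - x\<^sup>-\<^sup>a - 1\<close>.

  Cyclotomic part: with \<open>x = z\<^sup>a\<close>, \<open>y = z\<^sup>b\<close> for a primitive \<open>k\<close>-th root of unity \<open>z\<close>, a zero of \<open>F\<close> means
  \<open>(y + 1/y) - (x + 1/x) = 1\<close>. If all primitive \<open>k\<close>-th roots are zeros, averaging over them gives
  \<open>2 \<mu>(s)/\<phi>(s) - 2 \<mu>(r)/\<phi>(r) = 1\<close> for the orders \<open>r\<close>, \<open>s\<close> of \<open>x\<close>, \<open>y\<close>. This leaves five pairs \<open>(r, s)\<close>, and at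
  each of them the derivative of \<open>F\<close> does not vanish.

  Reciprocal factors: a non-reciprocal irreducible factor \<open>f\<close> with reversal \<open>f*\<close> would give
  \<open>F = f f* h\<close>, so \<open>W = f f h\<close> satisfies \<open>W W* = F F*\<close>. Comparing coefficients, whose squares sum to 5, forces
  \<open>W = \<plusminus>F\<close>, hence \<open>f = \<plusminus>f*\<close>.

  Irreducibility: for \<open>b/a\<close> or \<open>a/b\<close> large, the mean of \<open>log \<bar>F\<bar>\<close> over the unit circle is bounded by the mean of
  \<open>log \<bar>F - \<i>\<epsilon>\<bar>\<close>, which is close to a double integral over the torus. By Jensen's formula in the fast variable, the inner
  integral is near zero except on a third of the range of the slow variable, where it is at most about
  \<open>log ((3 + \<surd>5)/2)\<close>. So the Mahler measure of \<open>GT a b\<close> is less than \<open>(47/40)\<^sup>2\<close>, while the Lehmer polynomial has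
  a root larger than \<open>47/40\<close>: there is no room for two non-cyclotomic factors.
\<close>

subsection \<open>Coefficient sequences with the autocorrelation of \<open>GT\<close>\<close>

text \<open>The coefficient comparison is Ljunggren's method: five coefficients of size 1 leave so
  little freedom that reading the correlation from the largest shift downwards determines all of
  them up to a common sign.

  The averaged Moebius equation is decisive only when both orders have totient above 2; a smaller
  totient makes one of the two traces a rational integer in [-2, 2]. Simplicity of the zeros comes
  down to the irrationality of sqrt 3 and sqrt 5.

  The Mahler estimate has almost no slack. The limiting upper bound is ((3 + sqrt 5)/2)^(1/3) =
  1.378..., while two non-cyclotomic factors would need the square of Lehmer's constant, 1.3836....
  The rational 47/40 = 1.175 lies just below Lehmer's constant, and its sixth power still exceeds (3
  + sqrt 5)/2. The obstacle is that log |F| is unbounded near the zeros of F, so no Lipschitz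
  estimate compares it with a torus integral. The imaginary shift supplies one with constant 4
  pi/\<epsilon>; since \<epsilon> has to be tiny to preserve the slack, the ratio of the exponents
  has to be very large.\<close>

lemma sum_squares_eq_1:
  fixes f :: "'a \<Rightarrow> int"
  assumes "finite A" "(\<Sum>i\<in>A. (f i)\<^sup>2) = 1"
  obtains r where "r \<in> A" "f r = 1 \<or> f r = -1" "\<And>i. i \<in> A \<Longrightarrow> i \<noteq> r \<Longrightarrow> f i = 0"
proof -
  obtain r where r: "r \<in> A" "f r \<noteq> 0"
  proof (rule ccontr)
    assume "\<not> thesis"
    then have "\<forall>i\<in>A. f i = 0" using that by blast
    then have "(\<Sum>i\<in>A. (f i)\<^sup>2) = 0" by simp
    with assms(2) show False by simp
  qed
  have s: "(\<Sum>i\<in>A. (f i)\<^sup>2) = (f r)\<^sup>2 + (\<Sum>i\<in>A - {r}. (f i)\<^sup>2)"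
    using assms(1) r(1) by (rule sum.remove)
  have nn: "0 \<le> (\<Sum>i\<in>A - {r}. (f i)\<^sup>2)" by (intro sum_nonneg) auto
  have "(f r)\<^sup>2 \<ge> 1" using r(2) by (smt (verit) zero_less_power2)
  with s nn assms(2) have 1: "(f r)\<^sup>2 = 1" "(\<Sum>i\<in>A - {r}. (f i)\<^sup>2) = 0" by linarith+
  have "f i = 0" if "i \<in> A" "i \<noteq> r" for i
    using 1(2) that assms(1) by (subst (asm) sum_nonneg_eq_0_iff) auto
  then show thesis using that r(1) 1(1) by (auto simp: power2_eq_1_iff)
qed

text \<open>Laurent coefficients of \<open>F\<close>, indexed symmetrically about 0;
  \<open>e\<close> is the sign of the outermost pair, which is 1 exactly when \<open>b\<close> is
  the larger exponent.\<close>

definition pentanomial_coeff :: "int \<Rightarrow> int \<Rightarrow> int \<Rightarrow> int \<Rightarrow> int" where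
  "pentanomial_coeff e N m i = (if \<bar>i\<bar> = N then e else if \<bar>i\<bar> = m then - e else if i = 0 then - 1 else 0)"

lemma sum_outside:
  fixes w :: "int \<Rightarrow> int"
  assumes "finite T" "T \<subseteq> {-N..N}" "\<And>i. i \<in> {-N..N} - T \<Longrightarrow> w i * w (i - k) = 0"
  shows "(\<Sum>i\<in>{-N..N}. w i * w (i - k)) = (\<Sum>i\<in>T. w i * w (i - k))"
  using assms by (intro sum.mono_neutral_right) auto

text \<open>Only the five support points contribute, and the one at \<open>-N\<close> drops out
  because its shift leaves the support. The right side stays unevaluated, so that coincidences such
  as \<open>N = 2 * m\<close> have to be settled only at the few shifts that are used.\<close>

lemma autocorrelation_pentanomial_coeff:
  assumes "0 < m" "m < N" "k > 0"
  shows "(\<Sum>i\<in>{-N..N}. pentanomial_coeff e N m i * pentanomial_coeff e N m (i - k)) =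
     e * pentanomial_coeff e N m (N - k) - e * pentanomial_coeff e N m (m - k) - e * pentanomial_coeff e N m (- m - k) - pentanomial_coeff e N m (- k)"
proof -
  have "(\<Sum>i\<in>{-N..N}. pentanomial_coeff e N m i * pentanomial_coeff e N m (i - k)) =
     (\<Sum>i\<in>{N, -N, m, -m, 0}. pentanomial_coeff e N m i * pentanomial_coeff e N m (i - k))"
    using assms by (intro sum_outside) (auto simp: pentanomial_coeff_def)
  also have "\<dots> = e * pentanomial_coeff e N m (N - k) + e * pentanomial_coeff e N m (-N - k)
     - e * pentanomial_coeff e N m (m - k) - e * pentanomial_coeff e N m (- m - k) - pentanomial_coeff e N m (- k)"
    using assms by (simp add: pentanomial_coeff_def[of e N m N] pentanomial_coeff_def[of e N m "-N"] pentanomial_coeff_def[of e N m m]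
       pentanomial_coeff_def[of e N m "-m"] pentanomial_coeff_def[of e N m 0])
  also have "pentanomial_coeff e N m (-N - k) = 0" using assms by (auto simp: pentanomial_coeff_def)
  finally show ?thesis by simp
qed

text \<open>Large shifts see only the outermost entries, so the correlation can be read from the
  outside in. Of the square sum 5 the two ends use 2, the outermost inner pair at distance
  \<open>P\<close> uses 2, and a single entry at \<open>r\<close> remains to be located. Fixing both
  ends to 1 removes the common sign; hence the factor \<open>e\<close> in the conclusion.\<close>

lemma same_autocorrelation_normalized:
  fixes w :: "int \<Rightarrow> int"
  assumes mN: "0 < m" "m < N" and e: "e = 1 \<or> e = -1"
    and supp: "\<And>i. \<bar>i\<bar> > N \<Longrightarrow> w i = 0"
    and ends: "w N = 1" "w (-N) = 1"
    and sq: "(\<Sum>i\<in>{-N..N}. (w i)\<^sup>2) = 5"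
    and ac: "\<And>k. k > 0 \<Longrightarrow> (\<Sum>i\<in>{-N..N}. w i * w (i - k)) =
               (\<Sum>i\<in>{-N..N}. pentanomial_coeff e N m i * pentanomial_coeff e N m (i - k))"
  shows "w i = e * pentanomial_coeff e N m i"
proof -
  define G where "G k = e * pentanomial_coeff e N m (N - k) - e * pentanomial_coeff e N m (m - k) - e * pentanomial_coeff e N m (- m - k)
     - pentanomial_coeff e N m (- k)" for k
  have ac': "(\<Sum>i\<in>{-N..N}. w i * w (i - k)) = G k" if "k > 0" for k
    using ac[OF that] autocorrelation_pentanomial_coeff[OF mN that] by (simp add: G_def)
  have circ: "e * e = 1" using e by auto
  define M where "M = {i\<in>{-N..N}. \<bar>i\<bar> < N}"
  have finM: "finite M"
    unfolding M_def by (rule finite_subset[of _ "{-N..N}"]) auto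
  have M: "{-N..N} = insert N (insert (-N) M)" "N \<notin> insert (-N) M" "-N \<notin> M" "finite M"
    using mN finM by (auto simp: M_def)
  have sqM: "(\<Sum>i\<in>M. (w i)\<^sup>2) = 3"
    using sq M ends by simp
  define S where "S = {i\<in>M. w i \<noteq> 0}"
  have "S \<noteq> {}"
  proof
    assume "S = {}"
    then have "(\<Sum>i\<in>M. (w i)\<^sup>2) = 0" by (intro sum.neutral) (auto simp: S_def)
    with sqM show False by simp
  qed
  define P where "P = Max (abs ` S)"
  have finS: "finite S" using M by (simp add: S_def)
  have "P \<in> abs ` S" unfolding P_def using finS \<open>S \<noteq> {}\<close> by (intro Max_in) auto
  then have P: "P \<ge> 0" "P < N" "w P \<noteq> 0 \<or> w (-P) \<noteq> 0"
    by (auto simp: S_def M_def abs_if split: if_splits)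
  have Pmax: "w i = 0" if "P < \<bar>i\<bar>" "\<bar>i\<bar> \<noteq> N" for i
  proof (rule ccontr)
    assume "w i \<noteq> 0"
    moreover from this have "\<not> N < \<bar>i\<bar>" using supp by blast
    ultimately have "i \<in> S" using that by (auto simp: S_def M_def)
    then have "\<bar>i\<bar> \<le> P" unfolding P_def using finS by (intro Max_ge) auto
    with that show False by simp
  qed
  \<comment> \<open>If all inner entries lay closer than \<open>m\<close>, shift
    \<open>N + m\<close> would give 0, but the pentanomial gives -2 there.\<close>
  have Pm: "P \<ge> m"
  proof (rule ccontr)
    assume "\<not> P \<ge> m"
    then have "P < m" by simp
    have "(\<Sum>i\<in>{-N..N}. w i * w (i - (N + m))) = (\<Sum>i\<in>{N}. w i * w (i - (N + m)))"
    proof (rule sum_outside)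
      fix i assume i: "i \<in> {-N..N} - {N}"
      show "w i * w (i - (N + m)) = 0"
      proof (cases "i < m")
        case True
        then have "w (i - (N + m)) = 0" using i mN by (intro supp) auto
        then show ?thesis by simp
      next
        case False
        then have "w i = 0" using i mN \<open>P < m\<close> by (intro Pmax) auto
        then show ?thesis by simp
      qed
    qed (use mN in auto)
    also have "\<dots> = 0" using Pmax[of "-m"] \<open>P < m\<close> mN by simp
    finally have "G (N + m) = 0" using ac'[of "N + m"] mN by simp
    moreover have "G (N + m) = -2" using mN circ by (auto simp: G_def pentanomial_coeff_def)
    ultimately show False by simp
  qed
  have "P > 0" using Pm mN by simp
  \<comment> \<open>At shift \<open>N + P\<close> each end meets only the entry at distance
    \<open>P\<close> on the opposite side.\<close>
  have "(\<Sum>i\<in>{-N..N}. w i * w (i - (N + P))) = (\<Sum>i\<in>{N, P}. w i * w (i - (N + P)))"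
  proof (rule sum_outside)
    fix i assume i: "i \<in> {-N..N} - {N, P}"
    show "w i * w (i - (N + P)) = 0"
    proof (cases "i < P")
      case True
      then have "w (i - (N + P)) = 0" using i \<open>P > 0\<close> P by (intro supp) auto
      then show ?thesis by simp
    next
      case False
      then have "w i = 0" using i P by (intro Pmax) auto
      then show ?thesis by simp
    qed
  qed (use P in auto)
  also have "\<dots> = w (-P) + w P" using P ends by simp
  finally have top: "w (-P) + w P = G (N + P)" using ac'[of "N + P"] P mN by simp
  have GP: "G (N + P) = (if P = m then -2 else 0)"
    using mN P Pm circ by (auto simp: G_def pentanomial_coeff_def)
  define R where "R = {i\<in>M. \<bar>i\<bar> < P}"
  have "(\<Sum>i\<in>M. (w i)\<^sup>2) = (\<Sum>i\<in>insert P (insert (-P) R). (w i)\<^sup>2)"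
    using P M by (intro sum.mono_neutral_right) (auto simp: R_def M_def intro!: Pmax)
  also have "\<dots> = (w P)\<^sup>2 + (w (-P))\<^sup>2 + (\<Sum>i\<in>R. (w i)\<^sup>2)"
    using \<open>P > 0\<close> M by (subst sum.insert; (subst sum.insert)?) (auto simp: R_def)
  finally have sqR: "(w P)\<^sup>2 + (w (-P))\<^sup>2 + (\<Sum>i\<in>R. (w i)\<^sup>2) = 3" using sqM by simp
  have nnR: "0 \<le> (\<Sum>i\<in>R. (w i)\<^sup>2)" by (intro sum_nonneg) auto
  have bound: "\<bar>w P\<bar> \<le> 1" "\<bar>w (-P)\<bar> \<le> 1"
  proof -
    have "(w P)\<^sup>2 < 4" "(w (-P))\<^sup>2 < 4"
      using sqR nnR zero_le_power2[of "w P"] zero_le_power2[of "w (-P)"] by linarith+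
    then have "(w P)\<^sup>2 < 2\<^sup>2" "(w (-P))\<^sup>2 < 2\<^sup>2" by simp_all
    then show "\<bar>w P\<bar> \<le> 1" "\<bar>w (-P)\<bar> \<le> 1" 
      using power2_less_imp_less[of "\<bar>w P\<bar>" 2] power2_less_imp_less[of "\<bar>w (-P)\<bar>" 2] by auto
  qed
  have cases: "(P = m \<and> w P = -1 \<and> w (-P) = -1) \<or> (P > m \<and> w P = 1 \<and> w (-P) = -1)
      \<or> (P > m \<and> w P = -1 \<and> w (-P) = 1)"
    using bound top GP Pm P by (auto split: if_splits)
  then have "(\<Sum>i\<in>R. (w i)\<^sup>2) = 1" using sqR by auto
  then obtain r where r: "r \<in> R" "w r = 1 \<or> w r = -1" "\<And>i. i \<in> R \<Longrightarrow> i \<noteq> r \<Longrightarrow> w i = 0"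
    using M by (elim sum_squares_eq_1[rotated]) (auto simp: R_def)
  have rP: "\<bar>r\<bar> < P" using r by (auto simp: R_def)
  have w: "w x = (if x = N \<or> x = - N then 1 else if x = P then w P else if x = - P then w (-P)
      else if x = r then w r else 0)" for x
  proof -
    consider "\<bar>x\<bar> > P" "\<bar>x\<bar> \<noteq> N" | "\<bar>x\<bar> = P" | "\<bar>x\<bar> = N" | "x = r" | "\<bar>x\<bar> < P" "x \<noteq> r" by linarith
    then show ?thesis
    proof cases
      case 1 then show ?thesis using Pmax[of x] rP mN by auto
    next
      case 2 then show ?thesis using P ends by auto
    next
      case 3 then show ?thesis using ends mN by (auto simp: abs_if split: if_splits)
    next
      case 4 then show ?thesis using ends by simp
    next
      case 5 then have "x \<in> R" using P by (auto simp: R_def M_def)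
      then show ?thesis using r(3)[of x] 5 P by auto
    qed
  qed
  have A: "w (N - k) + w P * w (P - k) + w (-P) * w (-P - k) + w r * w (r - k) = G k" if "k > 0" for k
  proof -
    have "(\<Sum>i\<in>{-N..N}. w i * w (i - k)) = (\<Sum>i\<in>{N, P, -P, r}. w i * w (i - k))"
    proof (rule sum_outside)
      fix i assume i: "i \<in> {-N..N} - {N, P, -P, r}"
      show "w i * w (i - k) = 0"
      proof (cases "i = -N")
        case True
        then show ?thesis using supp[of "i - k"] that mN by auto
      next
        case False
        then have "w i = 0" using i by (subst w) auto
        then show ?thesis by simp
      qed
    qed (use P rP in auto)
    also have "\<dots> = w (N - k) + w P * w (P - k) + w (-P) * w (-P - k) + w r * w (r - k)"
      using P rP \<open>P > 0\<close> ends by (subst sum.insert; (subst sum.insert)?; (subst sum.insert)?) auto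
    finally show ?thesis using ac'[OF that] by simp
  qed
  define \<gamma> where "\<gamma> = w r"
  have \<gamma>: "\<gamma> = 1 \<or> \<gamma> = -1" using r by (simp add: \<gamma>_def)
  have GN: "G N = -2 * e + (if N = 2 * m then 1 else 0)"
    using mN circ by (auto simp: G_def pentanomial_coeff_def)
  show ?thesis
  proof (cases "P = m")
    case True
    then have c: "P = m" "w P = -1" "w (-P) = -1" using cases by auto
    have w': "w x = (if x = N \<or> x = - N then 1 else if x = m \<or> x = -m then -1
      else if x = r then \<gamma> else 0)" for x
      using w[of x] c by (auto simp: \<gamma>_def)
    have A': "w (N - k) - w (m - k) - w (-m - k) + \<gamma> * w (r - k) = G k" if "k > 0" for k
      using A[OF that] c by (simp add: \<gamma>_def)
    \<comment> \<open>Off the centre, the lone entry would meet exactly one end at shift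
      \<open>N + |r|\<close>. The possible coincidence \<open>k = 2 * m\<close> contributes 1 on
      both sides and cancels.\<close>
    have r0: "r = 0"
    proof (rule ccontr)
      assume "r \<noteq> 0"
      define k where "k = N + \<bar>r\<bar>"
      have k: "k > 0" "w (N - k) = (if r < 0 then \<gamma> else 0)" "w (m - k) = (if k = 2 * m then -1 else 0)"
        "w (-m - k) = 0" "w (r - k) = (if r > 0 then 1 else 0)"
        using \<open>r \<noteq> 0\<close> mN rP c by (auto simp: w' k_def)
      have "G k = (if k = 2 * m then 1 else 0)"
        using \<open>r \<noteq> 0\<close> mN rP c circ by (auto simp: G_def pentanomial_coeff_def k_def)
      with A'[OF k(1)] k(2-5) \<gamma> \<open>r \<noteq> 0\<close> show False
        by (auto split: if_splits)
    qed
    \<comment> \<open>Shift \<open>N\<close> counts the centre entry twice, once against each end,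
      and so fixes its sign.\<close>
    have "w 0 = \<gamma>" "w (m - N) = (if N = 2 * m then -1 else 0)" "w (-m - N) = 0" "w (-N) = 1"
      using r0 mN by (auto simp: w')
    with A'[of N] r0 mN GN have "\<gamma> = -e" by (auto split: if_splits)
    then show ?thesis using r0 mN e by (auto simp: w' pentanomial_coeff_def)
  next
    case False
    then obtain \<alpha> where \<alpha>: "w P = \<alpha>" "w (-P) = -\<alpha>" "\<alpha> = 1 \<or> \<alpha> = -1" "P > m"
      using cases Pm by auto
    have w': "w x = (if x = N \<or> x = - N then 1 else if x = P then \<alpha> else if x = -P then -\<alpha>
      else if x = r then \<gamma> else 0)" for x
      using w[of x] \<alpha> by (auto simp: \<gamma>_def)
    have A': "w (N - k) + \<alpha> * w (P - k) - \<alpha> * w (-P - k) + \<gamma> * w (r - k) = G k" if "k > 0" for k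
      using A[OF that] \<alpha> by (simp add: \<gamma>_def)
    \<comment> \<open>With \<open>P > m\<close> the value -2 at shift \<open>N + m\<close> can only
      come from accidental coincidences of positions. They pin down \<open>P\<close> and the
      absolute value of \<open>r\<close>, and shift \<open>N\<close> then refutes them.\<close>
    define k where "k = N + m"
    have k: "k > 0" "w (N - k) = (if r = -m then \<gamma> else 0)"
      "w (P - k) = (if 2 * P = k then -\<alpha> else if r = P - k then \<gamma> else 0)" "w (-P - k) = 0"
      "w (r - k) = (if r = m then 1 else if r - k = -P then -\<alpha> else 0)"
      using mN rP P \<alpha> by (auto simp: w' k_def)
    have Gk: "G k = -2" using mN circ by (auto simp: G_def pentanomial_coeff_def k_def)
    have 1: "2 * P = N + m" "\<bar>r\<bar> = m"
      using A'[OF k(1)] k(2-5) \<gamma> \<alpha> mN Gk P rP by (auto simp: k_def split: if_splits)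
    have 2: "w (P - N) = (if r = P - N then \<gamma> else 0)" "w (-P - N) = 0"
      "w (r - N) = (if r - N = -P then -\<alpha> else 0)" "w (N - N) = 0"
      using 1 mN P \<alpha> by (auto simp: w')
    \<comment> \<open>At most one term survives at shift \<open>N\<close>, with absolute value 1,
      while \<open>G N\<close> is 2 or -2. If \<open>N = 2 * m\<close>, no term survives and
      \<open>G N\<close> is odd.\<close>
    have "N \<noteq> 2 * m \<or> (r \<noteq> P - N \<and> r - N \<noteq> -P)" "r \<noteq> P - N \<or> r - N \<noteq> -P" 
      using 1 mN by auto
    moreover have "G N \<noteq> 0" "N \<noteq> 2 * m \<Longrightarrow> G N = 2 \<or> G N = -2" using GN e by auto
    ultimately have False using A'[of N] 2 \<alpha>(3) \<gamma> mN by (auto split: if_splits)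
    then show ?thesis ..
  qed
qed

section \<open>Transfer of the autocorrelation argument to integer polynomials\<close>

definition centred_coeff :: "nat \<Rightarrow> int poly \<Rightarrow> int \<Rightarrow> int" where
  "centred_coeff n p i = (if \<bar>i\<bar> \<le> int n then coeff p (nat (i + int n)) else 0)"

text \<open>From the degree upwards, the coefficients of the product with the reversal are
  autocorrelation sums; this turns an identity between such products into the hypotheses on
  sequences.\<close>

lemma coeff_mult_reflect_poly:
  fixes p :: "int poly"
  shows "coeff (p * reflect_poly p) (degree p + k) =
     (\<Sum>j\<le>degree p. coeff p j * (if j \<ge> k then coeff p (j - k) else 0))"
proof -
  have "coeff (p * reflect_poly p) (degree p + k) =
     (\<Sum>j\<le>degree p + k. coeff p j * coeff (reflect_poly p) (degree p + k - j))"
    by (rule coeff_mult)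
  also have "\<dots> = (\<Sum>j\<le>degree p. coeff p j * coeff (reflect_poly p) (degree p + k - j))"
    by (intro sum.mono_neutral_right) (auto simp: coeff_eq_0)
  also have "\<dots> = (\<Sum>j\<le>degree p. coeff p j * (if j \<ge> k then coeff p (j - k) else 0))"
    by (intro sum.cong) (auto simp: coeff_reflect_poly)
  finally show ?thesis .
qed

lemma sum_centred_coeff:
  assumes "degree p = 2 * n"
  shows "(\<Sum>i\<in>{- int n..int n}. centred_coeff n p i * centred_coeff n p (i - int k)) =
     coeff (p * reflect_poly p) (degree p + k)"
  unfolding coeff_mult_reflect_poly
proof (rule sum.reindex_bij_witness[of _ "\<lambda>j. int j - int n" "\<lambda>i. nat (i + int n)"], goal_cases)
  case (5 i)
  have "nat (i - int k + int n) = nat (i + int n) - k" by simp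
  then show ?case using 5 by (auto simp: centred_coeff_def)
qed (use assms in auto)

lemma sum_square_pentanomial_coeff:
  assumes "0 < m" "m < N" "e * e = 1"
  shows "(\<Sum>i\<in>{-N..N}. pentanomial_coeff e N m i * pentanomial_coeff e N m i) = 5"
proof -
  have "(\<Sum>i\<in>{-N..N}. pentanomial_coeff e N m i * pentanomial_coeff e N m (i - 0)) =
     (\<Sum>i\<in>{N,-N,m,-m,0}. pentanomial_coeff e N m i * pentanomial_coeff e N m (i - 0))"
    using assms by (intro sum_outside) (auto simp: pentanomial_coeff_def)
  also have "\<dots> = 5"
    using assms by (simp add: pentanomial_coeff_def)
  finally show ?thesis by simp
qed

lemma GT_symmetric_form:
  "GT a b = monom 1 (max a b + b) + monom 1 (max a b - b) - monom 1 (max a b + a)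
     - monom 1 (max a b - a) - monom 1 (max a b)"
proof -
  have "a + 2 * b - min a b = max a b + b" "a - min a b = max a b - b"
    "2 * a + b - min a b = max a b + a" "b - min a b = max a b - a" "a + b - min a b = max a b"
    by auto
  then show ?thesis by (simp add: GT_def Let_def)
qed

text \<open>For \<open>a = b\<close> the two pairs cancel and \<open>GT a b\<close> is
  \<open>- monom 1 a\<close>, whose factor x is not reciprocal.\<close>

locale GT_nondegenerate =
  fixes a b :: nat
  assumes ab: "a > 0" "b > 0" "a \<noteq> b"
begin

lemma coeff_GT:
  "coeff (GT a b) j = pentanomial_coeff (if a < b then 1 else -1) (int (max a b)) (int (min a b)) (int j - int (max a b))"
proof (cases "a < b")
  case True
  then have eq: "coeff (GT a b) j = (if b + b = j then 1 else 0) + (if b - b = j then 1 else 0)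
      - (if b + a = j then 1 else 0) - (if b - a = j then 1 else 0) - (if b = j then 1 else 0)"
    by (simp add: GT_symmetric_form max_def)
  consider "j = 2 * b" | "j = 0" | "j = b + a" | "j = b - a" | "j = b"
    | "j \<notin> {2 * b, 0, b + a, b - a, b}" by auto
  then show ?thesis unfolding eq
    using True ab by cases (auto simp: pentanomial_coeff_def max_def min_def)
next
  case False
  then have less: "b < a" using ab by simp
  then have eq: "coeff (GT a b) j = (if a + b = j then 1 else 0) + (if a - b = j then 1 else 0)
      - (if a + a = j then 1 else 0) - (if a - a = j then 1 else 0) - (if a = j then 1 else 0)"
    by (simp add: GT_symmetric_form max_def)
  consider "j = 2 * a" | "j = 0" | "j = a + b" | "j = a - b" | "j = a"
    | "j \<notin> {2 * a, 0, a + b, a - b, a}" by auto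
  then show ?thesis unfolding eq
    using less ab by cases (auto simp: pentanomial_coeff_def max_def min_def)
qed

lemma degree_GT: "degree (GT a b) = 2 * max a b"
proof (rule antisym)
  show "degree (GT a b) \<le> 2 * max a b"
    using ab by (intro degree_le) (auto simp: coeff_GT pentanomial_coeff_def)
  show "2 * max a b \<le> degree (GT a b)"
    using ab by (intro le_degree) (auto simp: coeff_GT pentanomial_coeff_def)
qed

lemma coeff_0_GT: "coeff (GT a b) 0 \<noteq> 0"
  using ab by (auto simp: coeff_GT pentanomial_coeff_def)

lemma reflect_poly_GT: "reflect_poly (GT a b) = GT a b"
proof (rule poly_eqI)
  fix j
  show "coeff (reflect_poly (GT a b)) j = coeff (GT a b) j"
  proof (cases "j \<le> 2 * max a b")
    case True
    have "pentanomial_coeff e N m (N - x) = pentanomial_coeff e N m (x - N)" for e N m x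
      by (simp add: pentanomial_coeff_def abs_minus_commute)
    moreover have "int (2 * max a b - j) - int (max a b) = int (max a b) - int j"
      using True by simp
    ultimately show ?thesis using True by (simp only: coeff_reflect_poly degree_GT coeff_GT) simp
  next
    case False
    then show ?thesis by (simp add: coeff_reflect_poly degree_GT coeff_eq_0)
  qed
qed

lemma centred_coeff_GT:
  "centred_coeff (max a b) (GT a b) = pentanomial_coeff (if a < b then 1 else -1) (int (max a b)) (int (min a b))"
proof
  fix i
  show "centred_coeff (max a b) (GT a b) i =
      pentanomial_coeff (if a < b then 1 else -1) (int (max a b)) (int (min a b)) i"
  proof (cases "\<bar>i\<bar> \<le> int (max a b)")
    case True
    then have "int (nat (i + int (max a b))) - int (max a b) = i" by linarith
    then show ?thesis using True by (simp only: centred_coeff_def coeff_GT if_True)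
  next
    case False
    then have "pentanomial_coeff e (int (max a b)) (int (min a b)) i = 0" for e
      by (auto simp: pentanomial_coeff_def)
    then show ?thesis using False by (simp add: centred_coeff_def)
  qed
qed

text \<open>The product with the reversal determines the degree and all autocorrelations of
  \<open>W\<close>, but not its sign. Multiplying by the leading coefficient \<open>s\<close>
  normalises both ends to 1.\<close>

lemma mult_reflect_poly_eq_GT_square:
  assumes W: "W * reflect_poly W = GT a b * GT a b"
  shows "W = GT a b \<or> W = - GT a b"
proof -
  define n where "n = max a b"
  define e where "e = (if a < b then 1 else -1 :: int)"
  define N m where "N = int n" and "m = int (min a b)"
  have mN: "0 < m" "m < N" using ab by (auto simp: m_def N_def n_def)
  have ne: "GT a b \<noteq> 0" using coeff_0_GT by auto
  \<comment> \<open>The constant coefficient of the product is the product of the two end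
    coefficients of \<open>W\<close>. Being 1, it makes them equal units.\<close>
  have "coeff W 0 * coeff (reflect_poly W) 0 = coeff (GT a b) 0 * coeff (GT a b) 0"
    using arg_cong[OF W, of "\<lambda>p. coeff p 0"] by (simp add: coeff_mult)
  also have "\<dots> = 1"
    using ab by (auto simp: coeff_GT pentanomial_coeff_def)
  finally have W0: "coeff W 0 * lead_coeff W = 1" by simp
  then have W0': "coeff W 0 \<noteq> 0" "W \<noteq> 0" by auto
  have "degree (W * reflect_poly W) = 2 * degree W"
    using W0' by (subst degree_mult_eq) auto
  with W have dW: "degree W = 2 * n"
    using ne by (simp add: degree_mult_eq degree_GT n_def)
  have cf: "(\<Sum>i\<in>{-N..N}. centred_coeff n W i * centred_coeff n W (i - k)) =
      (\<Sum>i\<in>{-N..N}. pentanomial_coeff e N m i * pentanomial_coeff e N m (i - k))" if "k \<ge> 0" for k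
  proof -
    have "centred_coeff n (GT a b) = pentanomial_coeff e N m"
      using centred_coeff_GT by (simp add: n_def N_def m_def e_def)
    then have "(\<Sum>i\<in>{-N..N}. pentanomial_coeff e N m i * pentanomial_coeff e N m (i - int (nat k))) =
        coeff (GT a b * reflect_poly (GT a b)) (degree (GT a b) + nat k)"
      using sum_centred_coeff[of "GT a b" n "nat k"] degree_GT by (simp only: n_def N_def)
    also have "\<dots> = coeff (W * reflect_poly W) (degree W + nat k)"
      by (simp only: W reflect_poly_GT dW degree_GT n_def)
    also have "\<dots> = (\<Sum>i\<in>{-N..N}. centred_coeff n W i * centred_coeff n W (i - int (nat k)))"
      using sum_centred_coeff[OF dW, of "nat k"] by (simp only: N_def)
    finally show ?thesis using that by simp
  qed
  have sq: "(\<Sum>i\<in>{-N..N}. (centred_coeff n W i)\<^sup>2) = 5"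
  proof -
    have "e * e = 1" by (simp add: e_def)
    then show ?thesis using cf[of 0] sum_square_pentanomial_coeff[OF mN, of e] by (simp add: power2_eq_square)
  qed
  define s where "s = lead_coeff W"
  have s: "coeff W 0 = s" "s = 1 \<or> s = -1"
    using W0 by (auto simp: s_def zmult_eq_1_iff)
  then have ss: "s * s = 1" by auto
  define w where "w i = s * centred_coeff n W i" for i
  have weq: "w i = e * pentanomial_coeff e N m i" for i
  proof (rule same_autocorrelation_normalized[OF mN, where w = w and e = e and i = i])
    show "e = 1 \<or> e = -1" by (simp add: e_def)
    show "w i = 0" if "\<bar>i\<bar> > N" for i using that by (simp add: w_def centred_coeff_def N_def)
    show "w N = 1" "w (-N) = 1"
    proof -
      have "centred_coeff n W N = coeff W (degree W)"
      proof -
        have "nat (N + int n) = degree W" using dW by (simp add: N_def)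
        then show ?thesis by (simp add: centred_coeff_def N_def)
      qed
      moreover have "centred_coeff n W (-N) = coeff W 0"
        by (simp add: centred_coeff_def N_def)
      ultimately show "w N = 1" "w (-N) = 1" using s(1) ss by (simp_all only: w_def s_def[symmetric])
    qed
    show "(\<Sum>i\<in>{-N..N}. (w i)\<^sup>2) = 5"
    proof -
      have "(w i)\<^sup>2 = (centred_coeff n W i)\<^sup>2" for i
        using s(2) by (auto simp: w_def)
      then show ?thesis using sq by simp
    qed
    show "(\<Sum>i\<in>{-N..N}. w i * w (i - k)) = (\<Sum>i\<in>{-N..N}. pentanomial_coeff e N m i * pentanomial_coeff e N m (i - k))"
      if "k > 0" for k
    proof -
      have "w i * w j = centred_coeff n W i * centred_coeff n W j" for i j
        using s(2) by (auto simp: w_def)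
      then show ?thesis using cf[of k] that by (simp only: order_less_imp_le)
    qed
  qed
  have GTc: "centred_coeff n (GT a b) = pentanomial_coeff e N m"
    using centred_coeff_GT by (simp add: n_def N_def m_def e_def)
  have eq0: "s * centred_coeff n W i = e * centred_coeff n (GT a b) i" for i
    unfolding GTc using weq[of i] unfolding w_def .
  have eq: "centred_coeff n W i = s * e * centred_coeff n (GT a b) i" for i
  proof -
    have "centred_coeff n W i = s * (s * centred_coeff n W i)" by (simp add: mult.assoc[symmetric] ss)
    then show ?thesis using eq0 by simp
  qed
  have "coeff W j = s * e * coeff (GT a b) j" for j
  proof (cases "j \<le> 2 * n")
    case True
    then have "nat (int j - int n + int n) = j" "\<bar>int j - int n\<bar> \<le> int n" by auto
    then show ?thesis using eq[of "int j - int n"] by (simp only: centred_coeff_def if_True)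
  next
    case False
    then show ?thesis using dW degree_GT by (simp add: coeff_eq_0 n_def)
  qed
  then have "W = smult (s * e) (GT a b)" by (intro poly_eqI) simp
  moreover have "s * e = 1 \<or> s * e = -1" using s by (auto simp: e_def)
  ultimately show ?thesis by auto
qed

text \<open>As \<open>GT a b\<close> is its own reversal, the prime \<open>f\<close> divides the
  reversal of \<open>f * g\<close>. If it divides its own reversal, it is reciprocal; otherwise the
  reversal of \<open>f\<close> occurs as a second factor, and exchanging that factor for
  \<open>f\<close> leaves the product with the reversal unchanged.\<close>

lemma irreducible_factor_GT_reciprocal:
  assumes f: "irreducible f" "f dvd GT a b"
  shows "reciprocal f"
proof (rule ccontr)
  assume nr: "\<not> reciprocal f"
  have f0: "f \<noteq> 0" using f by auto
  from f(2) obtain g where g: "GT a b = f * g" by (elim dvdE)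
  have cf: "coeff f 0 \<noteq> 0" "coeff g 0 \<noteq> 0"
    using coeff_0_GT by (auto simp: g coeff_mult)
  have pf: "prime_elem f" using f(1) by (simp add: prime_elem_iff_irreducible)
  have "reflect_poly f * reflect_poly g = f * g"
    using reflect_poly_GT by (simp add: g reflect_poly_mult)
  then have "f dvd reflect_poly f * reflect_poly g" by simp
  then have "f dvd reflect_poly g"
  proof (rule prime_elem_dvd_multD[OF pf, THEN disjE])
    \<comment> \<open>Equal degrees make the quotient a constant \<open>k\<close>, and reversing
      twice gives \<open>k * k = 1\<close>.\<close>
    assume "f dvd reflect_poly f"
    then obtain c where c: "reflect_poly f = f * c" by (elim dvdE)
    then have "degree c = 0" using f0 cf
      by (metis add_cancel_right_right degree_mult_eq degree_reflect_poly_eq mult_zero_right reflect_poly_eq_0_iff)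
    then obtain k where k: "c = [:k:]" by (elim degree_eq_zeroE)
    have "f = reflect_poly (reflect_poly f)" using cf by simp
    also have "\<dots> = smult (k * k) f" using c k by (simp add: reflect_poly_smult)
    finally have "coeff f 0 = k * k * coeff f 0" by (metis coeff_smult)
    then have "k * k = 1" using cf by simp
    then have "k = 1 \<or> k = -1" by (auto simp: zmult_eq_1_iff)
    with nr c k f0 show ?thesis by (auto simp: reciprocal_def)
  qed
  then obtain h where h: "reflect_poly g = f * h" by (elim dvdE)
  have ch: "coeff h 0 \<noteq> 0" using h cf
    by (metis coeff_0_reflect_poly_0_iff coeff_mult_0 degree_0 leading_coeff_0_iff mult_zero_right)
  have g': "g = reflect_poly f * reflect_poly h"
    using h cf by (metis reflect_poly_mult reflect_poly_reflect_poly)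
  define rf rh where "rf = reflect_poly f" and "rh = reflect_poly h"
  have refl: "reflect_poly rf = f" "reflect_poly rh = h" "reflect_poly f = rf" "reflect_poly h = rh"
    using cf ch by (simp_all add: rf_def rh_def)
  have rf0: "rf \<noteq> 0" "rh \<noteq> 0" using f0 ch by (auto simp: rf_def rh_def)
  have GT: "GT a b = f * (rf * rh)" using g g' by (simp add: rf_def rh_def)
  \<comment> \<open>Reversing the whole factorisation shows that the remaining cofactor is its own
    reversal.\<close>
  then have "f * (rf * rh) = f * (rf * h)"
    using reflect_poly_GT by (auto simp: reflect_poly_mult refl mult_ac)
  then have rh: "rh = h" using f0 rf0 by auto
  define W where "W = f * (f * rh)"
  have "reflect_poly W = rf * (rf * h)"
    by (simp add: W_def reflect_poly_mult refl)
  then have "W * reflect_poly W = GT a b * GT a b"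
    by (simp add: W_def GT rh mult_ac)
  then have "W = GT a b \<or> W = - GT a b" by (rule mult_reflect_poly_eq_GT_square)
  then have "f * (f * rh) = f * (rf * rh) \<or> f * (f * rh) = f * ((- rf) * rh)"
    by (simp add: W_def GT)
  then have "f = rf \<or> f = - rf"
    unfolding mult_cancel_left mult_cancel_right using f0 rf0 by blast
  with nr f0 show False by (simp add: reciprocal_def rf_def)
qed

lemma GT_product_of_reciprocal:
  "\<exists>fs. GT a b = prod_list fs \<and> (\<forall>f\<in>set fs. irreducible f \<and> reciprocal f)"
proof -
  have ne: "GT a b \<noteq> 0" using coeff_0_GT by auto
  have nu: "\<not> GT a b dvd 1" using degree_GT ab by (auto simp: is_unit_poly_iff)
  obtain fs where fs: "mset fs = prime_factorization (GT a b)" using ex_mset by blast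
  have "normalize (prod_list fs) = normalize (GT a b)"
    using prod_mset_prime_factorization_weak[OF ne] fs by (metis prod_mset_prod_list)
  then have dvd: "GT a b dvd prod_list fs" "prod_list fs dvd GT a b"
    by (metis associatedD1 associatedD2)+
  then obtain u v where uv: "GT a b = prod_list fs * u" "prod_list fs = GT a b * v"
    by (elim dvdE) blast
  then have "GT a b * (v * u) = GT a b * 1" by (metis mult.assoc mult.right_neutral)
  then have "v * u = 1" using ne by (simp only: mult_cancel_left) simp
  then have u: "u dvd 1" "GT a b = u * prod_list fs"
    using uv by (metis dvd_triv_right, metis mult.commute)
  have irr: "irreducible f" if "f \<in> set fs" for f
    using that fs by (metis in_prime_factors_iff set_mset_mset prime_elem_imp_irreducible prime_imp_prime_elem)
  obtain f0 fs' where fs': "fs = f0 # fs'" using u nu by (cases fs) auto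
  \<comment> \<open>Prime factorisation is exact only up to a unit; absorbing the unit into the
    first factor keeps that factor irreducible.\<close>
  define gs where "gs = u * f0 # fs'"
  have "GT a b = prod_list gs" using u by (simp add: gs_def fs' mult_ac)
  moreover have irr': "irreducible f" if "f \<in> set gs" for f
    using that irr u(1) fs' by (auto simp: gs_def irreducible_mult_unit_left)
  moreover have "reciprocal f" if "f \<in> set gs" for f
  proof (rule irreducible_factor_GT_reciprocal[OF irr'[OF that]])
    have "f dvd prod_list gs" using that by (auto dest!: split_list)
    then show "f dvd GT a b" using \<open>GT a b = prod_list gs\<close> by simp
  qed
  ultimately show ?thesis by blast
qed

end

subsection \<open>Cyclotomic polynomials\<close>

abbreviation cpoly :: "int poly \<Rightarrow> complex poly" where
  "cpoly \<equiv> map_poly of_int"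

section \<open>Integer polynomials and their complex root sets\<close>

lemma cpoly_mult: "cpoly (p * q) = cpoly p * cpoly q"
  by (intro poly_eqI) (simp add: coeff_map_poly coeff_mult)

lemma cpoly_add: "cpoly (p + q) = cpoly p + cpoly q"
  by (intro poly_eqI) (simp add: coeff_map_poly)

lemma cpoly_diff: "cpoly (p - q) = cpoly p - cpoly q"
  by (intro poly_eqI) (simp add: coeff_map_poly)

lemma cpoly_1: "cpoly 1 = 1"
  by (intro poly_eqI) (simp add: coeff_map_poly)

lemma cpoly_prod: "cpoly (prod f A) = (\<Prod>x\<in>A. cpoly (f x))"
  by (induction A rule: infinite_finite_induct) (simp_all add: cpoly_mult cpoly_1)

lemma cpoly_monom: "cpoly (monom c n) = monom (of_int c) n"
  by (intro poly_eqI) (simp add: coeff_map_poly)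

lemma cpoly_eq_iff: "cpoly p = cpoly q \<longleftrightarrow> p = q"
  by (auto simp: poly_eq_iff coeff_map_poly)

lemma cpoly_eq_0_iff: "cpoly p = 0 \<longleftrightarrow> p = 0"
  by (auto simp: poly_eq_iff coeff_map_poly)

lemma degree_cpoly: "degree (cpoly p) = degree p"
  by (intro degree_map_poly) simp

lemma lead_coeff_cpoly: "lead_coeff (cpoly p) = of_int (lead_coeff p)"
  by (simp add: degree_cpoly coeff_map_poly)

text \<open>Pseudo-division scales by powers of the leading coefficient, so for a monic divisor it
  is true division over the integers.\<close>

lemma monic_division:
  fixes A Q :: "int poly"
  assumes "lead_coeff Q = 1"
  obtains q r where "A = Q * q + r" "r = 0 \<or> degree r < degree Q"
proof -
  have "Q \<noteq> 0" using assms by auto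
  obtain q r where qr: "pseudo_divmod A Q = (q, r)" by (cases "pseudo_divmod A Q")
  have "A = Q * q + r" "r = 0 \<or> degree r < degree Q"
    using pseudo_divmod[OF \<open>Q \<noteq> 0\<close> qr] assms by simp_all
  then show thesis by (rule that)
qed

abbreviation lin_prod :: "complex set \<Rightarrow> complex poly" where
  "lin_prod S \<equiv> (\<Prod>z\<in>S. [:- z, 1:])"

lemma degree_lin_prod: "degree (lin_prod S) = card S"
  by (subst degree_prod_sum_eq) simp_all

lemma lead_coeff_lin_prod: "lead_coeff (lin_prod S) = 1"
  by (simp add: lead_coeff_prod)

lemma lin_prod_dvd:
  assumes "finite S" "\<And>z. z \<in> S \<Longrightarrow> poly p z = 0"
  shows "lin_prod S dvd p"
  using assms
proof (induction S arbitrary: p rule: finite_induct)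
  case (insert x S)
  then obtain q where q: "p = [:- x, 1:] * q" by (metis insertI1 poly_eq_0_iff_dvd dvdE)
  have "poly q z = 0" if "z \<in> S" for z
    using insert.prems[of z] that insert.hyps by (auto simp: q)
  then have "lin_prod S dvd q" by (rule insert.IH)
  then show ?case using insert.hyps by (auto simp: q simp del: mult_pCons_left intro: mult_dvd_mono)
qed simp

lemma lin_prod_eqI:
  assumes "finite S" "\<And>z. z \<in> S \<Longrightarrow> poly p z = 0" "degree p = card S" "lead_coeff p = 1"
  shows "p = lin_prod S"
proof -
  obtain q where q: "p = lin_prod S * q" using lin_prod_dvd[of S p] assms by blast
  have "p \<noteq> 0" using assms by auto
  then have "q \<noteq> 0" using q by auto
  have "lin_prod S \<noteq> 0" using assms(1) by simp
  then have "degree p = card S + degree q" using q \<open>q \<noteq> 0\<close> by (simp add: degree_mult_eq degree_lin_prod)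
  then have "degree q = 0" using assms by simp
  then obtain c where c: "q = [:c:]" by (elim degree_eq_zeroE)
  have "lead_coeff p = lead_coeff q"
    using lead_coeff_mult[of "lin_prod S" q] lead_coeff_lin_prod[of S] q by simp
  then have "c = 1" using c assms by simp
  then show ?thesis using q c by simp
qed

text \<open>\<open>A\<close> is monic, so division leaves an integer remainder of degree below
  \<open>card S\<close>; it vanishes on all of \<open>S\<close> and is therefore zero.\<close>

lemma int_poly_dvd_iff_roots:
  assumes A: "cpoly A = lin_prod S" and S: "finite S"
  shows "A dvd G \<longleftrightarrow> (\<forall>z\<in>S. poly (cpoly G) z = 0)"
proof
  assume "A dvd G"
  then obtain q where "G = A * q" by (elim dvdE)
  then show "\<forall>z\<in>S. poly (cpoly G) z = 0"
    using S by (auto simp: cpoly_mult A poly_prod)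
next
  assume roots: "\<forall>z\<in>S. poly (cpoly G) z = 0"
  have "of_int (lead_coeff A) = (1 :: complex)"
    using lead_coeff_cpoly[of A] lead_coeff_lin_prod[of S] A by simp
  then have lA: "lead_coeff A = 1" by simp
  have dA: "degree A = card S" using degree_cpoly[of A] A degree_lin_prod by simp
  obtain q r where qr: "G = A * q + r" "r = 0 \<or> degree r < degree A"
    using monic_division[OF lA] .
  have "r = 0"
  proof (rule ccontr)
    assume "r \<noteq> 0"
    then have "degree r < card S" using qr dA by simp
    have "poly (cpoly r) z = 0" if "z \<in> S" for z
    proof -
      have "prod ((-) z) S = 0" using S that by auto
      then show ?thesis using roots that by (auto simp: qr(1) cpoly_add cpoly_mult A poly_prod)
    qed
    then have "S \<subseteq> {z. poly (cpoly r) z = 0}" by auto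
    moreover have "finite {z. poly (cpoly r) z = 0}"
      using \<open>r \<noteq> 0\<close> by (intro poly_roots_finite) (simp add: cpoly_eq_0_iff)
    ultimately have "card S \<le> card {z. poly (cpoly r) z = 0}" by (rule card_mono[rotated])
    also have "\<dots> \<le> degree (cpoly r)"
      using \<open>r \<noteq> 0\<close> by (intro card_poly_roots_bound) (simp add: cpoly_eq_0_iff)
    finally show False using \<open>degree r < card S\<close> by (simp add: degree_cpoly)
  qed
  then show "A dvd G" using qr by simp
qed

text \<open>The remainder of the integer division would be a multiple of \<open>Q\<close> of smaller
  degree.\<close>

lemma integral_quotient:
  assumes "cpoly A = cpoly Q * R" "lead_coeff Q = 1"
  obtains p where "R = cpoly p"
proof -
  obtain q r where qr: "A = Q * q + r" "r = 0 \<or> degree r < degree Q"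
    using monic_division[OF assms(2)] .
  have eq: "cpoly Q * (R - cpoly q) = cpoly r"
    using assms(1) by (simp add: qr(1) cpoly_add cpoly_mult algebra_simps)
  have "R - cpoly q = 0"
  proof (rule ccontr)
    assume ne: "R - cpoly q \<noteq> 0"
    have "Q \<noteq> 0" using assms(2) by auto
    then have "cpoly Q \<noteq> 0" by (simp add: cpoly_eq_0_iff)
    with ne have "cpoly r \<noteq> 0" "degree (cpoly r) = degree Q + degree (R - cpoly q)"
      using eq[symmetric] by (simp_all add: degree_mult_eq degree_cpoly)
    then show False using qr(2) by (auto simp: cpoly_eq_0_iff degree_cpoly)
  qed
  then show thesis using that[of q] by simp
qed

section \<open>Primitive roots of unity and the integrality of cyclotomic polynomials\<close>

definition primitive_roots :: "nat \<Rightarrow> complex set" where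
  "primitive_roots k = {z. z ^ k = 1 \<and> (\<forall>j\<in>{1..<k}. z ^ j \<noteq> 1)}"

lemma prim_power_eq_1_iff:
  assumes "z \<in> primitive_roots k" "k > 0"
  shows "z ^ n = 1 \<longleftrightarrow> k dvd n"
proof
  assume "z ^ n = 1"
  have "z ^ n = z ^ (k * (n div k) + n mod k)" by simp
  also have "\<dots> = z ^ (n mod k)"
    using assms by (simp only: power_add power_mult) (simp add: primitive_roots_def)
  finally have "z ^ (n mod k) = 1" using \<open>z ^ n = 1\<close> by simp
  then have "n mod k \<notin> {1..<k}" using assms by (auto simp: primitive_roots_def)
  moreover have "n mod k < k" using assms by simp
  ultimately have "n mod k = 0" by auto
  then show "k dvd n" by auto
next
  assume "k dvd n"
  then show "z ^ n = 1" using assms by (auto simp: primitive_roots_def power_mult elim!: dvdE)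
qed

lemma primI: "(\<And>n. z ^ n = 1 \<longleftrightarrow> k dvd n) \<Longrightarrow> z \<in> primitive_roots k"
  by (auto simp: primitive_roots_def dest: dvd_imp_le)

lemma prim_unique: "z \<in> primitive_roots k \<Longrightarrow> z \<in> primitive_roots l \<Longrightarrow> k > 0 \<Longrightarrow> l > 0 \<Longrightarrow> k = l"
  using prim_power_eq_1_iff[of z k k] prim_power_eq_1_iff[of z k l]
    prim_power_eq_1_iff[of z l k] prim_power_eq_1_iff[of z l l] by (simp add: dvd_antisym)

lemma prim_power_eq: "z \<in> primitive_roots k \<Longrightarrow> k > 0 \<Longrightarrow> [m = n] (mod k) \<Longrightarrow> z ^ m = z ^ n"
proof -
  assume z: "z \<in> primitive_roots k" "k > 0" and mn: "[m = n] (mod k)"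
  have *: "z ^ m = z ^ (m mod k)" for m
  proof -
    have "z ^ m = z ^ (k * (m div k) + m mod k)" by simp
    also have "\<dots> = z ^ (m mod k)"
      using z by (simp only: power_add power_mult) (simp add: primitive_roots_def)
    finally show ?thesis .
  qed
  show "z ^ m = z ^ n" using *[of m] *[of n] mn by (simp add: cong_def)
qed

lemma finite_prim: "k > 0 \<Longrightarrow> finite (primitive_roots k)"
  by (rule finite_subset[OF _ finite_nth_roots[of k 1]]) (auto simp: primitive_roots_def)

lemma root_of_unity_prim:
  assumes "z ^ n = 1" "n > 0"
  obtains d where "d dvd n" "d > 0" "z \<in> primitive_roots d"
proof -
  define d where "d = (LEAST d. d > 0 \<and> z ^ d = 1)"
  have d: "d > 0" "z ^ d = 1"
    using LeastI[of "\<lambda>d. d > 0 \<and> z ^ d = 1" n] assms by (auto simp: d_def)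
  have "z ^ j \<noteq> 1" if "j \<in> {1..<d}" for j
    using not_less_Least[of j "\<lambda>d. d > 0 \<and> z ^ d = 1"] that by (auto simp: d_def)
  then have "z \<in> primitive_roots d" using d by (auto simp: primitive_roots_def)
  then show thesis using that d assms prim_power_eq_1_iff by blast
qed

lemma prim_nonempty:
  assumes "n > 0"
  shows "cis (2 * pi / real n) \<in> primitive_roots n"
proof -
  have "cis (2 * pi / real n) ^ j \<noteq> 1" if "j \<in> {1..<n}" for j
  proof
    assume 1: "cis (2 * pi / real n) ^ j = 1"
    have "cis (2 * pi * real j / real n) = cis (real j * (2 * pi / real n))"
      by (rule arg_cong[of _ _ cis]) simp
    also have "\<dots> = 1" using 1 Complex.DeMoivre[of "2 * pi / real n" j] by (simp only:)
    finally have "cis (2 * pi * real j / real n) = cis (2 * pi * real 0 / real n)" by simp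
    moreover have "inj_on (\<lambda>k. cis (2 * pi * real k / real n)) {..<n}"
      using Complex.bij_betw_roots_unity[OF assms] by (rule bij_betw_imp_inj_on)
    ultimately have "j = 0" using that assms inj_onD[of "\<lambda>k. cis (2 * pi * real k / real n)" "{..<n}" j 0] by auto
    with that show False by simp
  qed
  moreover have "cis (2 * pi / real n) ^ n = 1"
    using assms Complex.DeMoivre[of "2 * pi / real n" n] by simp
  ultimately show ?thesis by (simp add: primitive_roots_def)
qed

lemma roots_unity_eq_UN_prim:
  assumes "n > 0"
  shows "{z. z ^ n = 1} = (\<Union>d\<in>{d. d dvd n}. primitive_roots d)"
proof (intro equalityI subsetI)
  fix z :: complex assume "z \<in> {z. z ^ n = 1}"
  then show "z \<in> (\<Union>d\<in>{d. d dvd n}. primitive_roots d)" using assms root_of_unity_prim by blast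
next
  fix z assume "z \<in> (\<Union>d\<in>{d. d dvd n}. primitive_roots d)"
  then show "z \<in> {z. z ^ n = 1}" by (auto simp: primitive_roots_def power_mult elim!: dvdE)
qed

lemma lin_prod_UN_prim:
  assumes "finite I" "\<And>k. k \<in> I \<Longrightarrow> k > 0"
  shows "lin_prod (\<Union>k\<in>I. primitive_roots k) = (\<Prod>k\<in>I. lin_prod (primitive_roots k))"
  using assms by (intro prod.UNION_disjoint) (auto simp: finite_prim dest: prim_unique)

text \<open>This provides the witness for the definite description in \<open>cyclo\<close>. By
  induction the part of \<open>monom 1 n - 1\<close> that belongs to proper divisors is integral and
  monic, so the exact quotient is integral too.\<close>

lemma integral_lin_prod_prim:
  assumes "n > 0"
  shows "\<exists>p. cpoly p = lin_prod (primitive_roots n)"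
  using assms
proof (induction n rule: less_induct)
  case (less n)
  define D where "D = {d. d dvd n} - {n}"
  have D: "finite D" "n \<notin> D" "{d. d dvd n} = insert n D" "\<And>d. d \<in> D \<Longrightarrow> d > 0 \<and> d < n"
    using less.prems by (auto simp: D_def intro: Nat.gr0I dest: dvd_imp_le)
  have "\<forall>d\<in>D. \<exists>p. cpoly p = lin_prod (primitive_roots d)" using D(4) less.IH by blast
  then obtain P where P: "\<And>d. d \<in> D \<Longrightarrow> cpoly (P d) = lin_prod (primitive_roots d)" by metis
  have "cpoly (monom 1 n - 1) = lin_prod {z. z ^ n = 1}"
  proof (rule lin_prod_eqI)
    show "finite {z::complex. z ^ n = 1}" using less.prems by auto
    show "poly (cpoly (monom 1 n - 1)) z = 0" if "z \<in> {z. z ^ n = 1}" for z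
      using that by (simp add: cpoly_diff cpoly_1 cpoly_monom poly_monom)
    have d: "degree (monom 1 n - 1 :: int poly) = n"
      using less.prems by (intro antisym degree_le le_degree) (auto simp: )
    then show "degree (cpoly (monom 1 n - 1)) = card {z::complex. z ^ n = 1}"
      using less.prems by (simp add: degree_cpoly card_roots_unity_eq)
    show "lead_coeff (cpoly (monom 1 n - 1)) = 1"
      using less.prems by (simp add: lead_coeff_cpoly d)
  qed
  also have "\<dots> = (\<Prod>d\<in>{d. d dvd n}. lin_prod (primitive_roots d))"
    unfolding roots_unity_eq_UN_prim[OF less.prems]
    using less.prems by (intro lin_prod_UN_prim) (auto intro: Nat.gr0I)
  also have "\<dots> = cpoly (\<Prod>d\<in>D. P d) * lin_prod (primitive_roots n)"
    using D P by (simp add: cpoly_prod mult.commute)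
  finally have eq: "cpoly (monom 1 n - 1) = cpoly (\<Prod>d\<in>D. P d) * lin_prod (primitive_roots n)" .
  have "of_int (lead_coeff (\<Prod>d\<in>D. P d)) = (1::complex)"
    using P by (subst lead_coeff_cpoly[symmetric]) (simp add: cpoly_prod lead_coeff_prod)
  then have "lead_coeff (\<Prod>d\<in>D. P d) = 1" by simp
  from integral_quotient[OF eq this] show ?case by metis
qed

lemma cpoly_cyclo:
  assumes "k > 0"
  shows "cpoly (cyclo k) = lin_prod (primitive_roots k)"
proof -
  obtain p where p: "cpoly p = lin_prod (primitive_roots k)" using integral_lin_prod_prim[OF assms] by blast
  have "cyclo k = (THE q. cpoly q = lin_prod (primitive_roots k))" by (simp add: cyclo_def primitive_roots_def)
  also have "\<dots> = p"
    using p by (intro the_equality) (auto simp flip: cpoly_eq_iff)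
  finally show ?thesis using p by simp
qed

lemma cyclo_dvd_iff:
  "k > 0 \<Longrightarrow> cyclo k dvd G \<longleftrightarrow> (\<forall>z\<in>primitive_roots k. poly (cpoly G) z = 0)"
  using int_poly_dvd_iff_roots[OF cpoly_cyclo finite_prim] by blast

lemma bij_betw_totatives_prim:
  assumes z: "z \<in> primitive_roots n" and n: "n > 0"
  shows "bij_betw (\<lambda>j. z ^ j) (totatives n) (primitive_roots n)"
  unfolding bij_betw_def
proof
  have inj: "inj_on (\<lambda>j. z ^ j) {0<..n}"
  proof (rule linorder_inj_onI')
    fix i j assume ij: "i \<in> {0<..n}" "j \<in> {0<..n}" "i < j"
    show "z ^ i \<noteq> z ^ j"
    proof
      assume "z ^ i = z ^ j"
      moreover have "z ^ j = z ^ i * z ^ (j - i)" using ij by (simp flip: power_add)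
      moreover have "z \<noteq> 0" using z n by (auto simp: primitive_roots_def power_0_left)
      ultimately have "z ^ (j - i) = 1" by simp
      then have "n dvd j - i" using prim_power_eq_1_iff[OF z n] by blast
      then show False using ij by (auto dest!: dvd_imp_le)
    qed
  qed
  then show "inj_on (\<lambda>j. z ^ j) (totatives n)" by (rule inj_on_subset) (auto simp: totatives_def)
  have all: "(\<lambda>j. z ^ j) ` {0<..n} = {u. u ^ n = 1}"
  proof (rule card_subset_eq)
    show "(\<lambda>j. z ^ j) ` {0<..n} \<subseteq> {u. u ^ n = 1}"
      using prim_power_eq_1_iff[OF z n] by (auto simp flip: power_mult)
    show "card ((\<lambda>j. z ^ j) ` {0<..n}) = card {u::complex. u ^ n = 1}"
      using inj n by (simp add: card_image card_roots_unity_eq)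
  qed (use n in auto)
  show "(\<lambda>j. z ^ j) ` totatives n = primitive_roots n"
  proof (intro equalityI subsetI)
    fix u assume "u \<in> (\<lambda>j. z ^ j) ` totatives n"
    then obtain j where j: "coprime j n" "u = z ^ j" by (auto simp: totatives_def)
    have "u ^ i = 1 \<longleftrightarrow> n dvd i" for i
      using prim_power_eq_1_iff[OF z n, of "j * i"] j
      by (simp add: power_mult coprime_dvd_mult_right_iff coprime_commute)
    then show "u \<in> primitive_roots n" by (rule primI)
  next
    fix u assume u: "u \<in> primitive_roots n"
    then have "u \<in> {u. u ^ n = 1}" by (simp add: primitive_roots_def)
    then obtain j where j: "j \<in> {0<..n}" "u = z ^ j" using all by blast
    \<comment> \<open>The power of \<open>u\<close> with exponent \<open>n div g\<close> is already
      1, so a common divisor \<open>g > 1\<close> would contradict primitivity.\<close>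
    have "gcd j n = 1"
    proof -
      define g where "g = gcd j n"
      have g: "g > 0" "g dvd j" "g dvd n" using n by (auto simp: g_def)
      obtain j' where "j = g * j'" using g by (elim dvdE)
      then have "j * (n div g) = j' * n" using g by (simp add: mult_ac)
      then have "n dvd j * (n div g)" by simp
      then have "u ^ (n div g) = 1"
        using prim_power_eq_1_iff[OF z n, of "j * (n div g)"] j by (simp add: power_mult)
      then have "n dvd n div g" using prim_power_eq_1_iff[OF u n] by blast
      moreover have "n div g > 0" using g n by (simp add: div_greater_zero_iff dvd_imp_le)
      ultimately have "n \<le> n div g" by (rule dvd_imp_le)
      then have "\<not> g > 1" using n by (metis div_less_dividend not_le)
      then show "gcd j n = 1" using g(1) unfolding g_def by linarith
    qed
    then have "coprime j n" by (simp add: coprime_iff_gcd_eq_1)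
    then show "u \<in> (\<lambda>j. z ^ j) ` totatives n" using j by (auto simp: totatives_def)
  qed
qed

lemma card_prim: "n > 0 \<Longrightarrow> card (primitive_roots n) = totient n"
  using bij_betw_same_card[OF bij_betw_totatives_prim[OF prim_nonempty]] by (simp add: totient_def)

lemma power_mem_prim:
  assumes z: "z \<in> primitive_roots k" and k: "k > 0"
  shows "z ^ a \<in> primitive_roots (k div gcd a k)"
proof (rule primI)
  fix n
  define g where "g = gcd a k"
  have g: "g > 0" using k by (simp add: g_def)
  obtain a' k' where ak': "a = a' * g" "k = k' * g" and cop: "coprime a' k'"
    using gcd_coprime_exists[of a k] g unfolding g_def by blast
  have ak: "a = g * a'" "k = g * k'" "coprime a' k'"
    using cop by (simp_all add: mult.commute[of g] flip: ak')
  have "(z ^ a) ^ n = 1 \<longleftrightarrow> k dvd a * n"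
    using prim_power_eq_1_iff[OF z k, of "a * n"] by (simp add: power_mult)
  also have "\<dots> \<longleftrightarrow> k' dvd n"
    using g ak by (simp add: mult.assoc coprime_dvd_mult_right_iff coprime_commute)
  also have "k' = k div g" using g by (subst ak(2)) simp
  finally show "(z ^ a) ^ n = 1 \<longleftrightarrow> k div gcd a k dvd n" by (simp only: g_def)
qed

subsection \<open>Sums of primitive roots of unity\<close>

text \<open>For \<open>n > 0\<close> this is the Moebius function.\<close>

definition prim_sum :: "nat \<Rightarrow> complex" where
  "prim_sum n = \<Sum>(primitive_roots n)"

text \<open>Multiplication by a primitive \<open>p\<close>-th root of unity permutes the primitive
  \<open>n\<close>-th roots, so the sum is fixed by a factor different from 1.\<close>

lemma prim_sum_square_dvd:
  assumes n: "n > 0" and p: "prime p" "p * p dvd n"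
  shows "prim_sum n = 0"
proof -
  define w where "w = cis (2 * pi / real p)"
  have p0: "p > 0" "p > 1" using prime_gt_1_nat[OF p(1)] by simp_all
  have w: "w \<in> primitive_roots p" unfolding w_def using p0 by (intro prim_nonempty) auto
  have w0: "w \<noteq> 0" by (simp add: w_def)
  have maps: "z * w \<in> primitive_roots n" if z: "z \<in> primitive_roots n" for z
  proof (rule primI)
    fix j
    obtain m where "n = p * p * m" using p(2) by (elim dvdE)
    then have m: "n = p * (p * m)" by (simp only: mult.assoc)
    have wj: "w ^ j = 1 \<longleftrightarrow> p dvd j" for j using prim_power_eq_1_iff[OF w] p0 by blast
    have zj: "z ^ j = 1 \<longleftrightarrow> n dvd j" for j using prim_power_eq_1_iff[OF z n] by blast
    show "(z * w) ^ j = 1 \<longleftrightarrow> n dvd j"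
    proof
      assume 1: "(z * w) ^ j = 1"
      then have "((z * w) ^ j) ^ p = 1" by simp
      then have "z ^ (j * p) * w ^ (j * p) = 1" by (simp add: power_mult_distrib power_mult)
      moreover have "w ^ (j * p) = 1" by (simp add: wj)
      ultimately have "n dvd j * p" by (simp add: zj)
      then have "p dvd j" using m p0 by (simp add: mult.commute[of j]) (metis dvd_mult_left)
      then have "w ^ j = 1" by (simp add: wj)
      then show "n dvd j" using 1 by (simp add: power_mult_distrib zj)
    next
      assume "n dvd j"
      moreover have "p dvd n" using m by simp
      ultimately have "z ^ j = 1" "w ^ j = 1" by (auto simp: zj wj intro: dvd_trans)
      then show "(z * w) ^ j = 1" by (simp add: power_mult_distrib)
    qed
  qed
  have "inj_on (\<lambda>z. z * w) (primitive_roots n)" using w0 by (auto simp: inj_on_def)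
  moreover have "(\<lambda>z. z * w) ` primitive_roots n \<subseteq> primitive_roots n" using maps by auto
  ultimately have "bij_betw (\<lambda>z. z * w) (primitive_roots n) (primitive_roots n)"
    using finite_prim[OF n] by (metis bij_betw_imageI endo_inj_surj)
  then have "(\<Sum>z\<in>primitive_roots n. z * w) = prim_sum n"
    unfolding prim_sum_def by (rule sum.reindex_bij_betw)
  then have "prim_sum n * w = prim_sum n" by (simp add: prim_sum_def sum_distrib_right)
  moreover have "w \<noteq> 1" using prim_power_eq_1_iff[OF w, of 1] p0 by auto
  ultimately show ?thesis by simp
qed

text \<open>The preimage of the primitive \<open>m\<close>-th roots under the \<open>p\<close>-th
  power consists of the primitive roots of orders \<open>m\<close> and \<open>p * m\<close>, and the
  \<open>p\<close>-th roots of any single number sum to 0.\<close>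

lemma prim_sum_prime_mult:
  assumes m: "m > 0" and p: "prime p" "\<not> p dvd m"
  shows "prim_sum (p * m) = - prim_sum m"
proof -
  have p0: "p > 0" "p > 1" using prime_gt_1_nat[OF p(1)] by simp_all
  have cop: "coprime p m" using p by (simp add: prime_imp_coprime)
  have eq: "primitive_roots m \<union> primitive_roots (p * m) = {u. u ^ p \<in> primitive_roots m}"
  proof (intro equalityI subsetI)
    fix u assume "u \<in> primitive_roots m \<union> primitive_roots (p * m)"
    then show "u \<in> {u. u ^ p \<in> primitive_roots m}"
    proof
      assume "u \<in> primitive_roots m"
      then have "u ^ p \<in> primitive_roots (m div gcd p m)" using m by (intro power_mem_prim) auto
      then show ?thesis using cop by (simp add: coprime_iff_gcd_eq_1)
    next
      assume "u \<in> primitive_roots (p * m)"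
      then have "u ^ p \<in> primitive_roots ((p * m) div gcd p (p * m))" using m p0 by (intro power_mem_prim) auto
      then show ?thesis using p0 by simp
    qed
  next
    fix u assume "u \<in> {u. u ^ p \<in> primitive_roots m}"
    then have u: "u ^ p \<in> primitive_roots m" by simp
    have "u ^ (p * m) = 1" using u by (simp add: primitive_roots_def power_mult)
    then obtain d where d: "d dvd p * m" "d > 0" "u \<in> primitive_roots d"
      using root_of_unity_prim[of u "p * m"] m p0 by auto
    have "(u ^ p) ^ d = 1" using d(3) by (simp add: primitive_roots_def power_mult[symmetric] mult.commute[of p]) (simp add: power_mult)
    then have "m dvd d" using prim_power_eq_1_iff[OF u m] by blast
    then obtain e where e: "d = m * e" by (elim dvdE)
    then have "e dvd p" using d(1) m by (simp add: mult.commute[of p])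
    then have "e = 1 \<or> e = p" using p(1) by (simp add: prime_nat_iff)
    then show "u \<in> primitive_roots m \<union> primitive_roots (p * m)" using d(3) e by (auto simp: mult.commute)
  qed
  have disj: "primitive_roots m \<inter> primitive_roots (p * m) = {}"
  proof -
    have "m \<noteq> p * m" using m p0 by simp
    then show ?thesis using prim_unique[of _ m "p * m"] m p0 by auto
  qed
  have "prim_sum m + prim_sum (p * m) = \<Sum>{u. u ^ p \<in> primitive_roots m}"
    unfolding eq[symmetric] prim_sum_def using disj m p0
    by (intro sum.union_disjoint[symmetric]) (auto simp: finite_prim)
  also have "{u. u ^ p \<in> primitive_roots m} = (\<Union>v\<in>primitive_roots m. {u. u ^ p = v})" by auto
  also have "\<Sum>(\<Union>v\<in>primitive_roots m. {u. u ^ p = v}) = (\<Sum>v\<in>primitive_roots m. \<Sum>{u. u ^ p = v})"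
    using m p0 by (intro sum.UNION_disjoint) (auto simp: finite_prim)
  also have "\<dots> = 0" using sum_nth_roots p0 by (intro sum.neutral) auto
  finally show ?thesis by (simp add: add_eq_0_iff)
qed

lemma prim_1: "primitive_roots 1 = {1}"
  by (auto simp: primitive_roots_def)

lemma prim_sum_1: "prim_sum 1 = 1"
  unfolding prim_sum_def prim_1 by simp

lemma prim_sum_cases:
  assumes "n > 0"
  obtains s :: int where "prim_sum n = of_int s" "s \<in> {-1, 0, 1}"
proof -
  have "\<exists>s::int. prim_sum n = of_int s \<and> s \<in> {-1, 0, 1}"
    using assms
  proof (induction n rule: less_induct)
    case (less n)
    show ?case
    proof (cases "n = 1")
      case True
      then show ?thesis using prim_sum_1 by (intro exI[of _ 1]) simp
    next
      case False
      then obtain p where p: "prime p" "p dvd n" using prime_factor_nat by blast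
      then obtain m where m: "n = p * m" by (elim dvdE)
      show ?thesis
      proof (cases "p dvd m")
        case True
        then have "prim_sum n = 0" using p(1) less.prems by (intro prim_sum_square_dvd[of n p]) (auto simp: m)
        then show ?thesis by (intro exI[of _ 0]) simp
      next
        case False
        have "m > 0" "m < n" using less.prems m prime_gt_1_nat[OF p(1)] by auto
        with less.IH obtain s :: int where "prim_sum m = of_int s" "s \<in> {-1, 0, 1}" by blast
        then show ?thesis using prim_sum_prime_mult[OF \<open>m > 0\<close> p(1) False] m
          by (intro exI[of _ "-s"]) auto
      qed
    qed
  qed
  then show thesis using that by blast
qed

text \<open>Surjectivity of the map from units modulo \<open>k\<close> to units modulo
  \<open>r\<close>.\<close>

lemma coprime_lift:
  fixes j k r :: nat
  assumes "r dvd k" "coprime j r" "k > 0"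
  obtains j' where "coprime j' k" "[j' = j] (mod r)"
proof -
  \<comment> \<open>Chosen so that every prime divisor of \<open>k\<close> divides exactly one of
    \<open>j\<close> and \<open>r * t\<close>, hence not their sum.\<close>
  define t where "t = \<Prod>{p. prime p \<and> p dvd k \<and> \<not> p dvd j}"
  have fin: "finite {p. prime p \<and> p dvd k \<and> \<not> p dvd j}"
    by (rule finite_subset[of _ "{..k}"]) (use assms in \<open>auto dest: dvd_imp_le\<close>)
  have "coprime (j + r * t) k"
  proof (rule ccontr)
    assume "\<not> coprime (j + r * t) k"
    then have "gcd (j + r * t) k \<noteq> 1" by (simp only: coprime_iff_gcd_eq_1) simp
    then obtain p where "prime p" "p dvd gcd (j + r * t) k" using prime_factor_nat by blast
    then have p: "prime p" "p dvd j + r * t" "p dvd k" by (simp_all only: gcd_greatest_iff)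
    show False
    proof (cases "p dvd j")
      case True
      then have "p dvd r * t" using p(2) by (simp add: dvd_add_right_iff)
      moreover have "\<not> p dvd r" using True p(1) assms(2)
        using coprime_common_divisor_nat[OF assms(2) True] by auto
      moreover have "\<not> p dvd t"
      proof
        assume "p dvd t"
        then obtain q where "q \<in> {p. prime p \<and> p dvd k \<and> \<not> p dvd j}" "p dvd q"
          unfolding t_def using prime_dvd_prod_iff[OF fin p(1)] by auto
        then have "prime q" "\<not> q dvd j" "p dvd q" by auto
        then show False using True primes_dvd_imp_eq[OF p(1)] by blast
      qed
      ultimately show False using p(1) by (simp add: prime_dvd_mult_iff)
    next
      case False
      then have "p dvd t" unfolding t_def using p fin by (intro dvd_prodI[where f = "\<lambda>x. x"]) auto
      then have "p dvd r * t" by simp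
      then have "p dvd j" using p(2) by (simp add: dvd_add_left_iff)
      with False show False by simp
    qed
  qed
  moreover have "[j + r * t = j] (mod r)" by (simp add: cong_def)
  ultimately show thesis by (rule that)
qed

lemma bij_betw_power_prim:
  assumes k: "k > 0" and j: "coprime j k"
  shows "bij_betw (\<lambda>z. z ^ j) (primitive_roots k) (primitive_roots k)"
proof -
  have "inj_on (\<lambda>z. z ^ j) (primitive_roots k)"
  proof (rule inj_onI)
    fix z u assume z: "z \<in> primitive_roots k" and u: "u \<in> primitive_roots k" and eq: "z ^ j = u ^ j"
    have u0: "u \<noteq> 0" using u k by (auto simp: primitive_roots_def power_0_left)
    have k1: "(z / u) ^ k = 1" using z u by (simp add: power_divide primitive_roots_def)
    then obtain d where d: "d dvd k" "d > 0" "z / u \<in> primitive_roots d"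
      using root_of_unity_prim k by blast
    have "(z / u) ^ j = 1" using eq u0 by (simp add: power_divide)
    then have "d dvd j" using prim_power_eq_1_iff[OF d(3,2)] by blast
    then have "d = 1" using d(1) j by (metis coprime_common_divisor_nat)
    then have "z / u = 1" using d(3) prim_1 by simp
    then show "z = u" using u0 by simp
  qed
  moreover have "(\<lambda>z. z ^ j) ` primitive_roots k \<subseteq> primitive_roots k"
    using power_mem_prim[of _ k j] k j by (auto simp: coprime_iff_gcd_eq_1)
  ultimately show ?thesis using finite_prim[OF k] by (metis bij_betw_imageI endo_inj_surj)
qed

text \<open>Averaging over exponents \<open>j'\<close> coprime to \<open>k\<close> that lift the \<open>j\<close> coprime to \<open>r\<close> reduces the
  Ramanujan sum on the left to the sum of the primitive \<open>r\<close>-th roots of unity.\<close>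

lemma sum_power_prim:
  fixes a k :: nat
  assumes k: "k > 0"
  defines "r \<equiv> k div gcd a k"
  shows "of_nat (totient r) * (\<Sum>z\<in>primitive_roots k. z ^ a) = of_nat (totient k) * prim_sum r"
proof -
  have r: "r > 0" "r dvd k"
  proof -
    have "r * gcd a k = k" unfolding r_def by simp
    then show "r > 0" "r dvd k" using k by (auto intro: Nat.gr0I dvdI[of _ _ "gcd a k"])
  qed
  have "\<forall>j\<in>totatives r. \<exists>j'. coprime j' k \<and> [j' = j] (mod r)"
    using coprime_lift[OF r(2) _ k] by (metis in_totatives_iff)
  then obtain l where l: "\<And>j. j \<in> totatives r \<Longrightarrow> coprime (l j) k \<and> [l j = j] (mod r)" by metis
  have "of_nat (totient r) * (\<Sum>z\<in>primitive_roots k. z ^ a) = (\<Sum>j\<in>totatives r. \<Sum>z\<in>primitive_roots k. z ^ a)"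
    by (simp add: totient_def)
  also have "\<dots> = (\<Sum>j\<in>totatives r. \<Sum>z\<in>primitive_roots k. (z ^ a) ^ j)"
  proof (rule sum.cong[OF refl])
    fix j assume j: "j \<in> totatives r"
    have "(\<Sum>z\<in>primitive_roots k. z ^ a) = (\<Sum>z\<in>primitive_roots k. (z ^ l j) ^ a)"
      using l[OF j] by (intro sum.reindex_bij_betw[OF bij_betw_power_prim[OF k], symmetric]) auto
    also have "\<dots> = (\<Sum>z\<in>primitive_roots k. (z ^ a) ^ j)"
    proof (rule sum.cong[OF refl])
      fix z assume "z \<in> primitive_roots k"
      then have "z ^ a \<in> primitive_roots r" unfolding r_def using k by (rule power_mem_prim)
      then have "(z ^ a) ^ l j = (z ^ a) ^ j" using r(1) l[OF j] by (intro prim_power_eq) auto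
      then show "(z ^ l j) ^ a = (z ^ a) ^ j" by (metis power_mult mult.commute)
    qed
    finally show "(\<Sum>z\<in>primitive_roots k. z ^ a) = (\<Sum>z\<in>primitive_roots k. (z ^ a) ^ j)" .
  qed
  also have "\<dots> = (\<Sum>z\<in>primitive_roots k. \<Sum>j\<in>totatives r. (z ^ a) ^ j)" by (rule sum.swap)
  also have "\<dots> = (\<Sum>z\<in>primitive_roots k. prim_sum r)"
  proof (rule sum.cong[OF refl])
    fix z assume "z \<in> primitive_roots k"
    then have "z ^ a \<in> primitive_roots r" unfolding r_def using k by (rule power_mem_prim)
    then show "(\<Sum>j\<in>totatives r. (z ^ a) ^ j) = prim_sum r"
      unfolding prim_sum_def using r(1) by (intro sum.reindex_bij_betw bij_betw_totatives_prim)
  qed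
  also have "\<dots> = of_nat (totient k) * prim_sum r" by (simp add: card_prim[OF k])
  finally show ?thesis .
qed

lemma bij_betw_inverse_prim:
  assumes k: "k > 0"
  shows "bij_betw inverse (primitive_roots k) (primitive_roots k)"
proof (rule bij_betw_byWitness[where f' = inverse])
  have "inverse z \<in> primitive_roots k" if "z \<in> primitive_roots k" for z
    using that by (auto simp: primitive_roots_def power_inverse)
  then show "inverse ` primitive_roots k \<subseteq> primitive_roots k" "inverse ` primitive_roots k \<subseteq> primitive_roots k" by auto
qed auto

lemma sum_inverse_power_prim:
  "k > 0 \<Longrightarrow> (\<Sum>z\<in>primitive_roots k. inverse (z ^ a)) = (\<Sum>z\<in>primitive_roots k. z ^ a)"
  using sum.reindex_bij_betw[OF bij_betw_inverse_prim, of k "\<lambda>z. z ^ a"] by (simp add: power_inverse)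

lemma prim_sum_5: "prim_sum 5 = -1"
  using prim_sum_prime_mult[of 1 5] prim_sum_1 by simp

lemma prim_sum_10: "prim_sum 10 = 1"
  using prim_sum_prime_mult[of 5 2] prim_sum_5 by simp

text \<open>A nonzero Moebius value makes \<open>r\<close> squarefree, and a prime \<open>p\<close>
  dividing \<open>r\<close> has \<open>p - 1\<close> dividing 4. So \<open>r\<close> divides 30, and
  the eight divisors can be checked.\<close>

lemma totient_4_imp:
  assumes r: "r > 0" "totient r = 4" "prim_sum r \<noteq> 0"
  shows "r = 5 \<or> r = 10"
proof -
  note tot = r(2)
  have "r dvd 30"
  proof (rule multiplicity_le_imp_dvd)
    fix p :: nat assume p: "prime p"
    have 1: "multiplicity p r \<le> 1"
    proof (rule ccontr)
      assume "\<not> multiplicity p r \<le> 1"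
      then have "p ^ 2 dvd r" by (intro multiplicity_dvd') simp
      then have "prim_sum r = 0" using r(1) p by (intro prim_sum_square_dvd[of r p]) (auto simp: power2_eq_square)
      with r(3) show False by simp
    qed
    show "multiplicity p r \<le> multiplicity p 30"
    proof (cases "p dvd r")
      case True
      then have "totient p dvd 4" using totient_dvd r(2) by metis
      then have d4: "p - 1 dvd 4" using p by (simp add: totient_prime)
      then have "p \<le> 5" by (auto dest!: dvd_imp_le)
      then have "p \<in> {0,1,2,3,4,5}" by auto
      then have "p \<in> {2,3,5}" using p d4 by (auto simp: numeral_eq_Suc prime_nat_iff)
      then have "p dvd 30" by auto
      then have "multiplicity p 30 \<ge> 1" using p by (intro multiplicity_geI) auto
      with 1 show ?thesis by simp
    next
      case False
      then show ?thesis by (simp add: not_dvd_imp_multiplicity_0)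
    qed
  qed (use r in auto)
  then have "r dvd 2 * (3 * 5)" by simp
  then obtain c u where r: "r = c * u" "c dvd 2" "u dvd 3 * 5" using division_decomp by blast
  then obtain d e where u: "u = d * e" "d dvd 3" "e dvd 5" using division_decomp by blast
  have "c = 1 \<or> c = 2" "d = 1 \<or> d = 3" "e = 1 \<or> e = 5"
    using r u prime_nat_iff[of 2] prime_nat_iff[of 3] prime_nat_iff[of 5] by auto
  then have r': "r \<in> {1,2,3,5,6,10,15,30}" using r u by auto
  have "totient (3::nat) = 2" "totient (5::nat) = 4" by (simp_all add: totient_prime)
  moreover have "totient (3 * 5 :: nat) = 8"
    by (subst totient_mult_coprime) (simp_all add: totient_prime primes_coprime)
  moreover have "totient (2 * (3 * 5) :: nat) = 8" using calculation by (subst totient_double) simp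
  ultimately show ?thesis using r' tot by auto
qed

subsection \<open>Cyclotomic factors of \<open>GT\<close>\<close>

lemma poly_GT:
  assumes "z \<noteq> 0"
  shows "poly (cpoly (GT a b)) z = z ^ max a b * (z ^ b + inverse (z ^ b) - z ^ a - inverse (z ^ a) - 1)"
proof -
  have "z ^ (max a b - b) = z ^ max a b * inverse (z ^ b)" "z ^ (max a b - a) = z ^ max a b * inverse (z ^ a)"
    using assms by (simp_all add: power_diff divide_inverse)
  then show ?thesis
    by (simp add: GT_symmetric_form cpoly_diff cpoly_add cpoly_monom poly_monom power_add ring_distribs)
qed

text \<open>On the unit circle this is twice the cosine of the argument.\<close>

definition tr :: "complex \<Rightarrow> complex" where
  "tr z = z + inverse z"

lemma prim_nonzero: "z \<in> primitive_roots k \<Longrightarrow> k > 0 \<Longrightarrow> z \<noteq> 0"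
  by (auto simp: primitive_roots_def power_0_left)

lemma poly_GT_eq_0_iff:
  assumes "z \<in> primitive_roots k" "k > 0"
  shows "poly (cpoly (GT a b)) z = 0 \<longleftrightarrow> tr (z ^ b) - tr (z ^ a) = 1"
proof -
  have "poly (cpoly (GT a b)) z = z ^ max a b * (tr (z ^ b) - tr (z ^ a) - 1)"
    using poly_GT[OF prim_nonzero[OF assms], of a b] by (simp add: tr_def algebra_simps)
  then show ?thesis using prim_nonzero[OF assms] by simp
qed

lemma tr_prim_1: "z \<in> primitive_roots 1 \<Longrightarrow> tr z = 2"
  unfolding prim_1 by (simp add: tr_def)

lemma tr_prim_2:
  assumes "z \<in> primitive_roots 2"
  shows "tr z = -2"
proof -
  have "z ^ 2 = 1" "z \<noteq> 1"
    using prim_power_eq_1_iff[OF assms, of 2] prim_power_eq_1_iff[OF assms, of 1] by simp_all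
  then have "z = -1" by (simp add: power2_eq_1_iff)
  then show ?thesis by (simp add: tr_def)
qed

lemma tr_prim_3:
  assumes "z \<in> primitive_roots 3"
  shows "tr z = -1"
proof -
  have z: "z ^ 3 = 1" "z \<noteq> 1"
    using prim_power_eq_1_iff[OF assms, of 3] prim_power_eq_1_iff[OF assms, of 1] by simp_all
  have "(z - 1) * (z * z + z + 1) = 0" using z(1) by (simp add: algebra_simps power3_eq_cube)
  with z(2) have "z * z + z + 1 = 0" by simp
  moreover have "z \<noteq> 0" using z by auto
  then have "tr z + 1 = (z * z + z + 1) / z" by (simp add: tr_def field_simps)
  ultimately show ?thesis by (simp add: eq_neg_iff_add_eq_0)
qed

lemma tr_prim_4:
  assumes "z \<in> primitive_roots 4"
  shows "tr z = 0"
proof -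
  have z: "z ^ 4 = 1" "z ^ 2 \<noteq> 1"
    using prim_power_eq_1_iff[OF assms, of 4] prim_power_eq_1_iff[OF assms, of 2] by simp_all
  have "(z ^ 2 - 1) * (z * z + 1) = 0" using z(1) by (simp add: algebra_simps power4_eq_xxxx power2_eq_square)
  with z(2) have "z * z + 1 = 0" by simp
  moreover have "z \<noteq> 0" using z by auto
  ultimately show ?thesis by (simp add: tr_def field_simps)
qed

lemma tr_prim_6:
  assumes "z \<in> primitive_roots 6"
  shows "tr z = 1"
proof -
  have z: "z ^ 6 = 1" "z ^ 2 \<noteq> 1" "z ^ 3 \<noteq> 1"
    using prim_power_eq_1_iff[OF assms, of 6] prim_power_eq_1_iff[OF assms, of 2]
      prim_power_eq_1_iff[OF assms, of 3] by simp_all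
  have "(z ^ 3 - 1) * (z + 1) * (z * z - z + 1) = 0"
    using z(1) by (simp add: algebra_simps eval_nat_numeral)
  moreover have "z + 1 \<noteq> 0"
  proof
    assume "z + 1 = 0"
    then have "z = -1" by (simp add: eq_neg_iff_add_eq_0)
    with z(2) show False by simp
  qed
  ultimately have "z * z - z + 1 = 0" using z(3) by simp
  moreover have "z \<noteq> 0" using z by auto
  then have "tr z - 1 = (z * z - z + 1) / z" by (simp add: tr_def field_simps)
  ultimately show ?thesis by simp
qed

text \<open>The values are the golden ratio and its conjugate: the tenth cyclotomic polynomial at
  \<open>z\<close> is \<open>z ^ 2\<close> times the quadratic in \<open>tr z\<close>.\<close>

lemma tr_prim_10:
  assumes "z \<in> primitive_roots 10"
  shows "tr z * tr z = tr z + 1"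
proof -
  have z: "z ^ 10 = 1" "z ^ 2 \<noteq> 1" "z ^ 5 \<noteq> 1"
    using prim_power_eq_1_iff[OF assms, of 10] prim_power_eq_1_iff[OF assms, of 2]
      prim_power_eq_1_iff[OF assms, of 5] by simp_all
  have "(z ^ 5 - 1) * (z + 1) * (z ^ 4 - z ^ 3 + z ^ 2 - z + 1) = 0"
    using z(1) by (simp add: algebra_simps eval_nat_numeral)
  moreover have "z + 1 \<noteq> 0"
  proof
    assume "z + 1 = 0"
    then have "z = -1" by (simp add: eq_neg_iff_add_eq_0)
    with z(2) show False by simp
  qed
  ultimately have 1: "z ^ 4 - z ^ 3 + z ^ 2 - z + 1 = 0" using z(3) by simp
  have z0: "z \<noteq> 0" using z by auto
  have "z ^ 2 * (tr z * tr z - tr z - 1) = z ^ 4 - z ^ 3 + z ^ 2 - z + 1"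
    using z0 by (simp add: tr_def field_simps eval_nat_numeral)
  with 1 z0 have "tr z * tr z - tr z - 1 = 0" by simp
  then show ?thesis by (simp add: algebra_simps)
qed

section \<open>The residue rules and the orders of the two powers\<close>

lemma cong_int_iff_mod:
  assumes "n > 0"
  shows "[int x = c] (mod int n) \<longleftrightarrow> x mod n = nat (c mod int n)"
proof -
  have "[int x = c] (mod int n) \<longleftrightarrow> int (x mod n) = c mod int n"
    by (simp add: cong_def zmod_int)
  also have "\<dots> \<longleftrightarrow> x mod n = nat (c mod int n)" using assms by auto
  finally show ?thesis .
qed

text \<open>Negative residues become explicit natural ones (-1 modulo 10 becomes 9), so that all
  later case analyses are finite checks on natural numbers.\<close>

lemma mem_CT_indices_iff:
  "k \<in> CT_indices a b \<longleftrightarrow> (\<exists>d. d > 0 \<and> d dvd a \<and> d dvd b \<and>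
    (k = 6 * d \<and> (a div d mod 6, b div d mod 6) \<in> {(1,0), (3,2), (3,4), (5,0)} \<or>
     k = 10 * d \<and> (a div d mod 10, b div d mod 10)
       \<in> {(2,1), (2,9), (4,3), (4,7), (6,3), (6,7), (8,1), (8,9)} \<or>
     k = 12 * d \<and> (a div d mod 12, b div d mod 12)
       \<in> {(3,2), (3,10), (4,3), (4,9), (8,3), (8,9), (9,2), (9,10)}))"
proof -
  note c6 = cong_int_iff_mod[of 6, simplified]
  note c10 = cong_int_iff_mod[of 10, simplified]
  note c12 = cong_int_iff_mod[of 12, simplified]
  define P6 where "P6 d \<longleftrightarrow> (a div d mod 6, b div d mod 6) \<in> {(1,0), (3,2), (3,4), (5,0)}" for d
  define P10 where "P10 d \<longleftrightarrow> (a div d mod 10, b div d mod 10)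
       \<in> {(2,1), (2,9), (4,3), (4,7), (6,3), (6,7), (8,1), (8,9)}" for d
  define P12 where "P12 d \<longleftrightarrow> (a div d mod 12, b div d mod 12)
       \<in> {(3,2), (3,10), (4,3), (4,9), (8,3), (8,9), (9,2), (9,10)}" for d
  have "CT_indices a b = {6 * d | d. d > 0 \<and> d dvd a \<and> d dvd b \<and> P6 d}
      \<union> {10 * d | d. d > 0 \<and> d dvd a \<and> d dvd b \<and> P10 d}
      \<union> {12 * d | d. d > 0 \<and> d dvd a \<and> d dvd b \<and> P12 d}"
    unfolding CT_indices_def Let_def c6 c10 c12 P6_def P10_def P12_def
    by (intro arg_cong2[where f = "(\<union>)"] Collect_cong ex_cong1 conj_cong refl) auto
  then have "k \<in> CT_indices a b \<longleftrightarrow> (\<exists>d. d > 0 \<and> d dvd a \<and> d dvd b \<and>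
      (k = 6 * d \<and> P6 d \<or> k = 10 * d \<and> P10 d \<or> k = 12 * d \<and> P12 d))"
    by blast
  then show ?thesis by (simp only: P6_def P10_def P12_def)
qed

text \<open>\<open>C\<close> collects residues that share the gcd \<open>g\<close> with
  \<open>n\<close>; the order of \<open>z ^ a\<close> depends on that gcd alone.\<close>

lemma prim_power_factor:
  assumes "z \<in> primitive_roots (n * d)" "n > 0" "d > 0" "d dvd a" "a div d mod n \<in> C" "\<forall>c\<in>C. gcd c n = g"
  shows "z ^ a \<in> primitive_roots (n div g)"
proof -
  have "z ^ d \<in> primitive_roots (n * d div gcd d (n * d))" using assms by (intro power_mem_prim) auto
  then have "z ^ d \<in> primitive_roots n" using assms by simp
  then have "(z ^ d) ^ (a div d) \<in> primitive_roots (n div gcd (a div d) n)" using assms by (intro power_mem_prim) auto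
  moreover have "(z ^ d) ^ (a div d) = z ^ a" using assms by (simp flip: power_mult)
  moreover have "gcd (a div d mod n) n = g" using assms(5,6) by blast
  then have "gcd (a div d) n = g" using assms(2) by simp
  ultimately show ?thesis by simp
qed

text \<open>The values of \<open>2 cos\<close> on a pair of rational angles that solve \<open>2 cos B - 2 cos A = 1\<close>.\<close>

definition tr_solution :: "complex \<Rightarrow> complex \<Rightarrow> bool" where
  "tr_solution X Y \<longleftrightarrow> (X, Y) \<in> {(1, 2), (-2, -1), (-1, 0), (0, 1)} \<or> Y * Y = Y + 1 \<and> X = Y - 1"

lemma tr_solution_of_mem_CT_indices:
  assumes k: "k \<in> CT_indices a b"
  shows "k > 0" "z \<in> primitive_roots k \<Longrightarrow> tr_solution (tr (z ^ a)) (tr (z ^ b))"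
proof -
  show "k > 0" using k by (auto simp: mem_CT_indices_iff)
  assume z: "z \<in> primitive_roots k"
  have g: "gcd 5 6 = (1::nat)" "gcd 3 6 = (3::nat)" "gcd 2 6 = (2::nat)" "gcd 4 6 = (2::nat)"
    "gcd 3 10 = (1::nat)" "gcd 7 10 = (1::nat)" "gcd 9 10 = (1::nat)"
    "gcd 3 12 = (3::nat)" "gcd 9 12 = (3::nat)" "gcd 2 12 = (2::nat)" "gcd 10 12 = (2::nat)"
    "gcd 4 12 = (4::nat)" "gcd 8 12 = (4::nat)"
    by (simp_all add: gcd_non_0_nat)
  obtain d where D: "d > 0 \<and> d dvd a \<and> d dvd b \<and>
    (k = 6 * d \<and> (a div d mod 6, b div d mod 6) \<in> {(1,0), (3,2), (3,4), (5,0)} \<or>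
     k = 10 * d \<and> (a div d mod 10, b div d mod 10)
       \<in> {(2,1), (2,9), (4,3), (4,7), (6,3), (6,7), (8,1), (8,9)} \<or>
     k = 12 * d \<and> (a div d mod 12, b div d mod 12)
       \<in> {(3,2), (3,10), (4,3), (4,9), (8,3), (8,9), (9,2), (9,10)})"
    using iffD1[OF mem_CT_indices_iff k] by (rule exE)
  then have d: "d > 0" "d dvd a" "d dvd b" by blast+
  \<comment> \<open>Rules (I) and (III) each split into two products of residue sets with constant
    gcds, so each half fixes the orders of both powers. Rule (II) is not such a product and is kept
    whole.\<close>
  have "(p, q) \<in> {(1,0), (3,2), (3,4), (5,0)} \<Longrightarrow> p \<in> {1, 5} \<and> q = 0 \<or> p = 3 \<and> q \<in> {2, 4}"
    "(p, q) \<in> {(3,2), (3,10), (4,3), (4,9), (8,3), (8,9), (9,2), (9,10)} \<Longrightarrow>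
      p \<in> {3, 9} \<and> q \<in> {2, 10} \<or> p \<in> {4, 8} \<and> q \<in> {3, 9}" for p q :: nat
    by (simp, elim disjE; simp)+
  with D consider
      "k = 6 * d" "a div d mod 6 \<in> {1, 5}" "b div d mod 6 = 0"
    | "k = 6 * d" "a div d mod 6 = 3" "b div d mod 6 \<in> {2, 4}"
    | "k = 10 * d" "(a div d mod 10, b div d mod 10)
       \<in> {(2,1), (2,9), (4,3), (4,7), (6,3), (6,7), (8,1), (8,9)}"
    | "k = 12 * d" "a div d mod 12 \<in> {3, 9}" "b div d mod 12 \<in> {2, 10}"
    | "k = 12 * d" "a div d mod 12 \<in> {4, 8}" "b div d mod 12 \<in> {3, 9}"
    by meson
  then show "tr_solution (tr (z ^ a)) (tr (z ^ b))"
  proof cases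
    case 1
    then have "z ^ a \<in> primitive_roots 6" "z ^ b \<in> primitive_roots 1"
      using z prim_power_factor[of z 6 d a "{1,5}" 1] prim_power_factor[of z 6 d b "{0}" 6] d g by auto
    then show ?thesis using tr_prim_6 tr_prim_1 by (simp add: tr_solution_def)
  next
    case 2
    then have "z ^ a \<in> primitive_roots 2" "z ^ b \<in> primitive_roots 3"
      using z prim_power_factor[of z 6 d a "{3}" 3] prim_power_factor[of z 6 d b "{2,4}" 2] d g by auto
    then show ?thesis using tr_prim_2 tr_prim_3 by (simp add: tr_solution_def)
  next
    case 3
    define u where "u = z ^ b"
    have u: "u \<in> primitive_roots 10"
      unfolding u_def using 3 z prim_power_factor[of z 10 d b "{1,3,7,9}" 1] d g by auto
    have u0: "u \<noteq> 0" using u prim_nonzero by auto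
    have a: "(z ^ d) ^ (a div d) = z ^ a" and b: "(z ^ d) ^ (b div d) = u"
      using d by (simp_all add: u_def flip: power_mult)
    have zd: "z ^ d \<in> primitive_roots 10" using power_mem_prim[of z k d] 3(1) z d by simp
    \<comment> \<open>The pairs of rule (II) satisfy one of these congruences, so
      \<open>z ^ a\<close> is the square of \<open>u\<close> or its inverse. Hence X = Y * Y - 2 = Y
      - 1 for the two traces.\<close>
    have cases: "[a div d = 2 * (b div d)] (mod 10) \<or> [a div d + 2 * (b div d) = 0] (mod 10)"
    proof -
      have 1: "2 * (b div d) mod 10 = 2 * (b div d mod 10) mod 10"
        by (rule mod_mult_right_eq[symmetric])
      have "(a div d + 2 * (b div d)) mod 10 = (a div d mod 10 + 2 * (b div d) mod 10) mod 10"
        by (rule mod_add_eq[symmetric])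
      also have "\<dots> = (a div d mod 10 + 2 * (b div d mod 10)) mod 10"
        unfolding 1 by (rule mod_add_right_eq)
      finally have 2: "(a div d + 2 * (b div d)) mod 10 = (a div d mod 10 + 2 * (b div d mod 10)) mod 10" .
      define p q where "p = a div d mod 10" and "q = b div d mod 10"
      have "(p, q) \<in> {(2,1), (2,9), (4,3), (4,7), (6,3), (6,7), (8,1), (8,9)}"
        using 3(2) by (simp only: p_def q_def)
      then have "p = 2 * q mod 10 \<or> (p + 2 * q) mod 10 = 0 mod 10" by auto
      then show ?thesis unfolding cong_def 2 1 p_def q_def .
    qed
    have "tr (z ^ a) = tr (u ^ 2)"
    proof (rule disjE[OF cases])
      assume "[a div d = 2 * (b div d)] (mod 10)"
      then have "(z ^ d) ^ (a div d) = (z ^ d) ^ (2 * (b div d))" by (intro prim_power_eq[OF zd]) auto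
      moreover have "(z ^ d) ^ (2 * (b div d)) = u ^ 2" unfolding b[symmetric] by (rule power_even_eq)
      ultimately show ?thesis using a by simp
    next
      assume "[a div d + 2 * (b div d) = 0] (mod 10)"
      then have "(z ^ d) ^ (a div d + 2 * (b div d)) = (z ^ d) ^ 0" by (intro prim_power_eq[OF zd]) auto
      moreover have "(z ^ d) ^ (2 * (b div d)) = u ^ 2" unfolding b[symmetric] by (rule power_even_eq)
      ultimately have "u ^ 2 * z ^ a = 1" using a by (simp only: power_add power_0 mult.commute)
      then have "inverse (u ^ 2) = z ^ a" by (rule inverse_unique)
      then have "z ^ a = inverse (u ^ 2)" by (rule sym)
      then show ?thesis by (simp only: tr_def inverse_inverse_eq add.commute)
    qed
    moreover have "tr (u ^ 2) = tr u * tr u - 2"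
    proof -
      have "u * inverse u = 1" using u0 by simp
      then show ?thesis by (simp add: tr_def algebra_simps power2_eq_square)
    qed
    ultimately show ?thesis using tr_prim_10[OF u] by (simp add: tr_solution_def u_def)
  next
    case 4
    then have "z ^ a \<in> primitive_roots 4" "z ^ b \<in> primitive_roots 6"
      using z prim_power_factor[of z 12 d a "{3,9}" 3] prim_power_factor[of z 12 d b "{2,10}" 2] d g by auto
    then show ?thesis using tr_prim_4 tr_prim_6 by (simp add: tr_solution_def)
  next
    case 5
    then have "z ^ a \<in> primitive_roots 3" "z ^ b \<in> primitive_roots 4"
      using z prim_power_factor[of z 12 d a "{4,8}" 4] prim_power_factor[of z 12 d b "{3,9}" 3] d g by auto
    then show ?thesis using tr_prim_3 tr_prim_4 by (simp add: tr_solution_def)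
  qed
qed

text \<open>The multiplicity of \<open>p\<close> would be even on the left and odd on the right.
  This is the irrationality of sqrt p in integer form.\<close>

lemma square_eq_prime_mult_square:
  fixes m n :: int and p :: int
  assumes "prime p" "m\<^sup>2 = p * n\<^sup>2"
  shows "n = 0"
proof (rule ccontr)
  assume "n \<noteq> 0"
  have p: "prime_elem p" "p \<noteq> 0" using assms(1) by auto
  have "m \<noteq> 0" using assms \<open>n \<noteq> 0\<close> p by auto
  have "2 * multiplicity p m = multiplicity p (m\<^sup>2)"
    using p \<open>m \<noteq> 0\<close> by (simp add: prime_elem_multiplicity_power_distrib)
  also have "\<dots> = 1 + 2 * multiplicity p n"
    unfolding assms(2) using p \<open>n \<noteq> 0\<close>
    by (simp add: prime_elem_multiplicity_mult_distrib prime_elem_multiplicity_power_distrib)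
  finally show False by presburger
qed

text \<open>Equality would mean that the derivative of \<open>F\<close> vanishes at a common zero.
  Squaring expresses both sides through the traces: in the first two cases one side is 0 and the
  other is not, the next two would make sqrt 3 rational, the last one sqrt 5.\<close>

lemma tr_solution_simple:
  assumes "tr_solution (tr x) (tr y)" "x \<noteq> 0" "y \<noteq> 0" "a > 0" "b > 0"
  shows "of_nat b * (y - inverse y) \<noteq> of_nat a * (x - inverse x)"
proof
  assume eq: "of_nat b * (y - inverse y) = of_nat a * (x - inverse x)"
  define X Y where "X = tr x" and "Y = tr y"
  have "(x - inverse x)\<^sup>2 = X\<^sup>2 - 4" "(y - inverse y)\<^sup>2 = Y\<^sup>2 - 4"
    using assms by (simp_all add: X_def Y_def tr_def field_simps power2_eq_square)
  moreover have "(of_nat b * (y - inverse y))\<^sup>2 = (of_nat a * (x - inverse x))\<^sup>2" using eq by simp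
  ultimately have sq: "of_nat b ^ 2 * (Y\<^sup>2 - 4) = of_nat a ^ 2 * (X\<^sup>2 - 4)"
    by (simp add: power_mult_distrib)
  from assms(1) consider "X = 1" "Y = 2" | "X = -2" "Y = -1" | "X = -1" "Y = 0" | "X = 0" "Y = 1"
    | "Y * Y = Y + 1" "X = Y - 1"
    by (auto simp: tr_solution_def X_def Y_def)
  then show False
  proof cases
    case 1 then show False using sq assms by simp
  next
    case 2 then show False using sq assms by simp
  next
    case 3
    then have "of_nat (4 * b\<^sup>2) = (of_nat (3 * a\<^sup>2) :: complex)" using sq by (simp add: mult.commute)
    then have "4 * b\<^sup>2 = 3 * a\<^sup>2" unfolding of_nat_eq_iff .
    then have "(2 * int b)\<^sup>2 = 3 * (int a)\<^sup>2" by (simp add: power_mult_distrib flip: of_nat_power)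
    then show False using square_eq_prime_mult_square[of 3 "2 * int b" "int a"] assms by simp
  next
    case 4
    then have "of_nat (4 * a\<^sup>2) = (of_nat (3 * b\<^sup>2) :: complex)" using sq by (simp add: mult.commute)
    then have "4 * a\<^sup>2 = 3 * b\<^sup>2" unfolding of_nat_eq_iff .
    then have "(2 * int a)\<^sup>2 = 3 * (int b)\<^sup>2" by (simp add: power_mult_distrib flip: of_nat_power)
    then show False using square_eq_prime_mult_square[of 3 "2 * int a" "int b"] assms by simp
  next
    case 5
    \<comment> \<open>Reducing squares by \<open>Y * Y = Y + 1\<close> leaves an equation linear in
      \<open>Y\<close>, namely n Y = m. A rational golden ratio then yields (2 m - n)^2 = 5
      n^2.\<close>
    define n where "n = (int a)\<^sup>2 + (int b)\<^sup>2"
    define m where "m = 3 * (int b)\<^sup>2 - 2 * (int a)\<^sup>2"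
    have n: "(of_int n :: complex) = of_nat a ^ 2 + of_nat b ^ 2" by (simp add: n_def)
    have m: "(of_int m :: complex) = 3 * of_nat b ^ 2 - 2 * of_nat a ^ 2" by (simp add: m_def)
    have "of_nat b ^ 2 * (Y - 3) = of_nat a ^ 2 * (- 2 - Y)"
      using sq 5 by (simp add: power2_eq_square algebra_simps)
    then have nm: "of_int n * Y = of_int m" unfolding n m by (simp add: algebra_simps)
    have "of_int m * of_int m = of_int n * of_int n * (Y * Y)" unfolding nm[symmetric] by (simp add: mult_ac)
    also have "\<dots> = of_int n * (of_int n * Y) + of_int n * of_int n" by (simp add: 5 algebra_simps)
    also have "\<dots> = of_int n * of_int m + of_int n * of_int n" by (simp only: nm)
    finally have "(of_int (m * m) :: complex) = of_int (n * m + n * n)" by simp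
    then have "m * m = n * m + n * n" unfolding of_int_eq_iff .
    then have "(2 * m - n)\<^sup>2 = 5 * n\<^sup>2" by (simp add: power2_eq_square algebra_simps)
    then have "n = 0" using square_eq_prime_mult_square[of 5 "2 * m - n" n] by simp
    then show False using assms(4) by (simp add: n_def sum_power2_eq_zero_iff)
  qed
qed

text \<open>If the order of \<open>x\<close> has at most two primitive roots, then the conjugates of \<open>x\<close> are \<open>x\<close> and
  \<open>inverse x\<close>, so \<open>tr x\<close> is a rational integer.\<close>

lemma tr_totient_le_2:
  assumes x: "x \<in> primitive_roots r" and r: "r > 0" "totient r \<le> 2"
  shows "tr x \<in> {-2, -1, 0, 1, 2}"
proof (cases "x * x = 1")
  case True
  then have "x = 1 \<or> x = -1" by (simp add: square_eq_1_iff)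
  then show ?thesis by (auto simp: tr_def)
next
  case False
  have x0: "x \<noteq> 0" using x r prim_nonzero by blast
  then have ne: "x \<noteq> inverse x" using False by (metis right_inverse)
  have "inverse x \<in> primitive_roots r"
    using bij_betw_inverse_prim[OF r(1)] x by (auto simp: bij_betw_def)
  then have "{x, inverse x} = primitive_roots r"
    using x r ne finite_prim[OF r(1)] card_prim[OF r(1)] by (intro card_seteq) auto
  then have "prim_sum r = tr x" using ne by (simp add: prim_sum_def tr_def flip: \<open>{x, inverse x} = primitive_roots r\<close>)
  then show ?thesis using prim_sum_cases[OF r(1)] by (metis insertCI insertE of_int_0 of_int_1 of_int_minus singletonD)
qed

section \<open>Classification of the possible orders\<close>

lemma norm_tr_le: "z \<in> primitive_roots k \<Longrightarrow> k > 0 \<Longrightarrow> norm (tr z) \<le> 2"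
proof -
  assume "z \<in> primitive_roots k" "k > 0"
  then have "norm z ^ k = 1" by (simp add: primitive_roots_def flip: norm_power)
  then have "norm z = 1" using \<open>k > 0\<close> power_eq_imp_eq_base[of "norm z" k 1] by simp
  then show ?thesis unfolding tr_def
    by (intro order_trans[OF norm_triangle_ineq]) (simp add: norm_inverse)
qed

text \<open>Being even and above 2, both \<open>u\<close> and \<open>v\<close> are at least 4, so
  the left side is at most 2 u + 2 v \<le> u v. Equality must hold throughout.\<close>

lemma int_equation_cases:
  fixes u v s r :: int
  assumes "u > 2" "v > 2" "even u" "even v" "s \<in> {-1,0,1}" "r \<in> {-1,0,1}"
    "2 * u * s - 2 * v * r = u * v"
  shows "u = 4" "v = 4" "s = 1" "r = -1"
proof -
  have uv: "u * v \<ge> 4 * u" "u * v \<ge> 4 * v"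
    using assms(1-4) mult_left_mono[of 4 v u] mult_right_mono[of 4 u v] by presburger+
  have "s = 1 \<and> r = -1 \<and> u = v"
    if "w \<ge> 4 * u" "w \<ge> 4 * v" "2 * u * s - 2 * v * r = w" for w
    using assms(5,6) that assms(1,2) by auto
  from this[OF uv assms(7)] have sr: "s = 1" "r = -1" "u = v" by auto
  then show "s = 1" "r = -1" by auto
  have "u * u = 4 * u" using assms(7) sr by simp
  then show "u = 4" "v = 4" using assms(1) sr by auto
qed

text \<open>If one totient is at most 2, the corresponding trace is an integer, and the bound 2 on
  the other trace leaves four pairs. The averaged equation serves the case in which both totients
  exceed 2.\<close>

lemma order_classification:
  assumes k: "k > 0" and zero: "\<And>z. z \<in> primitive_roots k \<Longrightarrow> tr (z ^ b) - tr (z ^ a) = 1" and z: "z \<in> primitive_roots k"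
  shows "(tr (z ^ a), tr (z ^ b)) \<in> {(1, 2), (-2, -1), (-1, 0), (0, 1)} \<or>
    (z ^ a \<in> primitive_roots 5 \<and> z ^ b \<in> primitive_roots 10)"
proof -
  define r s where "r = k div gcd a k" and "s = k div gcd b k"
  have "r * gcd a k = k" "s * gcd b k = k" unfolding r_def s_def by simp_all
  then have pos: "r > 0" "s > 0" using k by (auto intro: Nat.gr0I)
  have xy: "z ^ a \<in> primitive_roots r" "z ^ b \<in> primitive_roots s"
    using power_mem_prim[OF z k] by (simp_all add: r_def s_def)
  define u v where "u = totient r" and "v = totient s"
  obtain \<rho> \<sigma> :: int where rs: "prim_sum r = of_int \<rho>" "\<rho> \<in> {-1,0,1}" "prim_sum s = of_int \<sigma>" "\<sigma> \<in> {-1,0,1}"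
    using prim_sum_cases pos by metis
  \<comment> \<open>Summing over all conjugates and cancelling \<open>totient k\<close> leaves an
    integer equation in the totients and Moebius values of \<open>r\<close> and
    \<open>s\<close>.\<close>
  have "(\<Sum>z\<in>primitive_roots k. tr (z ^ b) - tr (z ^ a)) = (\<Sum>z\<in>primitive_roots k. 1)"
    using zero by (intro sum.cong) auto
  then have "2 * (\<Sum>z\<in>primitive_roots k. z ^ b) - 2 * (\<Sum>z\<in>primitive_roots k. z ^ a) = of_nat (totient k)"
    using sum_inverse_power_prim[OF k] by (simp add: tr_def sum_subtractf sum.distrib card_prim[OF k])
  then have "of_nat u * of_nat v * (2 * (\<Sum>z\<in>primitive_roots k. z ^ b) - 2 * (\<Sum>z\<in>primitive_roots k. z ^ a)) =
      (of_nat u * of_nat v * of_nat (totient k) :: complex)" by simp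
  then have "2 * of_nat u * (of_nat v * (\<Sum>z\<in>primitive_roots k. z ^ b)) - 2 * of_nat v * (of_nat u * (\<Sum>z\<in>primitive_roots k. z ^ a)) =
      (of_nat u * of_nat v * of_nat (totient k) :: complex)" by (simp add: algebra_simps)
  moreover have "of_nat u * (\<Sum>z\<in>primitive_roots k. z ^ a) = of_nat (totient k) * of_int \<rho>"
    "of_nat v * (\<Sum>z\<in>primitive_roots k. z ^ b) = of_nat (totient k) * of_int \<sigma>"
    using sum_power_prim[OF k, of a] sum_power_prim[OF k, of b] rs by (simp_all add: u_def v_def r_def s_def)
  ultimately have "of_nat (totient k) * (2 * of_nat u * of_int \<sigma> - 2 * of_nat v * of_int \<rho>) =
      (of_nat (totient k) * (of_nat u * of_nat v) :: complex)" by (simp add: algebra_simps)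
  then have "2 * of_nat u * of_int \<sigma> - 2 * of_nat v * of_int \<rho> = (of_nat u * of_nat v :: complex)"
    using k by simp
  then have "(of_int (2 * int u * \<sigma> - 2 * int v * \<rho>) :: complex) = of_int (int u * int v)" by simp
  then have eq: "2 * int u * \<sigma> - 2 * int v * \<rho> = int u * int v" unfolding of_int_eq_iff .
  have T: "tr (z ^ b) = tr (z ^ a) + 1" using zero[OF z] by (simp add: algebra_simps)
  consider "u \<le> 2" | "v \<le> 2" | "u > 2" "v > 2" by linarith
  then show ?thesis
  proof cases
    case 1
    then have "tr (z ^ a) \<in> {-2, -1, 0, 1, 2}" using xy pos by (intro tr_totient_le_2) (auto simp: u_def)
    moreover have "tr (z ^ b) \<noteq> 3" using norm_tr_le[OF xy(2) pos(2)] by auto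
    ultimately show ?thesis using T by auto
  next
    case 2
    then have "tr (z ^ b) \<in> {-2, -1, 0, 1, 2}" using xy pos by (intro tr_totient_le_2) (auto simp: v_def)
    moreover have "tr (z ^ a) \<noteq> -3" using norm_tr_le[OF xy(1) pos(1)] by auto
    moreover have "tr (z ^ a) = tr (z ^ b) - 1" using T by simp
    ultimately show ?thesis by auto
  next
    case 3
    have "r > 2" "s > 2" using 3 totient_le[of r] totient_le[of s] by (auto simp: u_def v_def)
    then have "even (int u)" "even (int v)" using totient_even by (auto simp: u_def v_def)
    from int_equation_cases[OF _ _ this rs(4,2) eq] 3
    have c: "u = 4" "v = 4" "\<sigma> = 1" "\<rho> = -1" by auto
    have "r = 5 \<or> r = 10" "s = 5 \<or> s = 10"
      using totient_4_imp[of r] totient_4_imp[of s] c rs pos by (auto simp: u_def v_def)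
    \<comment> \<open>The Moebius value separates the two candidates: it is -1 at 5 and 1 at
      10.\<close>
    moreover have "r \<noteq> 10" "s \<noteq> 5" using c rs prim_sum_5 prim_sum_10 by auto
    ultimately show ?thesis using xy by auto
  qed
qed

text \<open>With c = \<open>tr z\<close>, \<open>z\<close> is a root of z^2 - c z + 1, which is a
  cyclotomic polynomial for c = -1, 0, 1 and the square of one for c = 2 and c = -2.\<close>

lemma prim_of_tr:
  assumes z: "z \<in> primitive_roots k" "k > 0"
  shows "tr z = 2 \<Longrightarrow> k = 1" "tr z = -2 \<Longrightarrow> k = 2" "tr z = -1 \<Longrightarrow> k = 3" "tr z = 0 \<Longrightarrow> k = 4" "tr z = 1 \<Longrightarrow> k = 6"
proof -
  have z0: "z \<noteq> 0" using prim_nonzero[OF z] .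
  have q: "z * z = c * z - 1" if "tr z = c" for c
  proof -
    have "z * tr z = z * z + 1" using z0 by (simp add: tr_def distrib_left)
    then show ?thesis using that by (simp add: algebra_simps)
  qed
  have unique: "k = n" if "z \<in> primitive_roots n" "n > 0" for n
    using prim_unique[OF z(1) that(1) z(2) that(2)] .
  show "k = 1" if "tr z = 2"
  proof -
    have "(z - 1) * (z - 1) = 0" using q[OF that] by (simp add: algebra_simps)
    then show ?thesis using unique[of 1] prim_1 by simp
  qed
  have order: "k dvd n" if "z ^ n = 1" for n
    using prim_power_eq_1_iff[OF z] that by blast
  have divs: "k = 1 \<or> k = 2 \<or> k = 3 \<or> k = 4 \<or> k = 6" if "k dvd 4 \<or> k dvd 6"
  proof -
    have "k \<le> 6" using that by (auto dest: dvd_imp_le)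
    then have "k \<in> {1, 2, 3, 4, 5, 6}" using z(2) by auto
    with that show ?thesis by auto
  qed
  note tr = tr_prim_1[of z] tr_prim_2[of z] tr_prim_3[of z] tr_prim_4[of z] tr_prim_6[of z]
  show "k = 2" if "tr z = -2"
  proof -
    have "(z + 1) * (z + 1) = z * z - (-2 * z - 1)" by (simp add: algebra_simps)
    also have "\<dots> = 0" using q[OF that] by simp
    finally have "z = -1" by (simp add: eq_neg_iff_add_eq_0)
    then have "k dvd 4" by (intro order) simp
    with divs that tr z(1) show ?thesis by auto
  qed
  show "k = 3" if "tr z = -1"
  proof -
    have zz: "z * z = - z - 1" using q[OF that] by simp
    have "z ^ 3 = z * (z * z)" by (simp add: power3_eq_cube)
    also have "\<dots> = z * (- z - 1)" by (simp only: zz)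
    also have "\<dots> = - (z * z) - z" by (simp add: algebra_simps)
    also have "\<dots> = 1" unfolding zz by simp
    finally have "z ^ 6 = 1" using power_mult[of z 3 2] by simp
    then have "k dvd 6" by (rule order)
    with divs that tr z(1) show ?thesis by auto
  qed
  show "k = 4" if "tr z = 0"
  proof -
    have zz: "z * z = - 1" using q[OF that] by simp
    have "z ^ 4 = (z * z) * (z * z)" by (simp add: eval_nat_numeral)
    then have "k dvd 4" unfolding zz by (intro order) simp
    with divs that tr z(1) show ?thesis by auto
  qed
  show "k = 6" if "tr z = 1"
  proof -
    have zz: "z * z = z - 1" using q[OF that] by simp
    have "z ^ 3 = z * (z * z)" by (simp add: power3_eq_cube)
    also have "\<dots> = z * (z - 1)" by (simp only: zz)
    also have "\<dots> = (z * z) - z" by (simp add: algebra_simps)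
    also have "\<dots> = - 1" unfolding zz by simp
    finally have "z ^ 6 = 1" using power_mult[of z 3 2] by simp
    then have "k dvd 6" by (rule order)
    with divs that tr z(1) show ?thesis by auto
  qed
qed

text \<open>Recovers residue information from orders: cancelling \<open>r\<close> in
  \<open>r * gcd a k = r * (g * d)\<close> gives \<open>gcd a k = g * d\<close>.\<close>

lemma gcd_div_factor:
  fixes a k d n r :: nat
  assumes "k = n * d" "k div gcd a k = r" "d > 0" "n = r * g" "k > 0"
  shows "d dvd a" "gcd (a div d) n = g"
proof -
  have "r * gcd a k = k" using assms(2) by auto
  then have "r * gcd a k = r * (g * d)" using assms by (simp add: mult_ac)
  moreover have "r > 0" using assms by (auto intro: Nat.gr0I)
  ultimately have G: "gcd a k = g * d" by simp
  then show "d dvd a" by (metis dvd_triv_right dvd_trans gcd_dvd1)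
  then obtain a' where a': "a = a' * d" by (metis dvd_def mult.commute)
  have "gcd (a' * d) (n * d) = g * d" using G assms(1) a' by simp
  then have "gcd a' n * d = g * d" by (metis gcd_mult_distrib_nat mult.commute)
  then show "gcd (a div d) n = g" using assms(3) a' by simp
qed

lemma gcd_residues:
  fixes x :: nat
  shows "gcd x 6 = 1 \<Longrightarrow> x mod 6 \<in> {1, 5}" "gcd x 6 = 2 \<Longrightarrow> x mod 6 \<in> {2, 4}"
    "gcd x 6 = 3 \<Longrightarrow> x mod 6 = 3" "gcd x 6 = 6 \<Longrightarrow> x mod 6 = 0"
    "gcd x 10 = 1 \<Longrightarrow> x mod 10 \<in> {1, 3, 7, 9}" "gcd x 10 = 2 \<Longrightarrow> x mod 10 \<in> {2, 4, 6, 8}"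
    "gcd x 12 = 2 \<Longrightarrow> x mod 12 \<in> {2, 10}" "gcd x 12 = 3 \<Longrightarrow> x mod 12 \<in> {3, 9}"
    "gcd x 12 = 4 \<Longrightarrow> x mod 12 \<in> {4, 8}"
proof -
  have div: "e dvd x" if "gcd x n = g" "e dvd g" for e n g :: nat
    using that by (metis dvd_trans gcd_dvd1)
  have ndiv: "\<not> e dvd x" if "gcd x n = g" "e dvd n" "\<not> e dvd g" for e n g :: nat
    using that by (metis gcd_greatest)
  {
    assume g: "gcd x 6 = 1"
    then have "\<not> 2 dvd x" "\<not> 3 dvd x" using ndiv[OF g, of 2] ndiv[OF g, of 3] by auto
    then show "x mod 6 \<in> {1, 5}" by (simp, presburger)
  next
    assume g: "gcd x 6 = 2"
    then have "2 dvd x" "\<not> 3 dvd x" using div[OF g, of 2] ndiv[OF g, of 3] by auto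
    then show "x mod 6 \<in> {2, 4}" by (simp, presburger)
  next
    assume g: "gcd x 6 = 3"
    then have "\<not> 2 dvd x" "3 dvd x" using div[OF g, of 3] ndiv[OF g, of 2] by auto
    then show "x mod 6 = 3" by presburger
  next
    assume g: "gcd x 6 = 6"
    then have "6 dvd x" using div[OF g, of 6] by auto
    then show "x mod 6 = 0" by presburger
  next
    assume g: "gcd x 10 = 1"
    then have "\<not> 2 dvd x" "\<not> 5 dvd x" using ndiv[OF g, of 2] ndiv[OF g, of 5] by auto
    then show "x mod 10 \<in> {1, 3, 7, 9}" by (simp, presburger)
  next
    assume g: "gcd x 10 = 2"
    then have "2 dvd x" "\<not> 5 dvd x" using div[OF g, of 2] ndiv[OF g, of 5] by auto
    then show "x mod 10 \<in> {2, 4, 6, 8}" by (simp, presburger)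
  next
    assume g: "gcd x 12 = 2"
    then have "2 dvd x" "\<not> 3 dvd x" "\<not> 4 dvd x" using div[OF g, of 2] ndiv[OF g, of 3] ndiv[OF g, of 4] by auto
    then show "x mod 12 \<in> {2, 10}" by (simp, presburger)
  next
    assume g: "gcd x 12 = 3"
    then have "3 dvd x" "\<not> 2 dvd x" using div[OF g, of 3] ndiv[OF g, of 2] by auto
    then show "x mod 12 \<in> {3, 9}" by (simp, presburger)
  next
    assume g: "gcd x 12 = 4"
    then have "4 dvd x" "\<not> 3 dvd x" using div[OF g, of 4] ndiv[OF g, of 3] by auto
    then show "x mod 12 \<in> {4, 8}" by (simp, presburger)
  }
qed

text \<open>Each admissible pair of orders makes \<open>k\<close> a multiple of their least common
  multiple 6, 10 or 12, with cofactor \<open>d\<close>, and the orders fix the gcds of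
  \<open>a div d\<close> and \<open>b div d\<close> with it. For four pairs this is already the
  rule; for orders 5 and 10 it allows sixteen residue pairs, of which half must be excluded.\<close>

lemma mem_CT_indicesI:
  assumes k: "k > 0" and zero: "\<And>z. z \<in> primitive_roots k \<Longrightarrow> tr (z ^ b) - tr (z ^ a) = 1"
  shows "k \<in> CT_indices a b"
proof -
  obtain z where z: "z \<in> primitive_roots k" using prim_nonempty[OF k] by blast
  define r s where "r = k div gcd a k" and "s = k div gcd b k"
  have rs: "r * gcd a k = k" "s * gcd b k = k" unfolding r_def s_def by simp_all
  then have pos: "r > 0" "s > 0" using k by (auto intro: Nat.gr0I)
  have xy: "z ^ a \<in> primitive_roots r" "z ^ b \<in> primitive_roots s"
    using power_mem_prim[OF z k] by (simp_all add: r_def s_def)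
  note X = prim_of_tr[OF xy(1) pos(1)] and Y = prim_of_tr[OF xy(2) pos(2)]
  have dvd: "r dvd k" "s dvd k" using rs by (metis dvd_triv_left)+
  have uniq: "r = n" if "z ^ a \<in> primitive_roots n" "n > 0" for n using prim_unique[OF xy(1) that(1) pos(1) that(2)] .
  have uniq': "s = n" if "z ^ b \<in> primitive_roots n" "n > 0" for n using prim_unique[OF xy(2) that(1) pos(2) that(2)] .
  have "(r, s) \<in> {(6, 1), (2, 3), (3, 4), (4, 6), (5, 10)}"
    using order_classification[OF k zero z] X Y uniq[of 5] uniq'[of 10] by auto
  then consider "r = 6" "s = 1" | "r = 2" "s = 3" | "r = 3" "s = 4" | "r = 4" "s = 6" | "r = 5" "s = 10"
    by auto
  then show ?thesis
  proof cases
    case 1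
    then obtain d where d: "k = 6 * d" using dvd by (auto elim!: dvdE)
    have d0: "d > 0" using d k by simp
    note A = gcd_div_factor[OF d r_def[symmetric] d0, of 1] and B = gcd_div_factor[OF d s_def[symmetric] d0, of 6]
    have "d dvd a" "d dvd b" "a div d mod 6 \<in> {1, 5}" "b div d mod 6 = 0"
      using A B 1 k gcd_residues(1)[of "a div d"] gcd_residues(4)[of "b div d"] by auto
    then show ?thesis unfolding mem_CT_indices_iff by (intro exI[of _ d]) (use d d0 in auto)
  next
    case 2
    then have "2 dvd k" "3 dvd k" using dvd by auto
    then have "6 dvd k" by presburger
    then obtain d where d: "k = 6 * d" by (elim dvdE)
    have d0: "d > 0" using d k by simp
    note A = gcd_div_factor[OF d r_def[symmetric] d0, of 3] and B = gcd_div_factor[OF d s_def[symmetric] d0, of 2]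
    have "d dvd a" "d dvd b" "a div d mod 6 = 3" "b div d mod 6 \<in> {2, 4}"
      using A B 2 k gcd_residues(3)[of "a div d"] gcd_residues(2)[of "b div d"] by auto
    then show ?thesis unfolding mem_CT_indices_iff by (intro exI[of _ d]) (use d d0 in auto)
  next
    case 3
    then have "3 dvd k" "4 dvd k" using dvd by auto
    then have "12 dvd k" by presburger
    then obtain d where d: "k = 12 * d" by (elim dvdE)
    have d0: "d > 0" using d k by simp
    note A = gcd_div_factor[OF d r_def[symmetric] d0, of 4] and B = gcd_div_factor[OF d s_def[symmetric] d0, of 3]
    have "d dvd a" "d dvd b" "a div d mod 12 \<in> {4, 8}" "b div d mod 12 \<in> {3, 9}"
      using A B 3 k gcd_residues(9)[of "a div d"] gcd_residues(8)[of "b div d"] by auto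
    then show ?thesis unfolding mem_CT_indices_iff by (intro exI[of _ d]) (use d d0 in auto)
  next
    case 4
    then have "4 dvd k" "6 dvd k" using dvd by auto
    then have "12 dvd k" by presburger
    then obtain d where d: "k = 12 * d" by (elim dvdE)
    have d0: "d > 0" using d k by simp
    note A = gcd_div_factor[OF d r_def[symmetric] d0, of 3] and B = gcd_div_factor[OF d s_def[symmetric] d0, of 2]
    have "d dvd a" "d dvd b" "a div d mod 12 \<in> {3, 9}" "b div d mod 12 \<in> {2, 10}"
      using A B 4 k gcd_residues(8)[of "a div d"] gcd_residues(7)[of "b div d"] by auto
    then show ?thesis unfolding mem_CT_indices_iff by (intro exI[of _ d]) (use d d0 in auto)
  next
    case 5
    then obtain d where d: "k = 10 * d" using dvd by (auto elim!: dvdE)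
    have d0: "d > 0" using d k by simp
    note A = gcd_div_factor[OF d r_def[symmetric] d0, of 2] and B = gcd_div_factor[OF d s_def[symmetric] d0, of 1]
    define p q where "p = a div d" and "q = b div d"
    have pq: "d dvd a" "d dvd b" "p mod 10 \<in> {2, 4, 6, 8}" "q mod 10 \<in> {1, 3, 7, 9}"
      using A B 5 k gcd_residues(6)[of p] gcd_residues(5)[of q] by (auto simp: p_def q_def)
    define w where "w = z ^ d"
    have w: "w \<in> primitive_roots 10" using power_mem_prim[OF z k, of d] d d0 by (simp add: w_def)
    have wa: "z ^ a = w ^ p" and wb: "z ^ b = w ^ q"
      using pq by (simp_all add: w_def p_def q_def flip: power_mult)
    have w0: "w \<noteq> 0" using prim_nonzero[OF w] by simp
    have w5: "w ^ 5 = -1"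
    proof -
      have "w ^ 5 * w ^ 5 = 1" using prim_power_eq_1_iff[OF w, of 10] by (simp flip: power_add)
      moreover have "w ^ 5 \<noteq> 1" using prim_power_eq_1_iff[OF w, of 5] by simp
      ultimately show ?thesis by (metis square_eq_1_iff)
    qed
    text \<open>The remaining residues would give \<open>x = - y\<close> or \<open>x = - inverse y\<close>, hence \<open>2 * tr y = 1\<close>.\<close>
    have "tr (z ^ a) \<noteq> - tr (z ^ b)"
    proof
      assume "tr (z ^ a) = - tr (z ^ b)"
      then have "2 * tr (z ^ b) = 1" using zero[OF z] by simp
      moreover have "tr (z ^ b) * tr (z ^ b) = tr (z ^ b) + 1" using tr_prim_10 xy(2) 5 by simp
      then have "(2 * tr (z ^ b)) * (2 * tr (z ^ b)) = 2 * (2 * tr (z ^ b)) + 4" by (simp add: algebra_simps)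
      ultimately show False by simp
    qed
    moreover have "tr (z ^ a) = - tr (z ^ b)" if "[p = q + 5] (mod 10)"
    proof -
      have "w ^ p = w ^ (q + 5)" using prim_power_eq[OF w _ that] by simp
      then show ?thesis by (simp add: wa wb power_add w5 tr_def)
    qed
    moreover have "tr (z ^ a) = - tr (z ^ b)" if "[p + q = 5] (mod 10)"
    proof -
      have "w ^ (p + q) = w ^ 5" using prim_power_eq[OF w _ that] by simp
      then have "w ^ q * (- (w ^ p)) = 1" by (simp add: power_add w5 mult.commute)
      then have "inverse (w ^ q) = - (w ^ p)" by (rule inverse_unique)
      then have i: "w ^ p = - inverse (w ^ q)" by simp
      show ?thesis unfolding wa wb tr_def i by simp
    qed
    ultimately have n: "\<not> [p = q + 5] (mod 10)" "\<not> [p + q = 5] (mod 10)" by blast+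
    have "(p mod 10, q mod 10) \<in> {(2,1), (2,9), (4,3), (4,7), (6,3), (6,7), (8,1), (8,9)}"
    proof -
      have "(q + 5) mod 10 = (q mod 10 + 5) mod 10" by (rule mod_add_left_eq[symmetric])
      moreover have "(p + q) mod 10 = (p mod 10 + q mod 10) mod 10" by (rule mod_add_eq[symmetric])
      ultimately have n': "p mod 10 \<noteq> (q mod 10 + 5) mod 10" "(p mod 10 + q mod 10) mod 10 \<noteq> 5"
        using n by (simp_all add: cong_def)
      define P Q where "P = p mod 10" and "Q = q mod 10"
      have "P \<in> {2, 4, 6, 8}" "Q \<in> {1, 3, 7, 9}" "P \<noteq> (Q + 5) mod 10" "(P + Q) mod 10 \<noteq> 5"
        using pq n' by (simp_all only: P_def Q_def not_False_eq_True)
      then have "(P, Q) \<in> {(2,1), (2,9), (4,3), (4,7), (6,3), (6,7), (8,1), (8,9)}" by auto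
      then show ?thesis by (simp only: P_def Q_def)
    qed
    then show ?thesis unfolding mem_CT_indices_iff using pq d d0
      by (intro exI[of _ d] conjI disjI2 disjI1) (simp_all only: p_def q_def)
  qed
qed

lemma mem_CT_indices_iff_cyclo_dvd:
  assumes "k > 0"
  shows "k \<in> CT_indices a b \<longleftrightarrow> cyclo k dvd GT a b"
proof
  assume k: "k \<in> CT_indices a b"
  have "poly (cpoly (GT a b)) z = 0" if "z \<in> primitive_roots k" for z
    using tr_solution_of_mem_CT_indices(2)[OF k that] poly_GT_eq_0_iff[OF that assms]
    by (auto simp: tr_solution_def)
  then show "cyclo k dvd GT a b" using cyclo_dvd_iff[OF assms] by blast
next
  assume "cyclo k dvd GT a b"
  then have "tr (z ^ b) - tr (z ^ a) = 1" if "z \<in> primitive_roots k" for z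
    using cyclo_dvd_iff[OF assms] poly_GT_eq_0_iff[OF that assms] that by blast
  then show "k \<in> CT_indices a b" by (rule mem_CT_indicesI[OF assms])
qed

text \<open>60 is the least common multiple of 6, 10 and 12, so all the roots involved are roots of
  unity of one common order.\<close>

lemma CT_indices_dvd: "k \<in> CT_indices a b \<Longrightarrow> k dvd 60 * gcd a b"
proof -
  assume "k \<in> CT_indices a b"
  then obtain d where d: "d dvd a" "d dvd b" "k = 6 * d \<or> k = 10 * d \<or> k = 12 * d"
    unfolding mem_CT_indices_iff by auto
  then obtain e where "gcd a b = d * e" by (meson dvdE gcd_greatest)
  then have "60 * gcd a b = 6 * d * (10 * e)" "60 * gcd a b = 10 * d * (6 * e)" "60 * gcd a b = 12 * d * (5 * e)"
    by simp_all
  then show "k dvd 60 * gcd a b" using d(3) by (metis dvd_triv_left)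
qed

section \<open>The product \<open>CT\<close> and the multiplicity of its factors\<close>

lemma finite_CT_indices: "a > 0 \<Longrightarrow> finite (CT_indices a b)"
  using CT_indices_dvd by (intro finite_subset[of "CT_indices a b" "{k. k dvd 60 * gcd a b}"]) auto

lemma cpoly_CT:
  assumes "a > 0"
  shows "cpoly (CT a b) = lin_prod (\<Union>k\<in>CT_indices a b. primitive_roots k)"
proof -
  have pos: "k > 0" if "k \<in> CT_indices a b" for k using tr_solution_of_mem_CT_indices(1)[OF that] .
  have "cpoly (CT a b) = (\<Prod>k\<in>CT_indices a b. lin_prod (primitive_roots k))"
    using pos by (simp add: CT_def cpoly_prod cpoly_cyclo)
  also have "\<dots> = lin_prod (\<Union>k\<in>CT_indices a b. primitive_roots k)"
    using finite_CT_indices[OF assms] pos by (intro lin_prod_UN_prim[symmetric]) auto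
  finally show ?thesis .
qed

lemma CT_dvd_GT:
  assumes "a > 0"
  shows "CT a b dvd GT a b"
proof -
  have pos: "k > 0" if "k \<in> CT_indices a b" for k using tr_solution_of_mem_CT_indices(1)[OF that] .
  have fin: "finite (\<Union>k\<in>CT_indices a b. primitive_roots k)"
    using finite_CT_indices[OF assms] pos finite_prim by auto
  have "poly (cpoly (GT a b)) z = 0" if "z \<in> (\<Union>k\<in>CT_indices a b. primitive_roots k)" for z
    using that pos mem_CT_indices_iff_cyclo_dvd cyclo_dvd_iff by blast
  then show ?thesis using int_poly_dvd_iff_roots[OF cpoly_CT[OF assms] fin] by blast
qed

text \<open>The roots of \<open>CT a b\<close> are distinct. This bound later shows that the
  quotient is not constant.\<close>

lemma degree_CT_le:
  assumes "a > 0"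
  shows "degree (CT a b) \<le> 60 * gcd a b"
proof -
  have n: "60 * gcd a b > 0" using assms by simp
  have "degree (CT a b) = card (\<Union>k\<in>CT_indices a b. primitive_roots k)"
    using degree_cpoly[of "CT a b"] by (simp add: cpoly_CT[OF assms] degree_lin_prod)
  also have "\<dots> \<le> card {z::complex. z ^ (60 * gcd a b) = 1}"
  proof (rule card_mono)
    show "finite {z::complex. z ^ (60 * gcd a b) = 1}" using n by auto
    show "(\<Union>k\<in>CT_indices a b. primitive_roots k) \<subseteq> {z. z ^ (60 * gcd a b) = 1}"
      using roots_unity_eq_UN_prim[OF n] CT_indices_dvd by blast
  qed
  also have "\<dots> = 60 * gcd a b" using n by (rule card_roots_unity_eq)
  finally show ?thesis .
qed

lemma mult_poly_pderiv_monom: "z * poly (pderiv (monom 1 n)) z = of_nat n * z ^ n"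
  for z :: complex
  by (cases n) (simp_all add: pderiv_monom poly_monom)

text \<open>The operator z d/dz multiplies each monomial by its exponent. At a zero of
  \<open>GT a b\<close> only the second summand remains, the one that
  \<open>tr_solution_simple\<close> keeps away from 0.\<close>

lemma mult_pderiv_GT:
  assumes "z \<noteq> 0"
  shows "z * poly (pderiv (cpoly (GT a b))) z = of_nat (max a b) * poly (cpoly (GT a b)) z
     + z ^ max a b * (of_nat b * (z ^ b - inverse (z ^ b)) - of_nat a * (z ^ a - inverse (z ^ a)))"
proof -
  define N where "N = max a b"
  have le: "a \<le> N" "b \<le> N" by (simp_all add: N_def)
  have p: "z ^ (N - b) = z ^ N * inverse (z ^ b)" "z ^ (N - a) = z ^ N * inverse (z ^ a)"
    using assms le by (simp_all add: power_diff divide_inverse)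
  have "z * poly (pderiv (cpoly (GT a b))) z =
     z * poly (pderiv (monom 1 (N + b))) z + z * poly (pderiv (monom 1 (N - b))) z
     - z * poly (pderiv (monom 1 (N + a))) z - z * poly (pderiv (monom 1 (N - a))) z
     - z * poly (pderiv (monom 1 N)) z"
    by (simp add: GT_symmetric_form N_def cpoly_diff cpoly_add cpoly_monom pderiv_diff pderiv_add ring_distribs
      del: mult_poly_pderiv_monom)
  also have "\<dots> = (of_nat N + of_nat b) * (z ^ N * z ^ b) + (of_nat N - of_nat b) * (z ^ N * inverse (z ^ b))
     - (of_nat N + of_nat a) * (z ^ N * z ^ a) - (of_nat N - of_nat a) * (z ^ N * inverse (z ^ a)) - of_nat N * z ^ N"
    unfolding mult_poly_pderiv_monom using le by (simp only: power_add p of_nat_add of_nat_diff)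
  finally show ?thesis unfolding poly_GT[OF assms] N_def[symmetric] by (simp add: algebra_simps)
qed

lemma cyclo_square_not_dvd_GT:
  assumes k: "k > 0" and ab: "a > 0" "b > 0"
  shows "\<not> (cyclo k)\<^sup>2 dvd GT a b"
proof
  assume sq: "(cyclo k)\<^sup>2 dvd GT a b"
  then have "cyclo k dvd GT a b" by (rule dvd_trans[rotated]) (simp add: power2_eq_square)
  then have mem: "k \<in> CT_indices a b" using mem_CT_indices_iff_cyclo_dvd[OF k] by simp
  obtain z where z: "z \<in> primitive_roots k" using prim_nonempty[OF k] by blast
  have z0: "z \<noteq> 0" using prim_nonzero[OF z k] .
  obtain q where "GT a b = (cyclo k)\<^sup>2 * q" using sq by (elim dvdE)
  then have q: "GT a b = cyclo k * (cyclo k * q)" by (simp only: power2_eq_square mult.assoc)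
  have "cyclo k dvd cyclo k" by simp
  then have c0: "poly (cpoly (cyclo k)) z = 0" using cyclo_dvd_iff[OF k] z by blast
  have "poly (cpoly (GT a b)) z = 0" "poly (pderiv (cpoly (GT a b))) z = 0"
    by (simp_all add: q cpoly_mult c0 pderiv_mult)
  then have "of_nat b * (z ^ b - inverse (z ^ b)) = of_nat a * (z ^ a - inverse (z ^ a))"
    using mult_pderiv_GT[OF z0, of a b] z0 by simp
  with tr_solution_simple[OF tr_solution_of_mem_CT_indices(2)[OF mem z] _ _ ab] z0 show False by simp
qed

lemma cyclo_not_dvd_quotient:
  assumes k: "k > 0" and ab: "a > 0" "b > 0"
  shows "\<not> cyclo k dvd GT a b div CT a b"
proof
  assume d: "cyclo k dvd GT a b div CT a b"
  have GT: "GT a b = CT a b * (GT a b div CT a b)" using CT_dvd_GT[OF ab(1)] by simp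
  then have "cyclo k dvd GT a b" using d by (metis dvd_mult)
  then have mem: "k \<in> CT_indices a b" using mem_CT_indices_iff_cyclo_dvd[OF k] by simp
  then have "cyclo k dvd CT a b" unfolding CT_def using finite_CT_indices[OF ab(1)] by (intro dvd_prodI) auto
  then have "cyclo k * cyclo k dvd CT a b * (GT a b div CT a b)" using d by (rule mult_dvd_mono)
  then have "(cyclo k)\<^sup>2 dvd GT a b" using GT by (simp add: power2_eq_square)
  with cyclo_square_not_dvd_GT[OF assms] show False by simp
qed

subsection \<open>Integrals of periodic functions\<close>

definition periodic_1 :: "(real \<Rightarrow> real) \<Rightarrow> bool" where
  "periodic_1 f \<longleftrightarrow> (\<forall>x. f (x + 1) = f x)"

lemma periodic_1_add_of_nat: "periodic_1 f \<Longrightarrow> f (x + real n) = f x"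
proof (induction n)
  case (Suc n)
  have "f (x + real (Suc n)) = f ((x + real n) + 1)" by (simp add: algebra_simps)
  then show ?case using Suc by (simp add: periodic_1_def)
qed simp

lemma periodic_1_add_of_nat_fun: "periodic_1 f \<Longrightarrow> f \<circ> (+) (real n) = f"
  using periodic_1_add_of_nat[of f _ n] by (auto simp: fun_eq_iff add.commute)

lemma has_integral_periodic_1_nat:
  assumes f: "periodic_1 f" "(f has_integral I) {0..1}"
  shows "(f has_integral (real n * I)) {0..real n}"
proof (induction n)
  case (Suc n)
  have "(f has_integral I) {0 + real n..1 + real n}"
    using has_integral_shift_Icc_real[of f "real n" I 0 1] f by (simp add: periodic_1_add_of_nat_fun)
  then have "(f has_integral (real n * I + I)) {0..1 + real n}"
    using Suc by (intro has_integral_combine[of 0 "real n"]) auto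
  then show ?case by (simp add: algebra_simps)
qed (simp add: has_integral_refl)

lemma has_integral_periodic_1_scale:
  assumes f: "periodic_1 f" "(f has_integral I) {0..1}" and n: "n > 0"
  shows "((\<lambda>t. f (real n * t)) has_integral I) {0..1}"
proof -
  have "((\<lambda>x. f (real n * x)) has_integral (1 / \<bar>real n\<bar>) *\<^sub>R (real n * I)) ((\<lambda>x. x / real n) ` {0..real n})"
    using n by (intro has_integral_stretch_real has_integral_periodic_1_nat f) auto
  moreover have "(\<lambda>x. x / real n) ` {0..real n} = {0..1}"
  proof (intro equalityI subsetI)
    fix y :: real assume "y \<in> {0..1}"
    then show "y \<in> (\<lambda>x. x / real n) ` {0..real n}"
      using n by (intro image_eqI[of _ _ "y * real n"]) (auto simp: mult_left_le_one_le)
  qed (use n in \<open>auto simp: field_simps\<close>)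
  ultimately show ?thesis using n by simp
qed

lemma has_integral_periodic_1_shift:
  assumes f: "periodic_1 f" "(f has_integral I) {0..1}" and c: "c \<ge> 0"
  shows "((\<lambda>t. f (t + c)) has_integral I) {0..1}"
proof -
  define n where "n = nat \<lfloor>c\<rfloor>"
  define d where "d = c - real n"
  have d: "0 \<le> d" "d \<le> 1" using c by (auto simp: d_def n_def) linarith+
  have fi: "f integrable_on {0..1}" using f by auto
  have i1: "f integrable_on {0..d}" "f integrable_on {d..1}"
    using d by (auto intro: integrable_on_subinterval[OF fi])
  have a: "(f has_integral integral {0..d} f) {1..1 + d}"
    using has_integral_shift_Icc_real[of f 1 "integral {0..d} f" 0 d] i1(1) periodic_1_add_of_nat_fun[OF f(1), of 1]
    by (simp add: integrable_integral add.commute)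
  have b: "(f has_integral integral {d..1} f) {d..1}" using i1(2) by (simp add: integrable_integral)
  have "(f has_integral (integral {d..1} f + integral {0..d} f)) {d..1 + d}"
    using d by (intro has_integral_combine[OF _ _ b a]) auto
  moreover have "integral {d..1} f + integral {0..d} f = I"
    using Henstock_Kurzweil_Integration.integral_combine[OF d fi] integral_unique[OF f(2)] by simp
  ultimately have "(f has_integral I) {0 + d..1 + d}" by simp
  then have "((f \<circ> (+) d) has_integral I) {0..1}" by (subst has_integral_shift_Icc_real)
  moreover have "(\<lambda>t. f (t + c)) = f \<circ> (+) d"
  proof
    show "f (t + c) = (f \<circ> (+) d) t" for t
      using periodic_1_add_of_nat[OF f(1), of "t + d" n] by (simp add: d_def algebra_simps)
  qed
  ultimately show ?thesis by simp
qed

subsection \<open>Jensen's formula\<close>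

abbreviation circ :: "real \<Rightarrow> complex" where
  "circ t \<equiv> cis (2 * pi * t)"

lemma circ_add: "circ (s + t) = circ s * circ t"
  by (simp add: cis_mult ring_distribs)

lemma circ_add_1: "circ (t + 1) = circ t"
  by (simp only: circ_add) simp

lemma finite_circ_eq: "finite {t \<in> {0..1}. circ t = w}"
proof (cases "\<exists>s. s \<in> {0..1} \<and> circ s = w")
  case True
  then obtain s where s: "s \<in> {0..1}" "circ s = w" by blast
  have "{t \<in> {0..1}. circ t = w} \<subseteq> {s - 1, s, s + 1}"
  proof
    fix t assume t: "t \<in> {t \<in> {0..1}. circ t = w}"
    have "circ (t - s) = 1"
    proof -
      have "circ (t - s) * circ s = circ t" by (simp flip: circ_add)
      also have "\<dots> = 1 * circ s" using t s by simp
      finally show ?thesis by (simp only: mult_cancel_right) simp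
    qed
    then have "cos (2 * pi * (t - s)) = 1" by (simp add: complex_eq_iff)
    then obtain m :: int where "2 * pi * (t - s) = of_int m * 2 * pi" by (auto simp: cos_one_2pi_int)
    then have m: "t - s = of_int m" by simp
    have "-1 \<le> t - s" "t - s \<le> 1" using t s by auto
    then have "m = -1 \<or> m = 0 \<or> m = 1" unfolding m by linarith
    then show "t \<in> {s - 1, s, s + 1}" using m by auto
  qed
  then show ?thesis by (rule finite_subset) auto
next
  case False
  then have "{t \<in> {0..1}. circ t = w} = {}" by blast
  then show ?thesis by (simp only: finite.emptyI)
qed

lemma finite_poly_circ:
  assumes "p \<noteq> 0"
  shows "finite {t \<in> {0..1}. poly p (circ t) = 0}"
proof -
  have "{t \<in> {0..1}. poly p (circ t) = 0} = (\<Union>w\<in>{w. poly p w = 0}. {t \<in> {0..1}. circ t = w})" by auto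
  then show ?thesis using poly_roots_finite[OF assms] finite_circ_eq by simp
qed

definition log_dist :: "complex \<Rightarrow> real \<Rightarrow> real" where
  "log_dist \<alpha> t = ln (norm (1 - \<alpha> * circ t))"

lemma periodic_1_log_dist: "periodic_1 (log_dist \<alpha>)"
  by (simp add: periodic_1_def log_dist_def circ_add_1)

lemma log_dist_square:
  assumes "1 - \<alpha>\<^sup>2 * circ (2 * t) \<noteq> 0"
  shows "log_dist (\<alpha>\<^sup>2) (2 * t) = log_dist \<alpha> t + log_dist \<alpha> (t + 1/2)"
proof -
  have "circ (t + 1/2) = - circ t" by (simp add: ring_distribs flip: cis_mult)
  moreover have e2: "circ (2 * t) = circ t * circ t" using circ_add[of t t] by simp
  moreover have eq: "1 - \<alpha>\<^sup>2 * (circ t * circ t) = (1 - \<alpha> * circ t) * (1 + \<alpha> * circ t)"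
    by (simp add: power2_eq_square algebra_simps)
  ultimately show ?thesis using assms
    by (simp add: log_dist_def norm_mult ln_mult)
qed

text \<open>The mean of a function of period 1 is unchanged by doubling the variable and by a half
  turn.\<close>

lemma integral_log_dist_square:
  assumes "(log_dist \<alpha> has_integral I) {0..1}" "(log_dist (\<alpha>\<^sup>2) has_integral J) {0..1}"
  shows "J = 2 * I"
proof -
  have 1: "((\<lambda>t. log_dist \<alpha> t + log_dist \<alpha> (t + 1/2)) has_integral (I + I)) {0..1}"
    using has_integral_add[OF assms(1) has_integral_periodic_1_shift[OF periodic_1_log_dist assms(1), of "1/2"]] by simp
  have 2: "((\<lambda>t. log_dist (\<alpha>\<^sup>2) (real 2 * t)) has_integral J) {0..1}"
    by (rule has_integral_periodic_1_scale[OF periodic_1_log_dist assms(2)]) simp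
  \<comment> \<open>At these points \<open>ln\<close> takes its default value at 0 and is not
    additive; finitely many of them do not affect the integral.\<close>
  define Z where "Z = {t \<in> {0..1}. poly (1 - monom (\<alpha>\<^sup>2) 2) (circ t) = 0}"
  have "poly (1 - monom (\<alpha>\<^sup>2) 2) 0 \<noteq> 0" by (simp add: poly_monom)
  then have "1 - monom (\<alpha>\<^sup>2) 2 \<noteq> 0" by auto
  then have "finite Z" unfolding Z_def by (rule finite_poly_circ)
  moreover have "log_dist \<alpha> t + log_dist \<alpha> (t + 1/2) = log_dist (\<alpha>\<^sup>2) (real 2 * t)" if "t \<in> {0..1} - Z" for t
  proof -
    have "circ (2 * t) = (circ t)\<^sup>2" using circ_add[of t t] by (simp only: mult_2 power2_eq_square)
    then have "1 - \<alpha>\<^sup>2 * circ (2 * t) \<noteq> 0" using that by (simp add: Z_def poly_monom)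
    then show ?thesis using log_dist_square by simp
  qed
  ultimately have "((\<lambda>t. log_dist \<alpha> t + log_dist \<alpha> (t + 1/2)) has_integral J) {0..1}"
    using 2 by (rule has_integral_spike_finite)
  from has_integral_unique[OF 1 this] show ?thesis by simp
qed

text \<open>Squaring \<open>\<alpha>\<close> doubles the mean of \<open>log_dist \<alpha>\<close>, so a bounded mean must vanish.\<close>

lemma has_integral_log_dist_bounded:
  assumes int: "\<And>n. log_dist (\<alpha> ^ 2 ^ n) integrable_on {0..1}"
    and bound: "\<And>n. \<bar>integral {0..1} (log_dist (\<alpha> ^ 2 ^ n))\<bar> \<le> B"
  shows "(log_dist \<alpha> has_integral 0) {0..1}"
proof -
  define J where "J n = integral {0..1} (log_dist (\<alpha> ^ 2 ^ n))" for n
  have J: "(log_dist (\<alpha> ^ 2 ^ n) has_integral J n) {0..1}" for n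
    using int unfolding J_def by (rule integrable_integral)
  have step: "J (Suc n) = 2 * J n" for n
  proof (rule integral_log_dist_square[OF J])
    have "(\<alpha> ^ 2 ^ n)\<^sup>2 = \<alpha> ^ 2 ^ Suc n"
      by (simp only: power_mult[symmetric] power_Suc2)
    then show "(log_dist ((\<alpha> ^ 2 ^ n)\<^sup>2) has_integral J (Suc n)) {0..1}" using J[of "Suc n"] by (simp only:)
  qed
  have Jn: "J n = 2 ^ n * J 0" for n
  proof (induction n)
    case (Suc n)
    then show ?case using step[of n] by simp
  qed simp
  have "J 0 = 0"
  proof (rule ccontr)
    assume "J 0 \<noteq> 0"
    obtain n where "B / \<bar>J 0\<bar> < 2 ^ n" using real_arch_pow[of 2 "B / \<bar>J 0\<bar>"] by auto
    then have "B < 2 ^ n * \<bar>J 0\<bar>" using \<open>J 0 \<noteq> 0\<close> by (simp add: field_simps)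
    then have "B < \<bar>J n\<bar>" using Jn[of n] by (simp add: abs_mult)
    with bound[of n] show False by (simp add: J_def)
  qed
  then show ?thesis using J[of 0] by simp
qed

text \<open>Repeated squaring only shrinks the modulus, so the bounds ln (1 - |\<alpha>|) and ln (1
  + |\<alpha>|) serve all the powers at once.\<close>

lemma has_integral_log_dist_lt_1:
  assumes "norm \<alpha> < 1"
  shows "(log_dist \<alpha> has_integral 0) {0..1}"
proof (rule has_integral_log_dist_bounded)
  fix n
  define \<beta> where "\<beta> = \<alpha> ^ 2 ^ n"
  have \<beta>: "norm \<beta> \<le> norm \<alpha>"
    using assms power_decreasing[of 1 "2 ^ n" "norm \<alpha>"] by (simp add: \<beta>_def norm_power)
  have low: "1 - norm \<alpha> \<le> norm (1 - \<beta> * circ t)" for t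
    using norm_triangle_ineq2[of 1 "\<beta> * circ t"] \<beta> by (simp add: norm_mult)
  have up: "norm (1 - \<beta> * circ t) \<le> 1 + norm \<alpha>" for t
    using norm_triangle_ineq4[of 1 "\<beta> * circ t"] \<beta> by (simp add: norm_mult)
  have ne: "1 - \<beta> * circ t \<noteq> 0" for t using low[of t] assms by auto
  have cont: "continuous_on {0..1} (log_dist \<beta>)"
    unfolding log_dist_def using ne by (intro continuous_intros) auto
  from cont show int: "log_dist (\<alpha> ^ 2 ^ n) integrable_on {0..1}"
    unfolding \<beta>_def by (rule integrable_continuous_real)
  have lb: "ln (1 - norm \<alpha>) \<le> log_dist \<beta> t" for t
    unfolding log_dist_def using low[of t] assms by (intro ln_mono) auto
  have ub: "log_dist \<beta> t \<le> ln (1 + norm \<alpha>)" for t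
    unfolding log_dist_def using up[of t] ne[of t] by (intro ln_mono) auto
  have "\<bar>log_dist \<beta> t\<bar> \<le> \<bar>ln (1 - norm \<alpha>)\<bar> + \<bar>ln (1 + norm \<alpha>)\<bar>" for t
    using lb[of t] ub[of t] by linarith
  then have "norm (integral {0..1} (log_dist \<beta>)) \<le> (\<bar>ln (1 - norm \<alpha>)\<bar> + \<bar>ln (1 + norm \<alpha>)\<bar>) * (1 - 0)"
    using cont by (intro integral_bound[where a = 0 and b = "1::real" and B = "\<bar>ln (1 - norm \<alpha>)\<bar> + \<bar>ln (1 + norm \<alpha>)\<bar>"]) (auto simp: \<beta>_def)
  then show "\<bar>integral {0..1} (log_dist (\<alpha> ^ 2 ^ n))\<bar> \<le> \<bar>ln (1 - norm \<alpha>)\<bar> + \<bar>ln (1 + norm \<alpha>)\<bar>"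
    by (simp add: \<beta>_def)
qed

text \<open>On the unit circle, truncating the logarithm at \<open>\<delta> = 1 - r\<close> costs at most \<open>ln 2\<close> compared
  with the radius \<open>r < 1\<close>, where the mean is zero.\<close>

lemma integral_log_dist_eq_1:
  assumes "norm \<alpha> = 1"
  shows "log_dist \<alpha> integrable_on {0..1}" "\<bar>integral {0..1} (log_dist \<alpha>)\<bar> \<le> ln 2"
proof -
  define Z where "Z = {t \<in> {0..1}. poly [:1, -\<alpha>:] (circ t) = 0}"
  have finZ: "finite Z" unfolding Z_def by (intro finite_poly_circ) simp
  have Z: "1 - \<alpha> * circ t = 0 \<longleftrightarrow> t \<in> Z" if "t \<in> {0..1}" for t
    using that by (auto simp: Z_def mult.commute)
  define \<delta> where "\<delta> k = 1 / real (k + 2)" for k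
  have \<delta>: "0 < \<delta> k" "\<delta> k < 1" "\<delta> (Suc k) \<le> \<delta> k" for k by (auto simp: \<delta>_def field_simps)
  define h where "h k t = ln (max (norm (1 - \<alpha> * circ t)) (\<delta> k))" for k t
  \<comment> \<open>On \<open>Z\<close> the truncation equals \<open>ln (\<delta> k)\<close> and
    diverges; setting it to 0 there gives pointwise convergence for the monotone convergence
    theorem.\<close>
  define g where "g k t = (if t \<in> Z then 0 else h k t)" for k t
  have "continuous_on {0..1} (h k)" for k
    unfolding h_def using \<delta>(1)[of k] by (intro continuous_intros) (auto simp: max_def)
  then have hi: "h k integrable_on {0..1}" for k by (rule integrable_continuous_real)
  have gi: "g k integrable_on {0..1}" for k
    by (rule integrable_spike_finite[OF finZ _ hi[of k]]) (simp add: g_def)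
  have ghi: "integral {0..1} (g k) = integral {0..1} (h k)" for k
    by (rule integral_spike[of Z]) (auto simp: g_def finZ negligible_finite)
  have up: "norm (1 - \<alpha> * circ t) \<le> 2" for t
    using norm_triangle_ineq4[of 1 "\<alpha> * circ t"] assms by (simp add: norm_mult)
  have hup: "h k t \<le> ln 2" for k t
    unfolding h_def using up[of t] \<delta>[of k] by (intro ln_mono) (auto simp: max_def)
  have ub: "integral {0..1} (h k) \<le> ln 2" for k
  proof -
    have "integral {0..1} (h k) \<le> integral {0..1::real} (\<lambda>_. ln 2 :: real)"
      using hup by (intro integral_le hi) auto
    then show ?thesis by simp
  qed
  have lb: "- ln 2 \<le> integral {0..1} (h k)" for k
  proof -
    define \<beta> where "\<beta> = of_real (1 - \<delta> k) * \<alpha>"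
    have n\<beta>: "norm \<beta> = 1 - \<delta> k" using assms \<delta>[of k] by (simp add: \<beta>_def norm_mult del: of_real_diff)
    then have \<beta>: "norm \<beta> < 1" using \<delta>(1)[of k] by simp
    have int: "(log_dist \<beta> has_integral 0) {0..1}" by (rule has_integral_log_dist_lt_1[OF \<beta>])
    have "log_dist \<beta> t \<le> ln 2 + h k t" for t
    proof -
      have "1 - \<beta> * circ t \<noteq> 0"
      proof
        assume "1 - \<beta> * circ t = 0"
        then have "norm (\<beta> * circ t) = 1" by simp
        with \<beta> show False by (simp add: norm_mult)
      qed
      then have pos: "0 < norm (1 - \<beta> * circ t)" by simp
      have "1 - \<beta> * circ t = (1 - \<alpha> * circ t) + of_real (\<delta> k) * (\<alpha> * circ t)"
        by (simp add: \<beta>_def algebra_simps)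
      then have "norm (1 - \<beta> * circ t) \<le> norm (1 - \<alpha> * circ t) + norm (of_real (\<delta> k) * (\<alpha> * circ t))"
        using norm_triangle_ineq by metis
      also have "norm (of_real (\<delta> k) * (\<alpha> * circ t)) = \<delta> k" using \<delta>(1)[of k] assms by (simp add: norm_mult)
      also have "norm (1 - \<alpha> * circ t) + \<delta> k \<le> 2 * max (norm (1 - \<alpha> * circ t)) (\<delta> k)" by (simp add: max_def)
      finally have "log_dist \<beta> t \<le> ln (2 * max (norm (1 - \<alpha> * circ t)) (\<delta> k))"
        unfolding log_dist_def using pos by (intro ln_mono) auto
      also have "\<dots> = ln 2 + h k t" unfolding h_def using \<delta>(1)[of k] by (intro ln_mult_pos) auto
      finally show ?thesis .
    qed
    moreover have "(\<lambda>t. ln 2 + h k t) integrable_on {0..1}"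
      using integrable_add[OF integrable_continuous_real[OF continuous_on_const] hi[of k]] .
    ultimately have "integral {0..1} (log_dist \<beta>) \<le> integral {0..1} (\<lambda>t. ln 2 + h k t)"
      using has_integral_integrable[OF int] by (intro integral_le) auto
    then have "0 \<le> integral {0..1} (\<lambda>t. ln 2 + h k t)"
      using integral_unique[OF int] by simp
    also have "\<dots> = ln 2 + integral {0..1} (h k)" using hi[of k] by (subst integral_add) auto
    finally show ?thesis by simp
  qed
  have "lf' integrable_on {0..1} \<and> (\<lambda>k. integral {0..1} (g k)) \<longlonglongrightarrow> integral {0..1} lf'"
    if lf': "lf' = (\<lambda>t. if t \<in> Z then 0 else log_dist \<alpha> t)" for lf'
  proof (rule monotone_convergence_decreasing)
    show "g k integrable_on {0..1}" for k by (rule gi)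
    show "g (Suc k) t \<le> g k t" if "t \<in> {0..1}" for k t
    proof -
      have "h (Suc k) t \<le> h k t" unfolding h_def using \<delta>[of k] \<delta>[of "Suc k"] by (intro ln_mono) (auto simp: max_def)
      then show ?thesis by (simp add: g_def)
    qed
    show "(\<lambda>k. g k t) \<longlonglongrightarrow> lf' t" if t: "t \<in> {0..1}" for t
    proof (cases "t \<in> Z")
      case True
      then show ?thesis by (simp add: g_def lf')
    next
      case False
      then have pos: "0 < norm (1 - \<alpha> * circ t)" using Z[OF t] by simp
      have "\<delta> \<longlonglongrightarrow> 0" unfolding \<delta>_def by real_asymp
      then have "\<forall>\<^sub>F k in sequentially. \<delta> k < norm (1 - \<alpha> * circ t)" using pos by (rule order_tendstoD)
      then have "\<forall>\<^sub>F k in sequentially. g k t = lf' t"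
        by eventually_elim (use False in \<open>simp add: g_def h_def lf' log_dist_def max_def\<close>)
      then show ?thesis by (rule tendsto_eventually)
    qed
    show "bounded (range (\<lambda>k. integral {0..1} (g k)))"
    proof (rule boundedI)
      fix x assume "x \<in> range (\<lambda>k. integral {0..1} (g k))"
      then show "norm x \<le> ln 2" using ub lb by (auto simp: ghi abs_le_iff minus_le_iff)
    qed
  qed
  then have i: "(\<lambda>t. if t \<in> Z then 0 else log_dist \<alpha> t) integrable_on {0..1}"
    and lim: "(\<lambda>k. integral {0..1} (g k)) \<longlonglongrightarrow> integral {0..1} (\<lambda>t. if t \<in> Z then 0 else log_dist \<alpha> t)" by blast+
  show "log_dist \<alpha> integrable_on {0..1}"
    by (rule integrable_spike_finite[OF finZ _ i]) auto
  have eq: "integral {0..1} (\<lambda>t. if t \<in> Z then 0 else log_dist \<alpha> t) = integral {0..1} (log_dist \<alpha>)"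
    by (rule integral_spike[of Z]) (auto simp: finZ negligible_finite)
  have "integral {0..1} (log_dist \<alpha>) \<le> ln 2" "- ln 2 \<le> integral {0..1} (log_dist \<alpha>)"
    using lim ub lb unfolding eq ghi by (auto intro: LIMSEQ_le_const2 LIMSEQ_le_const)
  then show "\<bar>integral {0..1} (log_dist \<alpha>)\<bar> \<le> ln 2" by linarith
qed

lemma has_integral_log_dist_le_1:
  assumes "norm \<alpha> \<le> 1"
  shows "(log_dist \<alpha> has_integral 0) {0..1}"
proof (cases "norm \<alpha> = 1")
  case True
  then have "norm (\<alpha> ^ 2 ^ n) = 1" for n by (simp add: norm_power)
  then show ?thesis using integral_log_dist_eq_1 by (intro has_integral_log_dist_bounded[of \<alpha> "ln 2"]) auto
next
  case False
  then show ?thesis using assms by (intro has_integral_log_dist_lt_1) simp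
qed

text \<open>Inside the disc, conjugation turns the distance into the form of
  \<open>log_dist\<close>. Outside, pulling out the factor \<alpha> leaves
  \<open>inverse \<alpha>\<close>, which lies inside.\<close>

lemma jensen_linear:
  "((\<lambda>t. ln (norm (circ t - \<alpha>))) has_integral ln (max 1 (norm \<alpha>))) {0..1}"
proof (cases "norm \<alpha> \<le> 1")
  case True
  have "norm (circ t - \<alpha>) = norm (1 - cnj \<alpha> * circ t)" for t
  proof -
    have "norm (1 - cnj \<alpha> * circ t) = norm (cnj (1 - cnj \<alpha> * circ t))" by (simp only: complex_mod_cnj)
    also have "cnj (1 - cnj \<alpha> * circ t) = 1 - \<alpha> * cnj (circ t)" by simp
    also have "\<dots> = cnj (circ t) * (circ t - \<alpha>)"
      by (simp add: ring_distribs cis_cnj cis_mult mult.commute[of \<alpha>])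
    finally show ?thesis by (simp add: norm_mult)
  qed
  then have "(\<lambda>t. ln (norm (circ t - \<alpha>))) = log_dist (cnj \<alpha>)" by (simp add: fun_eq_iff log_dist_def)
  then show ?thesis using has_integral_log_dist_le_1[of "cnj \<alpha>"] True by (simp add: max_def)
next
  case False
  then have a0: "\<alpha> \<noteq> 0" by auto
  define \<beta> where "\<beta> = inverse \<alpha>"
  have \<beta>: "norm \<beta> < 1" using False by (simp add: \<beta>_def norm_inverse inverse_less_1_iff)
  have ne: "1 - \<beta> * circ t \<noteq> 0" for t
  proof
    assume "1 - \<beta> * circ t = 0"
    then have "norm (\<beta> * circ t) = 1" by simp
    with \<beta> show False by (simp add: norm_mult)
  qed
  have "ln (norm (circ t - \<alpha>)) = ln (norm \<alpha>) + log_dist \<beta> t" for t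
  proof -
    have "circ t - \<alpha> = - \<alpha> * (1 - \<beta> * circ t)" using a0 by (simp add: \<beta>_def field_simps)
    then have "norm (circ t - \<alpha>) = norm \<alpha> * norm (1 - \<beta> * circ t)" by (simp add: norm_mult)
    then show ?thesis using a0 ne[of t] by (simp add: log_dist_def ln_mult)
  qed
  moreover have "((\<lambda>t. ln (norm \<alpha>) + log_dist \<beta> t) has_integral (ln (norm \<alpha>) * (1 - 0) + 0)) {0..1}"
    using has_integral_const_real[of "ln (norm \<alpha>)" 0 1] \<beta>
    by (intro has_integral_add has_integral_log_dist_lt_1) (auto simp: mult.commute)
  ultimately show ?thesis using False by (simp add: max_def)
qed

lemma log_poly_mult:
  assumes "p \<noteq> 0" "q \<noteq> 0"
    "((\<lambda>t. ln (norm (poly p (circ t)))) has_integral I) {0..1}"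
    "((\<lambda>t. ln (norm (poly q (circ t)))) has_integral J) {0..1}"
  shows "((\<lambda>t. ln (norm (poly (p * q) (circ t)))) has_integral (I + J)) {0..1}"
proof (rule has_integral_spike_finite[OF finite_poly_circ[of "p * q"] _ has_integral_add[OF assms(3,4)]])
  fix t :: real assume "t \<in> {0..1} - {t \<in> {0..1}. poly (p * q) (circ t) = 0}"
  then show "ln (norm (poly (p * q) (circ t))) = ln (norm (poly p (circ t))) + ln (norm (poly q (circ t)))"
    by (auto simp: norm_mult ln_mult)
qed (use assms in auto)

text \<open>Of the product formula only two lower bounds are recorded: the leading coefficient gives
  measure at least 1 for integer polynomials, and a single root outside the disc bounds the Lehmer
  polynomial from below.\<close>

lemma jensen:
  assumes "p \<noteq> 0"
  shows "\<exists>I. ((\<lambda>t. ln (norm (poly p (circ t)))) has_integral I) {0..1} \<and> ln (norm (lead_coeff p)) \<le> I \<and>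
    (\<forall>z. poly p z = 0 \<and> norm z \<ge> 1 \<longrightarrow> ln (norm (lead_coeff p)) + ln (norm z) \<le> I)"
  using assms
proof (induction "degree p" arbitrary: p)
  case 0
  then obtain c where c: "p = [:c:]" "c \<noteq> 0" by (metis degree_eq_zeroE pCons_eq_0_iff)
  have "((\<lambda>t. ln (norm (poly p (circ t)))) has_integral (ln (norm c) * (1 - 0))) {0..1}"
    using has_integral_const_real[of "ln (norm c)" 0 1] c by simp
  then show ?case using c by (intro exI[of _ "ln (norm c)"]) auto
next
  case (Suc n)
  then have "\<not> constant (poly p)" by (simp add: constant_degree)
  then obtain a where a: "poly p a = 0" using fundamental_theorem_of_algebra by blast
  then obtain q where q: "p = [:- a, 1:] * q" by (metis poly_eq_0_iff_dvd dvdE)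
  then have q0: "q \<noteq> 0" using Suc.prems by auto
  have "degree p = Suc (degree q)" unfolding q using q0 by (subst degree_mult_eq) auto
  then have "n = degree q" using Suc.hyps(2) by simp
  from Suc.hyps(1)[OF this q0] obtain I where I:
    "((\<lambda>t. ln (norm (poly q (circ t)))) has_integral I) {0..1}" "ln (norm (lead_coeff q)) \<le> I"
    "\<forall>z. poly q z = 0 \<and> norm z \<ge> 1 \<longrightarrow> ln (norm (lead_coeff q)) + ln (norm z) \<le> I" by blast
  have l: "lead_coeff p = lead_coeff q" unfolding q by (subst lead_coeff_mult) simp
  have "((\<lambda>t. ln (norm (poly [:- a, 1:] (circ t)))) has_integral ln (max 1 (norm a))) {0..1}"
    using jensen_linear[of a] by (simp add: algebra_simps)
  from log_poly_mult[OF _ q0 this I(1)]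
  have "((\<lambda>t. ln (norm (poly p (circ t)))) has_integral (ln (max 1 (norm a)) + I)) {0..1}" unfolding q by simp
  moreover have m0: "0 \<le> ln (max 1 (norm a))" by simp
  then have "ln (norm (lead_coeff p)) \<le> ln (max 1 (norm a)) + I" unfolding l using I(2) by linarith
  moreover have "ln (norm (lead_coeff p)) + ln (norm z) \<le> ln (max 1 (norm a)) + I"
    if "poly p z = 0" "norm z \<ge> 1" for z
  proof (cases "z = a")
    case True
    then show ?thesis using that I(2) l by (simp add: max_def)
  next
    case False
    then have "poly q z = 0" using that(1) by (simp add: q)
    with I(3) that(2) have "ln (norm (lead_coeff q)) + ln (norm z) \<le> I" by blast
    then show ?thesis unfolding l using m0 by linarith
  qed
  ultimately show ?case by blast
qed

subsection \<open>Averaging along a torus line\<close>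

text \<open>Shifting \<open>t\<close> by \<open>s / q\<close> moves the fast argument by \<open>s\<close> and the slow one only by \<open>p * s / q\<close>;
  then average over \<open>s\<close>.\<close>

lemma integral_torus_line_le:
  fixes g :: "real \<Rightarrow> real \<Rightarrow> real" and p q :: nat
  assumes cont: "continuous_on UNIV (\<lambda>(u, v). g u v)"
    and periodic_1: "\<And>v. periodic_1 (\<lambda>u. g u v)" "\<And>u. periodic_1 (g u)"
    and lip: "\<And>u u' v. \<bar>g u v - g u' v\<bar> \<le> K * \<bar>u - u'\<bar>"
    and pq: "p > 0" "q > 0" and K: "K \<ge> 0"
  shows "integral {0..1} (\<lambda>t. g (real p * t) (real q * t)) \<le>
     integral {0..1} (\<lambda>u. integral {0..1} (g u)) + K * (real p / real q)"
proof -
  have cg: "continuous_on S (\<lambda>x. g (f x) (h x))" if "continuous_on S f" "continuous_on S h" for f h :: "'c::topological_space \<Rightarrow> real" and S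
    using continuous_on_compose2[OF cont continuous_on_Pair[OF that]] by simp
  define h where "h t = g (real p * t) (real q * t)" for t
  have periodic_1_h: "periodic_1 h"
    unfolding periodic_1_def h_def
  proof
    fix t
    have "g (real p * (t + 1)) (real q * (t + 1)) = g (real p * t + real p) (real q * t + real q)"
      by (simp add: ring_distribs)
    also have "\<dots> = g (real p * t) (real q * t + real q)"
      using periodic_1_add_of_nat[OF periodic_1(1), of "real p * t" p] .
    also have "\<dots> = g (real p * t) (real q * t)"
      using periodic_1_add_of_nat[OF periodic_1(2), of "real p * t" "real q * t" q] .
    finally show "g (real p * (t + 1)) (real q * (t + 1)) = g (real p * t) (real q * t)" .
  qed
  define I where "I = integral {0..1} h"
  have "continuous_on {0..1} h" unfolding h_def by (intro cg continuous_intros)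
  then have hI: "(h has_integral I) {0..1}" unfolding I_def by (intro integrable_integral integrable_continuous_real)
  define G where "G u = integral {0..1} (g u)" for u
  have Gi: "(g u has_integral G u) {0..1}" for u
    unfolding G_def by (intro integrable_integral integrable_continuous_real cg continuous_intros)
  have "continuous_on UNIV (\<lambda>u. integral (cbox 0 1) (g u))"
    by (intro integral_continuous_on_param) (auto intro: continuous_on_subset[OF cont])
  then have contG: "continuous_on S G" for S unfolding G_def by (auto intro: continuous_on_subset)
  have periodic_1_G: "periodic_1 G"
  proof -
    have "g (u + 1) = g u" for u using periodic_1(1) by (auto simp: periodic_1_def)
    then show ?thesis by (simp add: periodic_1_def G_def)
  qed
  define f where "f s t = g (real p * t) (s + real q * t)" for s t
  have contf: "continuous_on S (\<lambda>(s, t). f s t)" for S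
    unfolding f_def case_prod_unfold by (intro cg continuous_intros)
  have shifted: "I \<le> integral {0..1} (f s) + K * (real p / real q)" if s: "s \<in> {0..1}" for s
  proof -
    have "((\<lambda>t. h (t + s / real q)) has_integral I) {0..1}"
      using s by (intro has_integral_periodic_1_shift periodic_1_h hI) auto
    moreover have "(f s has_integral integral {0..1} (f s)) {0..1}"
      unfolding f_def by (intro integrable_integral integrable_continuous_real cg continuous_intros)
    then have "((\<lambda>t. f s t + K * (real p / real q)) has_integral
        (integral {0..1} (f s) + K * (real p / real q) * (1 - 0))) {0..1}"
      using has_integral_const_real[of "K * (real p / real q)" 0 1]
      by (intro has_integral_add) (auto simp: mult.commute)
    moreover have "h (t + s / real q) \<le> f s t + K * (real p / real q)" for t
    proof -
      have "h (t + s / real q) = g (real p * t + real p * s / real q) (s + real q * t)"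
        using pq by (simp add: h_def ring_distribs add.commute)
      also have "\<dots> \<le> g (real p * t) (s + real q * t) + K * \<bar>real p * t + real p * s / real q - real p * t\<bar>"
        using lip[of "real p * t + real p * s / real q" "s + real q * t" "real p * t"] by linarith
      also have "\<bar>real p * t + real p * s / real q - real p * t\<bar> \<le> real p / real q"
        using s pq by (simp add: divide_right_mono mult_left_le)
      finally show ?thesis using K by (simp add: f_def mult_left_mono)
    qed
    ultimately show ?thesis by (auto dest: has_integral_le)
  qed
  have contA: "continuous_on {0..1} (\<lambda>s. integral {0..1} (f s))"
    using integral_continuous_on_param[of "{0..1}" 0 1 f] contf by simp
  have "I = integral {0..1} (\<lambda>s::real. I)" by simp
  also have "\<dots> \<le> integral {0..1} (\<lambda>s. integral {0..1} (f s) + K * (real p / real q))"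
    using shifted by (intro integral_le integrable_continuous_real continuous_intros contA) auto
  also have "\<dots> = integral {0..1} (\<lambda>s. integral {0..1} (f s)) + K * (real p / real q)"
    using integrable_continuous_real[OF contA] by (subst integral_add) auto
  finally have 1: "I \<le> integral {0..1} (\<lambda>s. integral {0..1} (f s)) + K * (real p / real q)" .
  have 2: "integral {0..1} (\<lambda>s. integral {0..1} (f s)) = integral {0..1} (\<lambda>t. integral {0..1} (\<lambda>s. f s t))"
    using integral_swap_continuous[of 0 0 1 1 f] contf by simp
  \<comment> \<open>After the swap, \<open>s\<close> runs through a full period of the fast
    variable, so the offset \<open>real q * t\<close> disappears; the factor \<open>p\<close> in the
    slow variable disappears by rescaling.\<close>
  have 3: "integral {0..1} (\<lambda>t. integral {0..1} (\<lambda>s. f s t)) = integral {0..1} (\<lambda>t. G (real p * t))"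
  proof (rule integral_cong)
    fix t :: real assume "t \<in> {0..1}"
    then have "((\<lambda>s. g (real p * t) (s + real q * t)) has_integral G (real p * t)) {0..1}"
      by (intro has_integral_periodic_1_shift periodic_1 Gi) auto
    then show "integral {0..1} (\<lambda>s. f s t) = G (real p * t)" unfolding f_def by (rule integral_unique)
  qed
  have 4: "integral {0..1} (\<lambda>t. G (real p * t)) = integral {0..1} G"
  proof (rule integral_unique)
    have "(G has_integral integral {0..1} G) {0..1}"
      by (intro integrable_integral integrable_continuous_real contG)
    then show "((\<lambda>t. G (real p * t)) has_integral integral {0..1} G) {0..1}"
      using pq by (intro has_integral_periodic_1_scale periodic_1_G) auto
  qed
  have "I \<le> integral {0..1} G + K * (real p / real q)" using 1 2 3 4 by linarith
  then show ?thesis unfolding I_def h_def[abs_def] G_def[abs_def] .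
qed

lemma integral_step_le:
  fixes f :: "real \<Rightarrow> real"
  assumes f: "f integrable_on {0..1}" and xy: "0 \<le> x" "x \<le> y" "y \<le> 1"
    and le: "\<And>t. t \<in> {0..x} \<Longrightarrow> f t \<le> A" "\<And>t. t \<in> {x..y} \<Longrightarrow> f t \<le> B" "\<And>t. t \<in> {y..1} \<Longrightarrow> f t \<le> A"
  shows "integral {0..1} f \<le> A * (1 - (y - x)) + B * (y - x)"
proof -
  have i: "f integrable_on {0..x}" "f integrable_on {x..y}" "f integrable_on {y..1}" "f integrable_on {0..y}"
    using xy by (auto intro: integrable_on_subinterval[OF f])
  have c: "integral {u..v} f \<le> C * (v - u)"
    if "f integrable_on {u..v}" "\<And>t. t \<in> {u..v} \<Longrightarrow> f t \<le> C" "u \<le> v" for u v C :: real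
  proof -
    have "integral {u..v} f \<le> integral {u..v} (\<lambda>_. C)" using that by (intro integral_le) auto
    then show ?thesis using that(3) by (simp add: mult.commute)
  qed
  have "integral {0..1} f = integral {0..x} f + integral {x..y} f + integral {y..1} f"
    using Henstock_Kurzweil_Integration.integral_combine[OF _ _ f, of y]
      Henstock_Kurzweil_Integration.integral_combine[OF _ _ i(4), of x] xy by simp
  also have "\<dots> \<le> A * (x - 0) + B * (y - x) + A * (1 - y)"
    using i xy le by (intro add_mono c) auto
  finally show ?thesis by (simp add: algebra_simps)
qed

subsection \<open>The fast integral\<close>

text \<open>The map \<open>z + inverse z\<close> sends circles to ellipses with foci 2 and -2, and
  this is the focal sum. With a square root of \<open>z\<close>, the two distances become squared
  norms of a sum and a difference, so the parallelogram law applies.\<close>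

lemma norm_joukowski:
  fixes z :: complex
  assumes "z \<noteq> 0"
  shows "norm (z + inverse z - 2) + norm (z + inverse z + 2) = 2 * (norm z + inverse (norm z))"
proof -
  define s where "s = csqrt z"
  have s: "s\<^sup>2 = z" "s \<noteq> 0" using assms by (auto simp: s_def)
  have "z + inverse z - 2 = (s - inverse s)\<^sup>2" "z + inverse z + 2 = (s + inverse s)\<^sup>2"
    using s(2) by (simp_all add: s(1)[symmetric] power2_eq_square algebra_simps)
  then have "norm (z + inverse z - 2) + norm (z + inverse z + 2) = (norm (s - inverse s))\<^sup>2 + (norm (s + inverse s))\<^sup>2"
    by (simp add: norm_power)
  also have "\<dots> = 2 * ((norm s)\<^sup>2 + (norm (inverse s))\<^sup>2)"
  proof -
    have "(norm (x - y))\<^sup>2 + (norm (x + y))\<^sup>2 = 2 * ((norm x)\<^sup>2 + (norm y)\<^sup>2)" for x y :: complex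
      by (simp only: cmod_power2) (simp add: power2_eq_square algebra_simps)
    then show ?thesis by blast
  qed
  also have "\<dots> = 2 * (norm z + inverse (norm z))"
    by (simp add: s(1)[symmetric] norm_power norm_inverse power_inverse)
  finally show ?thesis .
qed

lemma add_inverse_le_imp_le:
  fixes R r :: real
  assumes "R \<ge> 1" "r \<ge> 1" "R + inverse R \<le> r + inverse r"
  shows "R \<le> r"
proof (rule ccontr)
  assume "\<not> R \<le> r"
  then have "r < R" by simp
  moreover have "R * r > 1" using assms \<open>r < R\<close> by (metis less_1_mult mult.right_neutral mult_1 order_le_less order_less_le_trans)
  ultimately have "(R - r) * (R * r - 1) > 0" by simp
  moreover have "(R - r) * (R * r - 1) = R * r * (R + inverse R - (r + inverse r))"
    using assms by (simp add: field_simps)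
  moreover have "R * r * (R + inverse R - (r + inverse r)) \<le> 0"
    using assms by (intro mult_nonneg_nonpos) auto
  ultimately show False by linarith
qed

text \<open>With w = z + 1/z the integrand is, up to a unimodular factor, the product of
  \<open>circ v - z\<close> and \<open>circ v - inverse z\<close>. Jensen's formula gives ln R for R
  the larger of |z| and 1/|z|, and the focal sum bounds R + 1/R by
  \<open>max 2 \<bar>c\<bar> + \<epsilon>\<close>.\<close>

lemma integral_log_cos_le:
  fixes c \<epsilon> \<rho> :: real
  assumes "\<epsilon> \<ge> 0" "\<rho> \<ge> 1" "max 2 \<bar>c\<bar> + \<epsilon> \<le> \<rho> + inverse \<rho>"
  shows "integral {0..1} (\<lambda>v. ln (norm (of_real (2 * cos (2 * pi * v)) - Complex c \<epsilon>))) \<le> ln \<rho>"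
proof -
  define w where "w = Complex c \<epsilon>"
  have "\<exists>z. poly [:1, - w, 1:] z = 0"
    by (rule fundamental_theorem_of_algebra) (simp add: constant_degree)
  then obtain z where "1 - z * w + z * z = 0" by (auto simp: algebra_simps)
  then have z: "z * z = z * w - 1" by (simp add: algebra_simps)
  then have z0: "z \<noteq> 0" by auto
  then have w: "w = z + inverse z" using z by (simp add: field_simps)
  have eq: "norm (of_real (2 * cos (2 * pi * v)) - w) = norm (poly ([:- z, 1:] * [:- inverse z, 1:]) (circ v))" for v
  proof -
    have "circ v * cnj (circ v) = 1" by (simp add: cis_cnj cis_mult)
    moreover have "of_real (2 * cos (2 * pi * v)) = circ v + cnj (circ v)" by (simp add: complex_eq_iff)
    ultimately have "circ v * (of_real (2 * cos (2 * pi * v)) - w) = (circ v - z) * (circ v - inverse z)"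
      using z0 by (simp add: w algebra_simps)
    then have "norm (circ v) * norm (of_real (2 * cos (2 * pi * v)) - w) = norm ((circ v - z) * (circ v - inverse z))"
      by (metis norm_mult)
    then show ?thesis by (simp add: algebra_simps)
  qed
  have "((\<lambda>t. ln (norm (poly ([:- z, 1:] * [:- inverse z, 1:]) (circ t)))) has_integral
      (ln (max 1 (norm z)) + ln (max 1 (norm (inverse z))))) {0..1}"
  proof (rule log_poly_mult)
    have "poly [:- y, 1:] x = x - y" for x y :: complex by simp
    then show "((\<lambda>t. ln (norm (poly [:- z, 1:] (circ t)))) has_integral ln (max 1 (norm z))) {0..1}"
      "((\<lambda>t. ln (norm (poly [:- inverse z, 1:] (circ t)))) has_integral ln (max 1 (norm (inverse z)))) {0..1}"
      using jensen_linear by presburger+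
  qed auto
  then have int: "integral {0..1} (\<lambda>v. ln (norm (of_real (2 * cos (2 * pi * v)) - w))) =
     ln (max 1 (norm z)) + ln (max 1 (norm (inverse z)))"
    unfolding eq by (rule integral_unique)
  define R where "R = max (norm z) (inverse (norm z))"
  have R: "R \<ge> 1 \<and> R + inverse R = norm z + inverse (norm z) \<and>
      ln (max 1 (norm z)) + ln (max 1 (norm (inverse z))) = ln R"
  proof (cases "norm z \<ge> 1")
    case True
    then have "inverse (norm z) \<le> 1" by (simp add: inverse_le_1_iff)
    then have "R = norm z" "max 1 (norm z) = norm z" "max 1 (norm (inverse z)) = 1"
      using True by (auto simp: R_def norm_inverse)
    then show ?thesis using True by simp
  next
    case False
    then have "inverse (norm z) \<ge> 1" using z0 by (simp add: one_le_inverse_iff)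
    then have "R = inverse (norm z)" "max 1 (norm z) = 1" "max 1 (norm (inverse z)) = inverse (norm z)"
      using False by (auto simp: R_def norm_inverse)
    then show ?thesis using \<open>inverse (norm z) \<ge> 1\<close> by simp
  qed
  have "R \<le> \<rho>"
  proof (rule add_inverse_le_imp_le)
    have 1: "2 * (R + inverse R) = norm (w - 2) + norm (w + 2)"
      using norm_joukowski[OF z0] R w by simp
    have 2: "w - 2 = of_real (c - 2) + of_real \<epsilon> * \<i>" "w + 2 = of_real (c + 2) + of_real \<epsilon> * \<i>"
      by (simp_all add: w_def complex_eq_iff)
    have 3: "norm (of_real y + of_real \<epsilon> * \<i>) \<le> \<bar>y\<bar> + \<epsilon>" for y
      using norm_triangle_ineq[of "of_real y" "of_real \<epsilon> * \<i>"] assms(1) by (simp add: norm_mult)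
    have "2 * (R + inverse R) \<le> \<bar>c - 2\<bar> + \<bar>c + 2\<bar> + 2 * \<epsilon>"
      unfolding 1 2 using 3[of "c - 2"] 3[of "c + 2"] by linarith
    also have "\<bar>c - 2\<bar> + \<bar>c + 2\<bar> = 2 * max 2 \<bar>c\<bar>" by (simp add: max_def abs_if)
    finally show "R + inverse R \<le> \<rho> + inverse \<rho>" using assms(3) by argo
  qed (use R assms in auto)
  then have "ln R \<le> ln \<rho>" using R by (intro ln_mono) auto
  then have "integral {0..1} (\<lambda>v. ln (norm (of_real (2 * cos (2 * pi * v)) - w))) \<le> ln \<rho>"
    unfolding int using R by simp
  then show ?thesis unfolding w_def .
qed

subsection \<open>The Mahler measure\<close>

lemma mahler_measure_eq:
  "((\<lambda>t. ln (norm (poly p (circ t)))) has_integral I) {0..1} \<Longrightarrow> mahler_measure p = exp I"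
  by (simp add: mahler_measure_def integral_unique)

lemma mahler_measure_mult:
  assumes "p \<noteq> 0" "q \<noteq> 0"
  shows "mahler_measure (p * q) = mahler_measure p * mahler_measure q"
proof -
  obtain I J where IJ: "((\<lambda>t. ln (norm (poly p (circ t)))) has_integral I) {0..1}"
    "((\<lambda>t. ln (norm (poly q (circ t)))) has_integral J) {0..1}"
    using jensen assms by meson
  show ?thesis
    using mahler_measure_eq[OF log_poly_mult[OF assms IJ]] mahler_measure_eq[OF IJ(1)] mahler_measure_eq[OF IJ(2)]
    by (simp add: exp_add)
qed

lemma mahler_measure_int_ge_1:
  assumes "p \<noteq> 0"
  shows "mahler_measure (cpoly p) \<ge> 1"
proof -
  obtain I where I: "((\<lambda>t. ln (norm (poly (cpoly p) (circ t)))) has_integral I) {0..1}"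
    "ln (norm (lead_coeff (cpoly p))) \<le> I"
    using jensen[of "cpoly p"] assms by (auto simp: cpoly_eq_0_iff)
  have "lead_coeff p \<noteq> 0" using assms by simp
  then have "\<bar>lead_coeff p\<bar> \<ge> 1" by linarith
  then have "norm (lead_coeff (cpoly p)) \<ge> 1" unfolding lead_coeff_cpoly by simp
  then have "0 \<le> I" using I(2) by (intro order_trans[OF _ I(2)]) simp
  then show ?thesis using mahler_measure_eq[OF I(1)] by simp
qed

text \<open>For a monic polynomial one real root beyond 1 bounds the measure from below by that
  root.\<close>

lemma mahler_measure_lehmer_ge: "mahler_measure (cpoly lehmer_poly) \<ge> 47/40"
proof -
  define f where "f x = poly (map_poly real_of_int lehmer_poly) x" for x
  have f: "f x = 1 + x - x^3 - x^4 - x^5 - x^6 - x^7 + x^9 + x^10" for x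
    by (simp add: f_def lehmer_poly_def map_poly_pCons algebra_simps eval_nat_numeral)
  \<comment> \<open>47/40 = 1.175 lies just below the real root 1.17628..., so the sign change is
    exact rational arithmetic.\<close>
  have "f (47/40) \<le> 0" "0 \<le> f 2" unfolding f by (simp_all add: power_divide)
  moreover have "continuous_on {47/40..2} f" unfolding f by (intro continuous_intros)
  ultimately obtain x where x: "47/40 \<le> x" "f x = 0"
    using IVT'[of f "47/40" 0 2] by auto
  have "poly (cpoly lehmer_poly) (of_real x) = of_real (f x)"
    unfolding f by (simp add: lehmer_poly_def map_poly_pCons algebra_simps eval_nat_numeral)
  then have root: "poly (cpoly lehmer_poly) (of_real x) = 0" using x by simp
  have lead: "lead_coeff (cpoly lehmer_poly) = 1"
    unfolding lead_coeff_cpoly by (simp add: lehmer_poly_def)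
  then have ne: "cpoly lehmer_poly \<noteq> 0" by auto
  from jensen[OF ne] obtain I where I: "((\<lambda>t. ln (norm (poly (cpoly lehmer_poly) (circ t)))) has_integral I) {0..1}"
    "\<forall>z. poly (cpoly lehmer_poly) z = 0 \<and> norm z \<ge> 1 \<longrightarrow>
      ln (norm (lead_coeff (cpoly lehmer_poly))) + ln (norm z) \<le> I" by blast
  have "ln x \<le> I" using I(2)[rule_format, of "of_real x"] root x lead by simp
  moreover have "ln (47/40) \<le> ln x" using x by (intro ln_mono) auto
  ultimately have "ln (47/40) \<le> I" by linarith
  then have "exp (ln (47/40)) \<le> exp I" by (simp only: exp_le_cancel_iff)
  moreover have "exp (ln (47/40)) = (47/40 :: real)" by (rule exp_ln) simp
  ultimately show ?thesis using mahler_measure_eq[OF I(1)] by linarith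
qed

section \<open>Upper bound for the Mahler measure of \<open>GT\<close>\<close>

lemma ln_diff_le:
  fixes x y e :: real
  assumes "e > 0" "x \<ge> e" "y \<ge> e"
  shows "\<bar>ln x - ln y\<bar> \<le> \<bar>x - y\<bar> / e"
proof -
  have *: "ln x - ln y \<le> \<bar>x - y\<bar> / e" if "x \<ge> e" "y \<ge> e" for x y
  proof -
    have "ln x - ln y = ln (x / y)" using that assms(1) by (simp add: ln_div)
    also have "\<dots> \<le> x / y - 1" using that assms(1) by (intro ln_le_minus_one) auto
    also have "\<dots> = (x - y) / y" using that assms(1) by (simp add: field_simps)
    also have "\<dots> \<le> \<bar>x - y\<bar> / y" using that assms(1) by (intro divide_right_mono) auto
    also have "\<dots> \<le> \<bar>x - y\<bar> / e" using that assms(1) by (intro divide_left_mono) auto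
    finally show ?thesis .
  qed
  show ?thesis using *[of x y] *[of y x] assms by (auto simp: abs_le_iff abs_minus_commute)
qed

lemma cos_diff_le: "\<bar>cos x - cos y\<bar> \<le> \<bar>x - y\<bar>" for x y :: real
proof -
  have *: "\<bar>cos x - cos y\<bar> \<le> \<bar>x - y\<bar>" if xy: "x < y" for x y :: real
  proof -
    obtain z where "cos y - cos x = (y - x) * (- sin z)"
      using MVT2[OF xy, of cos "\<lambda>z. - sin z", OF DERIV_cos] by blast
    then have "\<bar>cos y - cos x\<bar> = \<bar>y - x\<bar> * \<bar>sin z\<bar>" by (simp add: abs_mult)
    also have "\<dots> \<le> \<bar>y - x\<bar> * 1" by (intro mult_left_mono) auto
    finally show ?thesis by (simp add: abs_minus_commute)
  qed
  show ?thesis using *[of x y] *[of y x] by (cases x y rule: linorder_cases) (auto simp: abs_minus_commute)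
qed

text \<open>The thresholds are the angles with cosine 1/2 and -1/2; in both cases the bound 2 holds
  on two thirds of the period.\<close>

lemma abs_slow_le_2:
  fixes u :: real
  shows "u \<in> {1/6..5/6} \<Longrightarrow> \<bar>1 + 2 * cos (2 * pi * u)\<bar> \<le> 2"
    and "u \<in> {0..1/3} \<union> {2/3..1} \<Longrightarrow> \<bar>- 1 + 2 * cos (2 * pi * u)\<bar> \<le> 2"
proof -
  have refl: "cos (2 * pi * u) = cos (2 * pi * (1 - u))" for u
    using cos_2pi_minus[of "2 * pi * u"] by (simp add: right_diff_distrib)
  have c1: "cos (2 * pi * u) \<le> 1/2" if "1/6 \<le> u" "u \<le> 1/2" for u
  proof -
    have "cos (2 * pi * u) \<le> cos (pi / 3)"
      using that by (intro cos_monotone_0_pi_le) (auto simp: field_simps)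
    then show ?thesis by (simp add: cos_60)
  qed
  have c2: "cos (2 * pi * u) \<ge> - (1/2)" if "0 \<le> u" "u \<le> 1/3" for u
  proof -
    have "cos (2 * pi / 3) \<le> cos (2 * pi * u)"
      using that by (intro cos_monotone_0_pi_le) (auto simp: field_simps)
    then show ?thesis by (simp add: cos_120)
  qed
  have b: "- 1 \<le> cos (2 * pi * u)" "cos (2 * pi * u) \<le> 1" for u by simp_all
  {
    assume "u \<in> {1/6..5/6}"
    then have "cos (2 * pi * u) \<le> 1/2" using c1[of u] c1[of "1 - u"] refl[of u] by (cases "u \<le> 1/2") auto
    then show "\<bar>1 + 2 * cos (2 * pi * u)\<bar> \<le> 2" using b[of u] by linarith
  next
    assume "u \<in> {0..1/3} \<union> {2/3..1}"
    then have "cos (2 * pi * u) \<ge> - (1/2)" using c2[of u] c2[of "1 - u"] refl[of u] by auto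
    then show "\<bar>- 1 + 2 * cos (2 * pi * u)\<bar> \<le> 2" using b[of u] by linarith
  }
qed

text \<open>The sign \<sigma> records which exponent is fast: 1 for \<open>b\<close>, -1 for
  \<open>a\<close>. Where the real part of the shifted centre lies in [-2, 2], the fast integral is
  at most \<open>ln \<rho>0\<close>; on the remaining third the bound 3 gives
  \<open>ln \<rho>1\<close>.\<close>

lemma integral_log_shifted_le:
  fixes \<epsilon> \<rho>0 \<rho>1 \<sigma> :: real and p q :: nat
  assumes \<epsilon>: "\<epsilon> > 0" and \<rho>: "\<rho>0 \<ge> 1" "\<rho>1 \<ge> 1" "2 + \<epsilon> \<le> \<rho>0 + inverse \<rho>0" "3 + \<epsilon> \<le> \<rho>1 + inverse \<rho>1"
    and \<sigma>: "\<sigma> = 1 \<or> \<sigma> = -1" and pq: "p > 0" "q > 0"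
  shows "integral {0..1} (\<lambda>t. ln (norm (of_real (2 * cos (2 * pi * (real q * t)))
       - Complex (\<sigma> + 2 * cos (2 * pi * (real p * t))) \<epsilon>))) \<le>
     2/3 * ln \<rho>0 + 1/3 * ln \<rho>1 + 4 * pi / \<epsilon> * (real p / real q)"
proof -
  define c where "c u = \<sigma> + 2 * cos (2 * pi * u)" for u
  define g where "g u v = ln (norm (of_real (2 * cos (2 * pi * v)) - Complex (c u) \<epsilon>))" for u v
  have low: "norm (of_real x - Complex y \<epsilon>) \<ge> \<epsilon>" for x y :: real
    using abs_Im_le_cmod[of "of_real x - Complex y \<epsilon>"] \<epsilon> by simp
  have pos: "norm (of_real x - Complex y \<epsilon>) > 0" for x y :: real
    using low[of x y] \<epsilon> by linarith
  have cosper: "cos (2 * pi * (x + 1)) = cos (2 * pi * x)" for x :: real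
    by (simp add: distrib_left)
  have "integral {0..1} (\<lambda>t. g (real p * t) (real q * t)) \<le>
     integral {0..1} (\<lambda>u. integral {0..1} (g u)) + 4 * pi / \<epsilon> * (real p / real q)"
  proof (rule integral_torus_line_le)
    have ne: "of_real (2 * cos (2 * pi * v)) - Complex (c u) \<epsilon> \<noteq> 0" for u v
      using pos[of "2 * cos (2 * pi * v)" "c u"] by auto
    have "continuous_on UNIV (\<lambda>x. g (fst x) (snd x))"
      unfolding g_def c_def Complex_eq using ne unfolding c_def Complex_eq
      by (intro continuous_intros) auto
    then show "continuous_on UNIV (\<lambda>(u, v). g u v)" by (simp add: case_prod_unfold)
    show "periodic_1 (\<lambda>u. g u v)" "periodic_1 (g u)" for u v
      by (simp_all only: periodic_1_def g_def c_def cosper) simp_all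
    \<comment> \<open>The argument of \<open>ln\<close> stays at least \<epsilon>, which gives the
      factor 1/\<epsilon>; the slow term 2 cos (2 pi u) contributes 4 pi.\<close>
    show "\<bar>g u v - g u' v\<bar> \<le> 4 * pi / \<epsilon> * \<bar>u - u'\<bar>" for u u' v
    proof -
      define x where "x = complex_of_real (2 * cos (2 * pi * v))"
      have "\<bar>g u v - g u' v\<bar> \<le> \<bar>norm (x - Complex (c u) \<epsilon>) - norm (x - Complex (c u') \<epsilon>)\<bar> / \<epsilon>"
        unfolding g_def x_def by (rule ln_diff_le[OF \<epsilon> low low])
      also have "\<bar>norm (x - Complex (c u) \<epsilon>) - norm (x - Complex (c u') \<epsilon>)\<bar> \<le>
          norm ((x - Complex (c u) \<epsilon>) - (x - Complex (c u') \<epsilon>))"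
        by (rule norm_triangle_ineq3)
      also have "(x - Complex (c u) \<epsilon>) - (x - Complex (c u') \<epsilon>) = of_real (c u' - c u)"
        by (simp add: complex_eq_iff)
      also have "norm (of_real (c u' - c u) :: complex) = 2 * \<bar>cos (2 * pi * u') - cos (2 * pi * u)\<bar>"
      proof -
        have "c u' - c u = 2 * (cos (2 * pi * u') - cos (2 * pi * u))" by (simp add: c_def)
        then show ?thesis by (simp only: norm_of_real abs_mult abs_numeral)
      qed
      also have "\<dots> \<le> 2 * \<bar>2 * pi * u' - 2 * pi * u\<bar>" by (intro mult_left_mono cos_diff_le) simp
      also have "2 * pi * u' - 2 * pi * u = 2 * pi * (u' - u)" by (simp add: right_diff_distrib)
      also have "2 * \<bar>2 * pi * (u' - u)\<bar> = 4 * pi * \<bar>u - u'\<bar>"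
        by (simp only: abs_mult abs_minus_commute[of u' u]) simp
      finally show ?thesis using \<epsilon> by (simp add: divide_right_mono)
    qed
  qed (use pq \<epsilon> in auto)
  also have "integral {0..1} (\<lambda>u. integral {0..1} (g u)) \<le> 2/3 * ln \<rho>0 + 1/3 * ln \<rho>1"
  proof -
    have ne: "of_real (2 * cos (2 * pi * v)) - Complex (c u) \<epsilon> \<noteq> 0" for u v
      using pos[of "2 * cos (2 * pi * v)" "c u"] by auto
    have "continuous_on UNIV (\<lambda>x. g (fst x) (snd x))"
      unfolding g_def c_def Complex_eq using ne unfolding c_def Complex_eq
      by (intro continuous_intros) auto
    then have "continuous_on (UNIV \<times> cbox 0 1) (\<lambda>(u, v). g u v)"
      by (auto simp: case_prod_unfold intro: continuous_on_subset)
    then have "continuous_on UNIV (\<lambda>u. integral (cbox 0 1) (g u))" by (rule integral_continuous_on_param)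
    then have int: "(\<lambda>u. integral {0..1} (g u)) integrable_on {0..1}"
      by (intro integrable_continuous_real) (auto intro: continuous_on_subset)
    have small: "integral {0..1} (g u) \<le> ln \<rho>0" if "\<bar>c u\<bar> \<le> 2" for u
      unfolding g_def using that \<rho> \<epsilon> by (intro integral_log_cos_le) auto
    have large: "integral {0..1} (g u) \<le> ln \<rho>1" for u
    proof -
      have "\<bar>c u\<bar> \<le> 3"
        using \<sigma> cos_le_one[of "2 * pi * u"] cos_ge_minus_one[of "2 * pi * u"] unfolding c_def by linarith
      then show ?thesis unfolding g_def using \<rho> \<epsilon> by (intro integral_log_cos_le) (auto simp: max_def)
    qed
    from \<sigma> show ?thesis
    proof
      assume "\<sigma> = 1"
      then have "integral {0..1} (\<lambda>u. integral {0..1} (g u)) \<le> ln \<rho>1 * (1 - (5/6 - 1/6)) + ln \<rho>0 * (5/6 - 1/6)"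
        using abs_slow_le_2(1) by (intro integral_step_le int small large) (auto simp: c_def)
      then show ?thesis by (simp add: mult.commute)
    next
      assume "\<sigma> = -1"
      then have "integral {0..1} (\<lambda>u. integral {0..1} (g u)) \<le> ln \<rho>0 * (1 - (2/3 - 1/3)) + ln \<rho>1 * (2/3 - 1/3)"
        using abs_slow_le_2(2) by (intro integral_step_le int small large) (auto simp: c_def)
      then show ?thesis by (simp add: mult.commute)
    qed
  qed
  finally show ?thesis unfolding g_def c_def by simp
qed

subsection \<open>Irreducibility of the non-cyclotomic part\<close>

lemma norm_poly_GT_circ:
  "norm (poly (cpoly (GT a b)) (circ t)) =
     \<bar>2 * cos (2 * pi * (real b * t)) - 2 * cos (2 * pi * (real a * t)) - 1\<bar>"
proof -
  have p: "circ t ^ n = circ (real n * t)" for n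
    using Complex.DeMoivre[of "2 * pi * t" n] by (simp add: mult_ac)
  have s: "circ x + inverse (circ x) = of_real (2 * cos (2 * pi * x))" for x
    by (simp add: complex_eq_iff)
  have "poly (cpoly (GT a b)) (circ t) = circ t ^ max a b *
      ((circ (real b * t) + inverse (circ (real b * t))) - (circ (real a * t) + inverse (circ (real a * t))) - 1)"
    unfolding poly_GT[OF cis_neq_zero] p by (simp add: algebra_simps)
  also have "\<dots> = circ t ^ max a b * of_real (2 * cos (2 * pi * (real b * t)) - 2 * cos (2 * pi * (real a * t)) - 1)"
    unfolding s by simp
  finally have "norm (poly (cpoly (GT a b)) (circ t)) = norm (circ t ^ max a b) *
      norm (of_real (2 * cos (2 * pi * (real b * t)) - 2 * cos (2 * pi * (real a * t)) - 1) :: complex)"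
    by (simp only: norm_mult)
  then show ?thesis by (simp only: norm_power norm_cis norm_of_real power_one mult_1)
qed

text \<open>An imaginary shift by \<open>\<epsilon>\<close> does not decrease the absolute value of a real number, and it removes the zeros.\<close>

lemma mahler_measure_GT_le:
  assumes ab: "a > 0" "b > 0" "a \<noteq> b"
    and \<epsilon>: "\<epsilon> > 0" and \<rho>: "\<rho>0 \<ge> 1" "\<rho>1 \<ge> 1" "2 + \<epsilon> \<le> \<rho>0 + inverse \<rho>0" "3 + \<epsilon> \<le> \<rho>1 + inverse \<rho>1"
  shows "mahler_measure (cpoly (GT a b)) \<le>
    exp (2/3 * ln \<rho>0 + 1/3 * ln \<rho>1 + 4 * pi / \<epsilon> * (real (min a b) / real (max a b)))"
proof -
  define p q where "p = min a b" and "q = max a b"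
  \<comment> \<open>Solving for the fast cosine: 2 cos B - (1 + 2 cos A) if \<open>b\<close> is
    larger, and 2 cos A - (-1 + 2 cos B), after a change of sign, if \<open>a\<close> is.\<close>
  define \<sigma> :: real where "\<sigma> = (if a < b then 1 else -1)"
  define X where "X t = of_real (2 * cos (2 * pi * (real q * t)))
       - Complex (\<sigma> + 2 * cos (2 * pi * (real p * t))) \<epsilon>" for t
  have pq: "p > 0" "q > 0" using ab by (auto simp: p_def q_def)
  interpret GT_nondegenerate a b using ab by unfold_locales
  have ne: "cpoly (GT a b) \<noteq> 0" using coeff_0_GT by (auto simp: cpoly_eq_0_iff)
  from jensen[OF ne] obtain J where J: "((\<lambda>t. ln (norm (poly (cpoly (GT a b)) (circ t)))) has_integral J) {0..1}"
    by blast
  define Z where "Z = {t \<in> {0..1}. poly (cpoly (GT a b)) (circ t) = 0}"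
  have X0: "X t \<noteq> 0" for t using \<epsilon> by (auto simp: X_def complex_eq_iff)
  have XGT: "norm (poly (cpoly (GT a b)) (circ t)) \<le> norm (X t)" for t
  proof -
    have "norm (poly (cpoly (GT a b)) (circ t)) = \<bar>Re (X t)\<bar>"
      unfolding norm_poly_GT_circ using ab by (auto simp: X_def \<sigma>_def p_def q_def max_def min_def)
    also have "\<dots> \<le> norm (X t)" by (rule abs_Re_le_cmod)
    finally show ?thesis .
  qed
  have "continuous_on {0..1} (\<lambda>t. ln (norm (X t)))"
    unfolding X_def Complex_eq using X0 unfolding X_def Complex_eq by (intro continuous_intros) auto
  then have X: "((\<lambda>t. ln (norm (X t))) has_integral integral {0..1} (\<lambda>t. ln (norm (X t)))) {0..1}"
    by (intro integrable_integral integrable_continuous_real)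
  \<comment> \<open>At zeros of \<open>GT a b\<close> the default value of \<open>ln\<close> need
    not lie below \<open>ln (norm (X t))\<close>, so the integrand is redefined there.\<close>
  have "((\<lambda>t. if t \<in> Z then ln (norm (X t)) else ln (norm (poly (cpoly (GT a b)) (circ t)))) has_integral J) {0..1}"
    using finite_poly_circ[OF ne] by (intro has_integral_spike_finite[OF _ _ J, of Z]) (auto simp: Z_def)
  then have "J \<le> integral {0..1} (\<lambda>t. ln (norm (X t)))"
  proof (rule has_integral_le[OF _ X])
    fix t :: real assume t: "t \<in> {0..1}"
    show "(if t \<in> Z then ln (norm (X t)) else ln (norm (poly (cpoly (GT a b)) (circ t)))) \<le> ln (norm (X t))"
    proof (cases "t \<in> Z")
      case False
      then have "norm (poly (cpoly (GT a b)) (circ t)) > 0" using t by (simp add: Z_def)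
      then show ?thesis using False XGT[of t] by (simp add: ln_mono)
    qed simp
  qed
  also have "\<dots> \<le> 2/3 * ln \<rho>0 + 1/3 * ln \<rho>1 + 4 * pi / \<epsilon> * (real p / real q)"
    unfolding X_def using \<epsilon> \<rho> pq by (intro integral_log_shifted_le) (auto simp: \<sigma>_def)
  finally show ?thesis using mahler_measure_eq[OF J] by (simp add: p_def q_def)
qed

text \<open>26181/10000 slightly exceeds (3 + sqrt 5)/2, the larger solution of x + 1/x = 3, and
  1001/1000 slightly exceeds the double solution 1 of x + 1/x = 2. After multiplication by 3 the
  claim compares 2.6234 with (47/40)^6 = 2.6316....\<close>

lemma exp_bound_numeric: "2/3 * ln (1001/1000) + 1/3 * ln (26181/10000) < 2 * ln (47/40 :: real)"
proof -
  have "2 * ln (1001/1000) + ln (26181/10000) = ln ((1001/1000)\<^sup>2 * (26181/10000) :: real)"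
    using ln_realpow[of "1001/1000" 2] by (subst ln_mult_pos) simp_all
  also have "\<dots> < ln ((47/40) ^ 6)"
    by (subst ln_less_cancel_iff) (simp_all add: power_divide)
  also have "\<dots> = 6 * ln (47/40)" using ln_realpow[of "47/40" 6] by simp
  finally show ?thesis by linarith
qed

lemma mahler_measure_GT_lt:
  obtains C :: real where "C \<ge> 30"
    "\<And>a b. a > 0 \<Longrightarrow> b > 0 \<Longrightarrow> max (real a / real b) (real b / real a) > C \<Longrightarrow>
       mahler_measure (cpoly (GT a b)) < (47/40)\<^sup>2"
proof
  \<comment> \<open>The slack that remains for the error term
    \<open>K * (real p / real q)\<close>.\<close>
  define gap where "gap = 2 * ln (47/40) - (2/3 * ln (1001/1000) + 1/3 * ln (26181/10000 :: real))"
  have gap: "gap > 0" using exp_bound_numeric by (simp add: gap_def)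
  \<comment> \<open>For x = 1001/1000 the excess of x + 1/x over 2 is only 1/1001000, and \<epsilon>
    has to fit below it.\<close>
  define \<epsilon> :: real where "\<epsilon> = 1 / 2000000"
  define K where "K = 4 * pi / \<epsilon>"
  have K: "K > 0" by (simp add: K_def \<epsilon>_def)
  \<comment> \<open>The bound 30 belongs to the degree argument for the quotient, not to the
    analytic estimate.\<close>
  show "max 30 (K / gap) \<ge> 30" by simp
  fix a b :: nat assume ab: "a > 0" "b > 0" and C: "max (real a / real b) (real b / real a) > max 30 (K / gap)"
  have ne: "a \<noteq> b" using C ab by auto
  define p q where "p = min a b" and "q = max a b"
  have pq: "real p > 0" "real q > 0" using ab by (auto simp: p_def q_def)
  have "max (real a / real b) (real b / real a) = real q / real p"
  proof (cases "a < b")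
    case True
    then have "real a / real b \<le> 1" "1 \<le> real b / real a" using ab by auto
    then have "real a / real b \<le> real b / real a" by (rule order_trans)
    then show ?thesis using True by (simp add: p_def q_def max_def)
  next
    case False
    then have "real b / real a \<le> 1" "1 \<le> real a / real b" using ab by auto
    then have "real b / real a \<le> real a / real b" by (rule order_trans)
    then show ?thesis using False by (simp add: p_def q_def max_def min_def)
  qed
  then have "real q / real p > K / gap" using C by simp
  then have small: "K * (real p / real q) < gap" using gap pq by (simp add: field_simps)
  have "mahler_measure (cpoly (GT a b)) \<le>
      exp (2/3 * ln (1001/1000) + 1/3 * ln (26181/10000) + K * (real p / real q))"
    unfolding K_def p_def q_def by (rule mahler_measure_GT_le[OF ab ne]) (simp_all add: \<epsilon>_def)
  also have "\<dots> < exp (2 * ln (47/40))" using small by (simp add: gap_def)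
  also have "\<dots> = (47/40)\<^sup>2" by (simp only: mult_2 exp_add power2_eq_square exp_ln)
  finally show "mahler_measure (cpoly (GT a b)) < (47/40)\<^sup>2" .
qed

text \<open>Every non-unit divisor of the quotient has measure at least 47/40, so two of them would
  exceed the bound for \<open>GT a b\<close>. That the quotient is not itself a unit needs a
  separate comparison of degrees.\<close>

lemma irreducible_GT_quotient:
  assumes L: lehmer_conjecture and pos: "a > 0" "b > 0"
    and C: "C \<ge> 30" "max (real a / real b) (real b / real a) > C"
    and M: "mahler_measure (cpoly (GT a b)) < (47/40)\<^sup>2"
  shows "irreducible (GT a b div CT a b)"
proof -
  define H where "H = GT a b div CT a b"
  have ne: "a \<noteq> b" using C pos by auto
  interpret GT_nondegenerate a b using pos ne by unfold_locales
  have GT: "GT a b = CT a b * H" unfolding H_def using CT_dvd_GT[OF pos(1)] by simp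
  have GT0: "GT a b \<noteq> 0" using coeff_0_GT by auto
  then have H0: "H \<noteq> 0" and CT0: "CT a b \<noteq> 0" using GT by auto
  have factor: "mahler_measure (cpoly p) \<ge> 47/40" if p: "p dvd H" "\<not> is_unit p" for p
  proof -
    have p0: "p \<noteq> 0" using p H0 by auto
    \<comment> \<open>The prime factor may be a constant prime number; the conjecture as formulated
      covers that case too.\<close>
    obtain f where f: "f dvd p" "prime f" using prime_divisor_exists[OF p0 p(2)] by blast
    then obtain h where h: "p = f * h" by (elim dvdE)
    have fh: "f \<noteq> 0" "h \<noteq> 0" using h p0 by auto
    have fH: "f dvd H" using f p dvd_trans by blast
    have "irreducible f" using f(2) by (simp add: prime_elem_imp_irreducible)
    moreover have "\<not> is_cyclotomic f"
    proof
      assume "is_cyclotomic f"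
      then obtain k where k: "k > 0" "f = cyclo k \<or> f = - cyclo k" by (auto simp: is_cyclotomic_def)
      then have "cyclo k dvd H" using fH by auto
      then show False using cyclo_not_dvd_quotient[OF k(1) pos] by (simp add: H_def)
    qed
    moreover have "coeff f 0 \<noteq> 0"
    proof -
      obtain g where "GT a b = f * g" using fH GT by (metis dvd_mult dvdE)
      then show ?thesis using coeff_0_GT by (auto simp: coeff_mult)
    qed
    then have "f \<noteq> [:0, 1:]" "f \<noteq> [:0, -1:]" by auto
    ultimately have "mahler_measure (cpoly f) \<ge> mahler_measure (cpoly lehmer_poly)"
      using L unfolding lehmer_conjecture_def by blast
    then have "47/40 \<le> mahler_measure (cpoly f) * 1" using mahler_measure_lehmer_ge by linarith
    also have "\<dots> \<le> mahler_measure (cpoly f) * mahler_measure (cpoly h)"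
      using fh mahler_measure_int_ge_1[of h] by (intro mult_left_mono) (simp_all add: mahler_measure_def)
    also have "\<dots> = mahler_measure (cpoly p)"
      unfolding h cpoly_mult using fh by (intro mahler_measure_mult[symmetric]) (simp_all add: cpoly_eq_0_iff)
    finally show ?thesis .
  qed
  have "irreducible H"
  proof (rule irreducibleI)
    show "H \<noteq> 0" by (rule H0)
    show "\<not> is_unit H"
    proof
      assume "is_unit H"
      then have "degree H = 0" by (auto simp: is_unit_poly_iff)
      then have "degree (GT a b) = degree (CT a b)" using GT H0 CT0 by (simp add: degree_mult_eq)
      \<comment> \<open>Since the gcd is at most the smaller exponent, the ratio of the exponents
        would be at most 30.\<close>
      then have "2 * max a b \<le> 60 * gcd a b" using degree_CT_le[OF pos(1), of b] degree_GT by simp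
      then have "max a b \<le> 30 * a" "max a b \<le> 30 * b"
        using gcd_le1_nat[of a b] gcd_le2_nat[of b a] pos by linarith+
      then have "real b \<le> 30 * real a" "real a \<le> 30 * real b" by linarith+
      then have "real b / real a \<le> 30" "real a / real b \<le> 30" using pos by (simp_all add: field_simps)
      with C show False by (simp add: max_def split: if_splits)
    qed
    fix p q assume pq: "H = p * q"
    show "is_unit p \<or> is_unit q"
    proof (rule ccontr)
      assume "\<not> (is_unit p \<or> is_unit q)"
      then have "47/40 \<le> mahler_measure (cpoly p)" "47/40 \<le> mahler_measure (cpoly q)"
        using factor[of p] factor[of q] pq by auto
      then have "(47/40)\<^sup>2 \<le> mahler_measure (cpoly p) * mahler_measure (cpoly q)"
        unfolding power2_eq_square by (intro mult_mono) auto
      also have "\<dots> = mahler_measure (cpoly H)"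
        unfolding pq cpoly_mult using H0 pq by (intro mahler_measure_mult[symmetric]) (auto simp: cpoly_eq_0_iff)
      also have "\<dots> \<le> mahler_measure (cpoly (CT a b)) * mahler_measure (cpoly H)"
        using mahler_measure_int_ge_1[OF CT0] mahler_measure_int_ge_1[OF H0] by (simp add: mult_le_cancel_right1)
      also have "\<dots> = mahler_measure (cpoly (GT a b))"
        unfolding GT cpoly_mult using H0 CT0 by (intro mahler_measure_mult[symmetric]) (simp_all add: cpoly_eq_0_iff)
      finally show False using M by simp
    qed
  qed
  then show ?thesis by (simp add: H_def)
qed

theorem theorem1p3:
  shows "(\<forall>a b :: nat. a > 0 \<and> b > 0 \<longrightarrow>
            (CT a b dvd GT a b
             \<and> (\<forall>k\<in>CT_indices a b. \<not> (cyclo k) ^ 2 dvd GT a b)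
             \<and> (\<forall>k>0. \<not> cyclo k dvd GT a b div CT a b))
          \<and> (a \<noteq> b \<longrightarrow>
               (\<exists>fs. GT a b = prod_list fs \<and> (\<forall>f\<in>set fs. irreducible f \<and> reciprocal f))))
       \<and> (lehmer_conjecture \<longrightarrow>
            (\<exists>C::real. \<forall>a b :: nat. a > 0 \<and> b > 0 \<and> max (real a / real b) (real b / real a) > C
               \<longrightarrow> irreducible (GT a b div CT a b)))"
proof (intro conjI allI impI)
  fix a b :: nat assume ab: "a > 0 \<and> b > 0"
  then have pos: "a > 0" "b > 0" by simp_all
  show "CT a b dvd GT a b" using pos by (intro CT_dvd_GT)
  show "\<forall>k\<in>CT_indices a b. \<not> (cyclo k) ^ 2 dvd GT a b"
    using tr_solution_of_mem_CT_indices(1) cyclo_square_not_dvd_GT pos by blast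
  show "\<not> cyclo k dvd GT a b div CT a b" if "k > 0" for k
    using cyclo_not_dvd_quotient[OF that pos] .
  assume "a \<noteq> b"
  then interpret GT_nondegenerate a b using pos by unfold_locales
  show "\<exists>fs. GT a b = prod_list fs \<and> (\<forall>f\<in>set fs. irreducible f \<and> reciprocal f)"
    by (rule GT_product_of_reciprocal)
next
  assume lehmer_conjecture
  obtain C :: real where "C \<ge> 30"
    "\<And>a b. a > 0 \<Longrightarrow> b > 0 \<Longrightarrow> max (real a / real b) (real b / real a) > C \<Longrightarrow>
       mahler_measure (cpoly (GT a b)) < (47/40)\<^sup>2"
    using mahler_measure_GT_lt by blast
  then show "\<exists>C::real. \<forall>a b :: nat. a > 0 \<and> b > 0 \<and> max (real a / real b) (real b / real a) > C
      \<longrightarrow> irreducible (GT a b div CT a b)"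
    using irreducible_GT_quotient[OF \<open>lehmer_conjecture\<close>] by blast
qed

end
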